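(* Let $\ell\in\{1,\ldots,d\}$. Suppose that all the model assumptions (A1)--(A6) listed in the context hold, and let $\widehat g_\ell$ be the hard thresholding wavelet estimator of $g_\ell$ defined in the context, built from $n\ge 2$ observations $(Y_1,\mathbf X_1),\ldots,(Y_n,\mathbf X_n)$. Suppose that $g_\ell\in \mathbf B^s_{p,q}(M)$ with $M>0$, $q\ge 1$, and either \{$p\ge 2$ and $s\in(0,R)$\} or \{$p\in[1,2)$ and $s\in(1/p,R)$\}. Then there exists a constant $C>0$, not depending on $n$, such that $$\mathbb E\left(\int_0^1(\widehat g_\ell(x)-g_\ell(x))^2dx\right)\le C\left(\frac{\ln n}{n}\right)^{2s/(2s+1)}.$$
   Context: **Model.** $d\ge1$ is an integer, $(Y_i,\mathbf X_i)_{i\in\mathbb Z}$ is a stationary $\mathbb R\times[0,1]^d$-valued process on a probability space, $\rho:\mathbb R\to\mathbb R$ is a given measurable function, and $g(\mathbf x)=\mathbb E(\rho(Y_1)\mid \mathbf X_1=\mathbf x)$, $\mathbf x\in[0,1]^d$. It is assumed that $g$ is additive: there are measurable $g_1,\ldots,g_d:[0,1]\to\mathbb R$ and $\mu\in\mathbb R$ with $g(\mathbf x)=\mu+\sum_{\ell=1}^d g_\ell(x_\ell)$. Write $\mathbf X_i=(X_{1,i},\ldots,X_{d,i})$. **Assumptions.** (A1) Each $X_{\ell,i}$ is uniformly distributed on $[0,1]$; the vectors $\mathbf X_i$ have a common (known) density $f$ on $[0,1]^d$. (A2) $\mathbb E(g_\ell(X_{\ell,i}))=0$ for all $\ell\in\{1,\ldots,d\}$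 and all $i$. (A3) (Exponential strong mixing) With $\alpha_m=\sup|\mathbb P(A\cap B)-\mathbb P(A)\mathbb P(B)|$, the supremum being over $A\in\sigma((Y_i,\mathbf X_i),i\le0)$ and $B\in\sigma((Y_i,\mathbf X_i),i\ge m)$, there are constants $\gamma>0$, $c>0$ with $\alpha_m\le\gamma e^{-cm}$ for every integer $m\ge1$. (A4) $\int_{\mathbb R}|\rho(y)|dy\le C_1<\infty$ and $\sup_{y\in\mathbb R}|\rho(y)|\le C_2<\infty$. (A5) $\inf_{\mathbf x\in[0,1]^d}f(\mathbf x)\ge c_0$ for a constant $c_0>0$. (A6) $(Y_0,\mathbf X_0)$ and $(Y_0,\mathbf X_0,Y_m,\mathbf X_m)$ have densities, and $h_m(y,\mathbf x,y_*,\mathbf x_* )=f_{(Y_0,\mathbf X_0,Y_m,\mathbf X_m)}(y,\mathbf x,y_*,\mathbf x_* )-f_{(Y_0,\mathbf X_0)}(y,\mathbf x)f_{(Y_0,\mathbf X_0)}(y_*,\mathbf x_* )$ satisfies $\sup_{m\in\{1,\ldots,n\}}\sup|h_m|\le C_3$ with a constant $C_3$ not depending on $n$. **Wavelets.** $R\ge1$ is an integer; $\phi,\psi$ are the compactly supported Daubechies $\mathrm{db}_{2R}$ scaling function and wavelet ($\psi$ has $R$ vanishing moments). $\phi_{j,k}(x)=2^{j/2}\phi(2^jx-k)$ and $\psi_{j,k}(x)=2^{j/2}\psi(2^jx-k)$, with an appropriate treatment at the boundaries of $[0,1]$, are such that for some integer $\tau$ with $2^\tau\ge 2R$ and every integer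 $j_*\ge\tau$, $\{\phi_{j_*,k}:0\le k\le 2^{j_*}-1\}\cup\{\psi_{j,k}:j\ge j_*,0\le k\le 2^j-1\}$ is an orthonormal basis of $\mathbb L_2([0,1])$. For all $j\ge\tau$ and $0\le k\le2^j-1$ these functions satisfy $\int_0^1\phi_{j,k}=2^{-j/2}$, $\int_0^1\psi_{j,k}=0$, and, with a constant $K$ independent of $j,k$: $\sup|\phi_{j,k}|\le K2^{j/2}$, $\sup|\psi_{j,k}|\le K2^{j/2}$, $\sup_x\sum_{k=0}^{2^j-1}|\phi_{j,k}(x)|\le K2^{j/2}$, $\int_0^1|\phi_{j,k}|\le K2^{-j/2}$, $\int_0^1|\psi_{j,k}|\le K2^{-j/2}$. For $\mathbf k=(k_1,\ldots,k_d)\in\{0,\ldots,2^j-1\}^d$, put $\Phi_{j,\mathbf k}(\mathbf x)=\prod_{v=1}^d\phi_{j,k_v}(x_v)$ and $\Psi_{j,\mathbf k,\ell}(\mathbf x)=\psi_{j,k_\ell}(x_\ell)\prod_{v\ne\ell}\phi_{j,k_v}(x_v)$. Write $\mathbf k_{-\ell}=(k_1,\ldots,k_{\ell-1},k_{\ell+1},\ldots,k_d)$ and $D_j^*=\{0,\ldots,2^j-1\}^{d-1}$. **Besov balls.** For $M>0$, $s\in(0,R)$, $p\ge1$, $q\ge1$, a function $h\in\mathbb L_2([0,1])$ belongs to $\mathbf B^s_{p,q}(M)$ if and only if its wavelet coefficients $\beta_{j,k}=\int_0^1h\psi_{j,k}$ satisfy $\left(\sum_{j=\tau}^\infty\left(2^{j(s+1/2-1/p)}\left(\sum_{k=0}^{2^j-1}|\beta_{j,k}|^p\right)^{1/p}\right)^q\right)^{1/q}\le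 M^*$, where $M^*>0$ is a constant depending on $M$. **Estimator.** For $k=k_\ell\in\{0,\ldots,2^j-1\}$ (the $\ell$-th coordinate of $\mathbf k$ fixed equal to $k$), $$\widehat a_{j,k,\ell}=\frac{2^{-j(d-1)/2}}{n}\sum_{i=1}^n\frac{\rho(Y_i)}{f(\mathbf X_i)}\sum_{\mathbf k_{-\ell}\in D_j^*}\Phi_{j,\mathbf k}(\mathbf X_i),\qquad \widehat b_{j,k,\ell}=\frac{2^{-j(d-1)/2}}{n}\sum_{i=1}^n\frac{\rho(Y_i)}{f(\mathbf X_i)}\sum_{\mathbf k_{-\ell}\in D_j^*}\Psi_{j,\mathbf k,\ell}(\mathbf X_i),$$ $\widehat\mu=\frac1n\sum_{i=1}^n\rho(Y_i)$, $\lambda_n=\sqrt{\ln n/n}$, and $$\widehat g_\ell(x)=\sum_{k=0}^{2^\tau-1}\widehat a_{\tau,k,\ell}\phi_{\tau,k}(x)+\sum_{j=\tau}^{j_1}\sum_{k=0}^{2^j-1}\widehat b_{j,k,\ell}\mathbf 1_{\{|\widehat b_{j,k,\ell}|\ge\kappa\lambda_n\}}\psi_{j,k}(x)-\widehat\mu,$$ where $j_1$ is the largest integer with $2^{j_1}\le n/(\ln n)^3$ (the sum over $j$ is empty if $j_1<\tau$). Here $\kappa>0$ is a large enough constant (not depending on $n,s,p,q,M$), namely one for which there is a constant $C'>0$ such that, with $b_{j,k,\ell}=2^{-j(d-1)/2}\int_{[0,1]^d}g(\mathbf x)\sum_{\mathbf k_{-\ell}\in D_j^*}\Psi_{j,\mathbf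 k,\ell}(\mathbf x)d\mathbf x$, one has $\mathbb P(|\widehat b_{j,k,\ell}-b_{j,k,\ell}|\ge\kappa\lambda_n/2)\le C'/n^4$ for all $n\ge2$, all $j\ge\tau$ with $2^j\le n/(\ln n)^3$ and all $k\in\{0,\ldots,2^j-1\}$; such a $\kappa$ exists under (A1)--(A6). *)

theory Defs
  imports "HOL-Probability.Probability" "HOL-Computational_Algebra.Polynomial"
begin

section \<open>Stochastic processes\<close>

definition stationary_process :: "'a measure \<Rightarrow> (int \<Rightarrow> 'a \<Rightarrow> 'b::topological_space) \<Rightarrow> bool" where
  "stationary_process M Z \<longleftrightarrow>
     (\<forall>i. Z i \<in> borel_measurable M) \<and>
     (\<forall>h. distr M (\<Pi>\<^sub>M i\<in>UNIV. borel) (\<lambda>\<omega> i. Z (i + h) \<omega>)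
        = distr M (\<Pi>\<^sub>M i\<in>UNIV. borel) (\<lambda>\<omega> i. Z i \<omega>))"

definition generated_events ::
    "'a measure \<Rightarrow> (int \<Rightarrow> 'a \<Rightarrow> 'b::topological_space) \<Rightarrow> int set \<Rightarrow> 'a set set" where
  "generated_events M Z I =
     sigma_sets (space M) {Z i -` B \<inter> space M | i B. i \<in> I \<and> B \<in> sets borel}"

definition alpha_mixing :: "'a measure \<Rightarrow> (int \<Rightarrow> 'a \<Rightarrow> 'b::topological_space) \<Rightarrow> nat \<Rightarrow> real" where
  "alpha_mixing M Z m =
     Sup {\<bar>measure M (A \<inter> B) - measure M A * measure M B\<bar> | A B.
            A \<in> generated_events M Z {..0} \<and> B \<in> generated_events M Z {int m..}}"

definition unit_cube :: "(real ^ 'd) set" where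
  "unit_cube = {x. \<forall>v. 0 \<le> x $ v \<and> x $ v \<le> 1}"

text \<open>\<open>g\<close> is a version of \<open>x \<mapsto> E(V | X = x)\<close>, where \<open>X\<close> takes its values in the set \<open>S\<close>.\<close>

definition regression_function ::
    "'a measure \<Rightarrow> ('a \<Rightarrow> real) \<Rightarrow> ('a \<Rightarrow> 'b::topological_space) \<Rightarrow> 'b set \<Rightarrow> ('b \<Rightarrow> real) \<Rightarrow> bool" where
  "regression_function M V X S g \<longleftrightarrow>
     g \<in> borel_measurable (restrict_space borel S) \<and>
     (AE \<omega> in M. real_cond_exp M (vimage_algebra (space M) X borel) V \<omega> = g (X \<omega>))"


section \<open>Orthonormal bases of \<open>L\<^sub>2([0,1])\<close>\<close>

definition L2_01 :: "(real \<Rightarrow> real) set" where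
  "L2_01 = {h. set_borel_measurable lborel {0..1} h \<and> set_integrable lborel {0..1} (\<lambda>x. (h x)\<^sup>2)}"

definition orthonormal_basis_01 :: "'i set \<Rightarrow> ('i \<Rightarrow> real \<Rightarrow> real) \<Rightarrow> bool" where
  "orthonormal_basis_01 I e \<longleftrightarrow>
     (\<forall>a\<in>I. e a \<in> L2_01) \<and>
     (\<forall>a\<in>I. \<forall>b\<in>I. (LBINT x:{0..1}. e a x * e b x) = (if a = b then 1 else 0)) \<and>
     (\<forall>h\<in>L2_01. \<forall>\<epsilon>>0. \<exists>F u. finite F \<and> F \<subseteq> I \<and>
        (LBINT x:{0..1}. (h x - (\<Sum>a\<in>F. u a * e a x))\<^sup>2) < \<epsilon>)"


section \<open>Daubechies wavelets\<close>

text \<open>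
  The filter of length \<open>2R\<close> is the coefficient sequence of a polynomial \<open>P\<close>: the zero of order \<open>R\<close>
  at \<open>-1\<close> amounts to \<open>R\<close> vanishing moments of the wavelet, and the absence of zeros in the
  open unit disc singles out the extremal phase solution among the spectral factors.
\<close>

definition daubechies_filter :: "nat \<Rightarrow> real poly \<Rightarrow> bool" where
  "daubechies_filter R P \<longleftrightarrow>
     degree P = 2 * R - 1 \<and>
     poly P 1 = sqrt 2 \<and>
     (\<forall>m. (\<Sum>k<2 * R. coeff P k * coeff P (k + 2 * m)) = (if m = 0 then 1 else 0)) \<and>
     [:1, 1:] ^ R dvd P \<and>
     (\<forall>z::complex. norm z < 1 \<longrightarrow> poly (map_poly of_real P) z \<noteq> 0)"

text \<open>Translates are normalised so that both functions are supported in \<open>[0, 2R - 1]\<close>.\<close>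

definition daubechies_pair :: "nat \<Rightarrow> (real \<Rightarrow> real) \<Rightarrow> (real \<Rightarrow> real) \<Rightarrow> bool" where
  "daubechies_pair R \<phi> \<psi> \<longleftrightarrow>
     (\<exists>P. daubechies_filter R P \<and>
        integrable lborel \<phi> \<and> (LBINT x. \<phi> x) = 1 \<and>
        (\<forall>x. x \<notin> {0..2 * real R - 1} \<longrightarrow> \<phi> x = 0) \<and>
        (\<forall>x. \<phi> x = sqrt 2 * (\<Sum>k<2 * R. coeff P k * \<phi> (2 * x - real k))) \<and>
        (\<forall>x. \<psi> x = sqrt 2 * (\<Sum>k<2 * R. (-1) ^ k * coeff P (2 * R - 1 - k) * \<phi> (2 * x - real k))))"

text \<open>
  \<open>\<phi>w j k\<close> and \<open>\<psi>w j k\<close> are the scaling functions and wavelets on \<open>[0,1]\<close>, for \<open>j \<ge> \<tau>\<close> and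
  \<open>k < 2 ^ j\<close>. Those whose dilated translate lives in \<open>[0,1]\<close> are this dilated translate; the
  correction at the boundary is only subject to the stated properties. The endpoints are left
  out of the former condition so as not to exclude periodisation when \<open>R = 1\<close>.
\<close>

definition wavelet_system_01 ::
    "nat \<Rightarrow> nat \<Rightarrow> real \<Rightarrow> (real \<Rightarrow> real) \<Rightarrow> (real \<Rightarrow> real) \<Rightarrow>
     (nat \<Rightarrow> nat \<Rightarrow> real \<Rightarrow> real) \<Rightarrow> (nat \<Rightarrow> nat \<Rightarrow> real \<Rightarrow> real) \<Rightarrow> bool" where
  "wavelet_system_01 R \<tau> K \<phi> \<psi> \<phi>w \<psi>w \<longleftrightarrow>
     daubechies_pair R \<phi> \<psi> \<and>
     2 * R \<le> 2 ^ \<tau> \<and>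
     (\<forall>j\<ge>\<tau>. \<forall>k<2 ^ j. (\<forall>x. x \<notin> {0..1} \<longrightarrow> \<phi> (2 ^ j * x - real k) = 0) \<longrightarrow>
        (\<forall>x\<in>{0<..<1}. \<phi>w j k x = 2 powr (real j / 2) * \<phi> (2 ^ j * x - real k))) \<and>
     (\<forall>j\<ge>\<tau>. \<forall>k<2 ^ j. (\<forall>x. x \<notin> {0..1} \<longrightarrow> \<psi> (2 ^ j * x - real k) = 0) \<longrightarrow>
        (\<forall>x\<in>{0<..<1}. \<psi>w j k x = 2 powr (real j / 2) * \<psi> (2 ^ j * x - real k))) \<and>
     (\<forall>j0\<ge>\<tau>. orthonormal_basis_01
        ({..<2 ^ j0} <+> (SIGMA j:{j0..}. {..<2 ^ j}))
        (case_sum (\<lambda>k. \<phi>w j0 k) (\<lambda>(j, k). \<psi>w j k))) \<and>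
     (\<forall>j\<ge>\<tau>. \<forall>k<2 ^ j.
        (LBINT x:{0..1}. \<phi>w j k x) = 2 powr (- real j / 2) \<and>
        (LBINT x:{0..1}. \<psi>w j k x) = 0 \<and>
        (\<forall>x\<in>{0..1}. \<bar>\<phi>w j k x\<bar> \<le> K * 2 powr (real j / 2)) \<and>
        (\<forall>x\<in>{0..1}. \<bar>\<psi>w j k x\<bar> \<le> K * 2 powr (real j / 2)) \<and>
        (LBINT x:{0..1}. \<bar>\<phi>w j k x\<bar>) \<le> K * 2 powr (- real j / 2) \<and>
        (LBINT x:{0..1}. \<bar>\<psi>w j k x\<bar>) \<le> K * 2 powr (- real j / 2)) \<and>
     (\<forall>j\<ge>\<tau>. \<forall>x\<in>{0..1}. (\<Sum>k<2 ^ j. \<bar>\<phi>w j k x\<bar>) \<le> K * 2 powr (real j / 2))"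

definition wavelet_coeff :: "(nat \<Rightarrow> nat \<Rightarrow> real \<Rightarrow> real) \<Rightarrow> (real \<Rightarrow> real) \<Rightarrow> nat \<Rightarrow> nat \<Rightarrow> real" where
  "wavelet_coeff \<psi>w h j k = (LBINT x:{0..1}. h x * \<psi>w j k x)"

definition besov_term ::
    "(nat \<Rightarrow> nat \<Rightarrow> real \<Rightarrow> real) \<Rightarrow> real \<Rightarrow> real \<Rightarrow> real \<Rightarrow> (real \<Rightarrow> real) \<Rightarrow> nat \<Rightarrow> real" where
  "besov_term \<psi>w s p q h j =
     (2 powr (real j * (s + 1 / 2 - 1 / p)) *
      (\<Sum>k<2 ^ j. \<bar>wavelet_coeff \<psi>w h j k\<bar> powr p) powr (1 / p)) powr q"

text \<open>The radius argument is the bound \<open>M\<^sup>*\<close> on the sequence norm.\<close>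

definition besov_ball ::
    "(nat \<Rightarrow> nat \<Rightarrow> real \<Rightarrow> real) \<Rightarrow> nat \<Rightarrow> real \<Rightarrow> real \<Rightarrow> real \<Rightarrow> real \<Rightarrow> (real \<Rightarrow> real) set" where
  "besov_ball \<psi>w \<tau> s p q Mstar =
     {h \<in> L2_01. summable (\<lambda>i. besov_term \<psi>w s p q h (\<tau> + i)) \<and>
                 (\<Sum>i. besov_term \<psi>w s p q h (\<tau> + i)) powr (1 / q) \<le> Mstar}"


section \<open>The hard thresholding estimator\<close>

definition tensor_phi ::
    "(nat \<Rightarrow> nat \<Rightarrow> real \<Rightarrow> real) \<Rightarrow> nat \<Rightarrow> ('d::finite \<Rightarrow> nat) \<Rightarrow> real ^ 'd \<Rightarrow> real" where
  "tensor_phi \<phi>w j k x = (\<Prod>v\<in>UNIV. \<phi>w j (k v) (x $ v))"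

definition tensor_psi ::
    "(nat \<Rightarrow> nat \<Rightarrow> real \<Rightarrow> real) \<Rightarrow> (nat \<Rightarrow> nat \<Rightarrow> real \<Rightarrow> real) \<Rightarrow>
     nat \<Rightarrow> ('d::finite \<Rightarrow> nat) \<Rightarrow> 'd \<Rightarrow> real ^ 'd \<Rightarrow> real" where
  "tensor_psi \<phi>w \<psi>w j k l x = \<psi>w j (k l) (x $ l) * (\<Prod>v\<in>UNIV - {l}. \<phi>w j (k v) (x $ v))"

text \<open>
  Summing over \<open>k\<^sub>-\<^sub>l\<close> in \<open>D\<^sub>j\<^sup>*\<close> with the \<open>l\<close>-th coordinate fixed to \<open>k0\<close> is rendered as
  summing over the full multi-indices whose \<open>l\<close>-th coordinate is \<open>k0\<close>.
\<close>

definition multi_indices :: "nat \<Rightarrow> 'd::finite \<Rightarrow> nat \<Rightarrow> ('d \<Rightarrow> nat) set" where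
  "multi_indices j l k0 = {k. (\<forall>v. k v < 2 ^ j) \<and> k l = k0}"

definition a_hat ::
    "(nat \<Rightarrow> nat \<Rightarrow> real \<Rightarrow> real) \<Rightarrow> (real \<Rightarrow> real) \<Rightarrow> (real ^ 'd \<Rightarrow> real) \<Rightarrow>
     (int \<Rightarrow> 'a \<Rightarrow> real) \<Rightarrow> (int \<Rightarrow> 'a \<Rightarrow> real ^ 'd) \<Rightarrow> nat \<Rightarrow> nat \<Rightarrow> nat \<Rightarrow> 'd::finite \<Rightarrow> 'a \<Rightarrow> real" where
  "a_hat \<phi>w \<rho> f Y X n j k0 l \<omega> =
     2 powr (- (real j * (real CARD('d) - 1)) / 2) / real n *
     (\<Sum>i=1..int n. \<rho> (Y i \<omega>) / f (X i \<omega>) *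
        (\<Sum>k\<in>multi_indices j l k0. tensor_phi \<phi>w j k (X i \<omega>)))"

definition b_hat ::
    "(nat \<Rightarrow> nat \<Rightarrow> real \<Rightarrow> real) \<Rightarrow> (nat \<Rightarrow> nat \<Rightarrow> real \<Rightarrow> real) \<Rightarrow>
     (real \<Rightarrow> real) \<Rightarrow> (real ^ 'd \<Rightarrow> real) \<Rightarrow>
     (int \<Rightarrow> 'a \<Rightarrow> real) \<Rightarrow> (int \<Rightarrow> 'a \<Rightarrow> real ^ 'd) \<Rightarrow> nat \<Rightarrow> nat \<Rightarrow> nat \<Rightarrow> 'd::finite \<Rightarrow> 'a \<Rightarrow> real" where
  "b_hat \<phi>w \<psi>w \<rho> f Y X n j k0 l \<omega> =
     2 powr (- (real j * (real CARD('d) - 1)) / 2) / real n *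
     (\<Sum>i=1..int n. \<rho> (Y i \<omega>) / f (X i \<omega>) *
        (\<Sum>k\<in>multi_indices j l k0. tensor_psi \<phi>w \<psi>w j k l (X i \<omega>)))"

definition b_true ::
    "(nat \<Rightarrow> nat \<Rightarrow> real \<Rightarrow> real) \<Rightarrow> (nat \<Rightarrow> nat \<Rightarrow> real \<Rightarrow> real) \<Rightarrow>
     (real ^ 'd \<Rightarrow> real) \<Rightarrow> nat \<Rightarrow> nat \<Rightarrow> 'd::finite \<Rightarrow> real" where
  "b_true \<phi>w \<psi>w g j k0 l =
     2 powr (- (real j * (real CARD('d) - 1)) / 2) *
     (LINT x:unit_cube|lborel. g x * (\<Sum>k\<in>multi_indices j l k0. tensor_psi \<phi>w \<psi>w j k l x))"

definition mu_hat :: "(real \<Rightarrow> real) \<Rightarrow> (int \<Rightarrow> 'a \<Rightarrow> real) \<Rightarrow> nat \<Rightarrow> 'a \<Rightarrow> real" where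
  "mu_hat \<rho> Y n \<omega> = (\<Sum>i=1..int n. \<rho> (Y i \<omega>)) / real n"

definition noise_level :: "nat \<Rightarrow> real" where
  "noise_level n = sqrt (ln (real n) / real n)"

text \<open>An integer, which is negative when \<open>n < (ln n)\<^sup>3\<close>.\<close>

definition max_level :: "nat \<Rightarrow> int" where
  "max_level n = (GREATEST j. 2 powr real_of_int j \<le> real n / ln (real n) ^ 3)"

definition g_hat ::
    "nat \<Rightarrow> (nat \<Rightarrow> nat \<Rightarrow> real \<Rightarrow> real) \<Rightarrow> (nat \<Rightarrow> nat \<Rightarrow> real \<Rightarrow> real) \<Rightarrow>
     (real \<Rightarrow> real) \<Rightarrow> (real ^ 'd \<Rightarrow> real) \<Rightarrow>
     (int \<Rightarrow> 'a \<Rightarrow> real) \<Rightarrow> (int \<Rightarrow> 'a \<Rightarrow> real ^ 'd) \<Rightarrow> real \<Rightarrow> nat \<Rightarrow> 'd::finite \<Rightarrow> 'a \<Rightarrow> real \<Rightarrow> real" where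
  "g_hat \<tau> \<phi>w \<psi>w \<rho> f Y X \<kappa> n l \<omega> x =
     (\<Sum>k<2 ^ \<tau>. a_hat \<phi>w \<rho> f Y X n \<tau> k l \<omega> * \<phi>w \<tau> k x) +
     (\<Sum>j | \<tau> \<le> j \<and> int j \<le> max_level n. \<Sum>k<2 ^ j.
        b_hat \<phi>w \<psi>w \<rho> f Y X n j k l \<omega> *
        (if \<bar>b_hat \<phi>w \<psi>w \<rho> f Y X n j k l \<omega>\<bar> \<ge> \<kappa> * noise_level n then 1 else 0) *
        \<psi>w j k x) -
     mu_hat \<rho> Y n \<omega>"

end

theory Submission
  imports Defs "HOL-Real_Asymp.Real_Asymp"
begin

text \<open>
  The constant function has scaling coefficients \<open>2 powr (- j / 2)\<close> and vanishing wavelet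
  coefficients, so \<open>\<Sum>k. \<phi>w j k = 2 powr (j / 2)\<close> almost everywhere on \<open>[0,1]\<close>. Summing over
  \<open>k\<^sub>-\<^sub>l\<close> therefore removes all the coordinates but the \<open>l\<close>-th: \<open>b_hat\<close> is an unbiased estimator
  of the wavelet coefficient of \<open>gl l\<close>, and \<open>a_hat\<close> of the scaling coefficient of \<open>\<mu> + gl l\<close>.

  By Parseval the risk splits into four parts. The errors of \<open>a_hat\<close> at level \<open>\<tau>\<close> and of
  \<open>mu_hat\<close> are \<open>O(1/n)\<close> by a covariance inequality for bounded mixing variables. Off an event
  of probability \<open>C' / n^4\<close>, on which the error is at most of the order \<open>2^j\<close>, hard thresholding
  costs at most \<open>min \<beta>\<^sup>2 (9/4 \<kappa>\<^sup>2 ln n / n)\<close> per coefficient; this is summed over the levels by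
  comparing \<open>2^j\<close> with \<open>(n / ln n) powr (1 / (2 s + 1))\<close>. The levels above the maximal one are
  negligible by the Besov condition.
\<close>

section \<open>Rates\<close>

text \<open>The identity for the sum of the scaling functions holds only almost everywhere, which
  forces two treatments of the other coordinates: inside Lebesgue integrals the sum is replaced by
  its value, while pointwise bounds on the estimators use the supremum bound, at the price of a
  factor \<open>K\<close> per coordinate. The case \<open>p > 2\<close> is reduced to
  \<open>p = 2\<close>, so that one interpolation of \<open>min (x^2) a\<close> serves all cases.
  Above the maximal level the coefficients contribute the power \<open>- t\<close> of
  \<open>n / (ln n)^3\<close>, where \<open>t = 2 * s\<close> for \<open>p = 2\<close> and, thanks
  to \<open>1 / p < s\<close>, \<open>t > 1\<close> for \<open>p < 2\<close>. In both cases
  \<open>t\<close> strictly exceeds the rate exponent, and this gap absorbs every logarithm. The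
  power \<open>n^4\<close> in the deviation bound pays for crude errors: the sum over the levels of
  \<open>2^j\<close> coefficients with errors of order \<open>2^j\<close> is \<open>O(n^2)\<close>,
  so order \<open>1 / n^2\<close> remains. The basis property is given as density of finite
  combinations; Parseval therefore enters only through finite sums.\<close>

lemma sum_power2_le:
  fixes x :: real
  assumes "finite J" "\<And>j. j \<in> J \<Longrightarrow> 2 ^ j \<le> x" "0 \<le> x"
  shows "(\<Sum>j\<in>J. 2 ^ j) \<le> 2 * x"
proof (cases "J = {}")
  case False
  have "(\<Sum>j\<in>J. 2 ^ j) \<le> (\<Sum>j\<le>Max J. (2::real) ^ j)"
    using assms(1) by (intro sum_mono2) auto
  also have "\<dots> = 2 * 2 ^ Max J - 1"
    by (simp add: sum_gp_basic[of "2::real", simplified] sum_gp0)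
  also have "\<dots> \<le> 2 * x"
    using assms(2)[of "Max J"] assms(1) False by simp
  finally show ?thesis .
qed (use assms in auto)

text \<open>A geometric sum is at most its first term divided by \<open>1 - 2 powr - r\<close>. The
  set \<open>J\<close> may have gaps: its elements are shifted by its minimum and compared with the
  full series.\<close>

lemma sum_powr_minus_le:
  fixes x r :: real
  assumes J: "finite J" and x: "0 < x" "\<And>j. j \<in> J \<Longrightarrow> x \<le> 2 ^ j" and r: "0 < r"
  shows "(\<Sum>j\<in>J. 2 powr (- (r * real j))) \<le> x powr - r / (1 - 2 powr - r)"
proof -
  define q where "q = 2 powr - r"
  have q: "0 < q" "q < 1"
    using r by (auto simp: q_def powr_less_one)
  show ?thesis
  proof (cases "J = {}")
    case True
    then show ?thesis using q x by (simp add: q_def)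
  next
    case False
    define m where "m = Min J"
    have m: "m \<in> J" "\<And>j. j \<in> J \<Longrightarrow> m \<le> j"
      using J False by (auto simp: m_def)
    have eq: "2 powr (- (r * real j)) = q ^ j" for j
      by (simp add: q_def powr_powr flip: powr_realpow)
    have "(\<Sum>j\<in>J. q ^ j) = (\<Sum>j\<in>J. q ^ m * q ^ (j - m))"
      using m(2) by (intro sum.cong) (auto simp flip: power_add)
    also have "\<dots> = q ^ m * (\<Sum>i\<in>(\<lambda>j. j - m) ` J. q ^ i)"
    proof -
      have "inj_on (\<lambda>j. j - m) J"
        using m(2) by (auto intro!: inj_onI) (metis le_add_diff_inverse2)
      then show ?thesis
        by (simp add: sum.reindex sum_distrib_left)
    qed
    also have "\<dots> \<le> q ^ m * (1 / (1 - q))"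
      using q J sum_le_suminf[of "\<lambda>i. q ^ i" "(\<lambda>j. j - m) ` J"]
      by (intro mult_left_mono) (auto simp: suminf_geometric)
    also have "q ^ m \<le> x powr - r"
    proof -
      have "q ^ m = (2 ^ m) powr - r"
        by (simp add: q_def powr_powr mult.commute flip: powr_realpow)
      also have "\<dots> \<le> x powr - r"
        using x(2)[OF m(1)] x(1) r by (intro powr_mono2') auto
      finally show ?thesis .
    qed
    finally show ?thesis
      using q by (simp add: eq q_def divide_right_mono mult_right_mono)
  qed
qed

text \<open>The cut is at \<open>2 ^ j = x\<close>: the growing bound is summed below it and the
  decaying one above it, so each sum is governed by its value at the cut. This is the usual balance
  of variance and bias.\<close>

lemma sum_min_geometric_le:
  fixes u :: "nat \<Rightarrow> real" and a b r x :: real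
  assumes J: "finite J" and "0 < x" "0 < r" "0 \<le> a" "0 \<le> b"
    and up: "\<And>j. j \<in> J \<Longrightarrow> u j \<le> a * 2 ^ j"
    and down: "\<And>j. j \<in> J \<Longrightarrow> u j \<le> b * 2 powr (- (r * real j))"
  shows "(\<Sum>j\<in>J. u j) \<le> 2 * (a * x) + b * x powr - r / (1 - 2 powr - r)"
proof -
  define J1 where "J1 = {j\<in>J. 2 ^ j \<le> x}"
  define J2 where "J2 = {j\<in>J. x < 2 ^ j}"
  have fin: "finite J1" "finite J2"
    using J by (auto simp: J1_def J2_def)
  have "J = J1 \<union> J2" "J1 \<inter> J2 = {}"
    by (auto simp: J1_def J2_def)
  then have "(\<Sum>j\<in>J. u j) = (\<Sum>j\<in>J1. u j) + (\<Sum>j\<in>J2. u j)"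
    using fin by (simp add: sum.union_disjoint)
  also have "(\<Sum>j\<in>J1. u j) \<le> a * (\<Sum>j\<in>J1. 2 ^ j)"
    unfolding sum_distrib_left by (intro sum_mono up) (auto simp: J1_def)
  also have "\<dots> \<le> a * (2 * x)"
    using assms fin by (intro mult_left_mono sum_power2_le) (auto simp: J1_def)
  also have "(\<Sum>j\<in>J2. u j) \<le> b * (\<Sum>j\<in>J2. 2 powr (- (r * real j)))"
    unfolding sum_distrib_left by (intro sum_mono down) (auto simp: J2_def)
  also have "\<dots> \<le> b * (x powr - r / (1 - 2 powr - r))"
    using assms fin by (intro mult_left_mono sum_powr_minus_le) (auto simp: J2_def)
  finally show ?thesis
    by simp
qed

text \<open>A strict gap between the exponents beats every power of the logarithm, so the quotient
  tends to 0. A convergent sequence is bounded, which settles the small \<open>n\<close> as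
  well.\<close>

lemma log_power_rate_bound:
  fixes t \<theta> :: real
  assumes "0 < \<theta>" "\<theta> < t"
  shows "\<exists>C>0. \<forall>n\<ge>2. (real n / ln (real n) ^ 3) powr - t \<le> C * (ln (real n) / real n) powr \<theta>"
proof -
  define F where "F = (\<lambda>n. (real n / ln (real n) ^ 3) powr - t / (ln (real n) / real n) powr \<theta>)"
  have "F \<longlonglongrightarrow> 0"
    unfolding F_def using assms by real_asymp
  then obtain C where C: "C > 0" "\<And>n. norm (F n) \<le> C"
    using convergent_imp_Bseq[of F] by (auto simp: convergent_def Bseq_def)
  show ?thesis
  proof (intro exI[of _ C] conjI allI impI C(1))
    fix n :: nat assume "2 \<le> n"
    then have "0 < (ln (real n) / real n) powr \<theta>" by simp
    moreover have "F n \<le> C" using C(2)[of n] by simp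
    ultimately show "(real n / ln (real n) ^ 3) powr - t \<le> C * (ln (real n) / real n) powr \<theta>"
      by (simp add: F_def pos_divide_le_eq)
  qed
qed

lemma half_le_ln:
  assumes "2 \<le> n"
  shows "1 / 2 \<le> ln (real n)"
proof -
  have "ln (inverse (real n)) \<le> inverse (real n) - 1"
    using assms by (intro ln_le_minus_one) auto
  moreover have "inverse (real n) \<le> 1 / 2"
    using assms by (simp add: field_simps)
  ultimately show ?thesis
    using assms by (simp add: ln_inverse)
qed

text \<open>Serves to absorb errors of order \<open>1 / n\<close> in the rate. Since
  \<open>d = ln n / n\<close> is at most 1, the power \<theta> < 1 only enlarges it; the factor 2 is
  the price of \<open>1 / 2 \<le> ln n\<close>.\<close>

lemma inverse_le_rate:
  fixes \<theta> :: real
  assumes n: "2 \<le> n" and "0 < \<theta>" "\<theta> < 1"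
  shows "1 / real n \<le> 2 * (ln (real n) / real n) powr \<theta>"
proof -
  define d where "d = ln (real n) / real n"
  have "0 < d" "d \<le> 1"
    using n ln_le_minus_one[of "real n"] by (auto simp: d_def)
  then have "d powr 1 \<le> d powr \<theta>"
    using assms by (intro powr_mono') auto
  then have *: "ln (real n) / real n \<le> (ln (real n) / real n) powr \<theta>"
    using \<open>0 < d\<close> unfolding d_def[symmetric] by simp
  have "1 / real n \<le> 2 * (ln (real n) / real n)"
    using half_le_ln[OF n] n by (simp add: field_simps)
  then show "1 / real n \<le> 2 * (ln (real n) / real n) powr \<theta>"
    using * by linarith
qed

text \<open>\<open>max_level\<close> is the floor of a base 2 logarithm. It is negative when the
  quotient is below 1, and then both sides are false for every natural \<open>j\<close>, in
  accordance with an empty sum over the levels.\<close>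

lemma le_max_level_iff:
  assumes "2 \<le> n"
  shows "int j \<le> max_level n \<longleftrightarrow> 2 ^ j \<le> real n / ln (real n) ^ 3"
proof -
  define y where "y = real n / ln (real n) ^ 3"
  have "0 < y" using assms by (simp add: y_def)
  have "max_level n = \<lfloor>log 2 y\<rfloor>"
    unfolding max_level_def y_def[symmetric]
    using \<open>0 < y\<close> by (intro Greatest_equality) (auto simp: powr_le_iff le_floor_iff)
  then have "int j \<le> max_level n \<longleftrightarrow> 2 powr real j \<le> y"
    using \<open>0 < y\<close> by (simp add: le_floor_iff powr_le_iff)
  then show ?thesis
    by (simp add: powr_realpow y_def)
qed

lemma finite_levels:
  fixes y :: real
  shows "finite {j. \<tau> \<le> j \<and> 2 ^ j \<le> y}"
proof -
  obtain m where "y < 2 ^ m"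
    using real_arch_pow[of 2 y] by auto
  then have "j < m" if "2 ^ j \<le> y" for j
    using that power_strict_increasing_iff[of "2::real" j m] by linarith
  then have "{j. \<tau> \<le> j \<and> 2 ^ j \<le> y} \<subseteq> {..<m}" by auto
  then show ?thesis by (rule finite_subset) simp
qed

section \<open>Besov balls in terms of the coefficients of a single level\<close>

lemma besov_ball_level_bound:
  assumes h: "h \<in> besov_ball \<psi>w \<tau> s p q Ms" and pq: "1 \<le> p" "1 \<le> q" and j: "\<tau> \<le> j" and "0 < Ms"
  shows "(\<Sum>k<2 ^ j. \<bar>wavelet_coeff \<psi>w h j k\<bar> powr p) \<le> Ms powr p * 2 powr (- (real j * (p * (s + 1 / 2) - 1)))"
proof -
  let ?t = "\<lambda>i. besov_term \<psi>w s p q h (\<tau> + i)"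
  define S where "S = (\<Sum>k<2 ^ j. \<bar>wavelet_coeff \<psi>w h j k\<bar> powr p)"
  define a where "a = 2 powr (real j * (s + 1 / 2 - 1 / p))"
  have "0 \<le> S" by (auto simp: S_def intro: sum_nonneg)
  have "0 < a" by (simp add: a_def)
  have sm: "summable ?t" and le: "(\<Sum>i. ?t i) powr (1 / q) \<le> Ms"
    using h by (auto simp: besov_ball_def)
  have nn: "0 \<le> ?t i" for i by (simp add: besov_term_def)
  \<comment> \<open>One term of a series of nonnegative terms is at most the sum. The q-th root then
    removes \<open>q\<close>, and the p-th power turns the weight exponent into
    \<open>p * (s + 1 / 2) - 1\<close>.\<close>
  have "?t (j - \<tau>) \<le> (\<Sum>i. ?t i)"
    using sum_le_suminf[OF sm, of "{j - \<tau>}"] nn by simp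
  then have "?t (j - \<tau>) powr (1 / q) \<le> (\<Sum>i. ?t i) powr (1 / q)"
    using nn pq by (intro powr_mono2) auto
  moreover have "?t (j - \<tau>) powr (1 / q) = a * S powr (1 / p)"
    using j pq by (simp add: besov_term_def powr_powr S_def a_def)
  ultimately have "a * S powr (1 / p) \<le> Ms" using le by simp
  then have "S powr (1 / p) \<le> Ms / a"
    using \<open>0 < a\<close> by (simp add: field_simps)
  then have "(S powr (1 / p)) powr p \<le> (Ms / a) powr p"
    using pq by (intro powr_mono2) auto
  also have "(S powr (1 / p)) powr p = S"
    using pq \<open>0 \<le> S\<close> by (simp add: powr_powr)
  also have "(Ms / a) powr p = Ms powr p * 2 powr (- (real j * (p * (s + 1 / 2) - 1)))"
  proof -
    have e: "(s + 1 / 2 - 1 / p) * p = p * (s + 1 / 2) - 1"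
      using pq by (subst left_diff_distrib) (simp add: mult.commute)
    have "a powr p = 2 powr (real j * ((s + 1 / 2 - 1 / p) * p))"
      by (simp add: a_def powr_powr mult.assoc)
    then have "a powr p = 2 powr (real j * (p * (s + 1 / 2) - 1))"
      unfolding e .
    moreover have "(Ms / a) powr p = Ms powr p / a powr p"
      using \<open>0 < Ms\<close> \<open>0 < a\<close> by (simp add: powr_divide)
    ultimately show ?thesis
      by (simp only: powr_minus divide_inverse)
  qed
  finally show ?thesis by (simp add: S_def)
qed

text \<open>Beyond \<open>w\<close> the exponent \<open>2 - p \<le> 0\<close> gives
  \<open>x powr (2 - p) \<le> w powr (2 - p)\<close>; up to \<open>w\<close> the second summand
  alone suffices.\<close>

lemma square_le_powr_add:
  fixes x w p :: real
  assumes "2 \<le> p" "0 < w" "0 \<le> x"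
  shows "x\<^sup>2 \<le> x powr p * w powr (2 - p) + w\<^sup>2"
proof (cases "x \<le> w")
  case True
  then have "x\<^sup>2 \<le> w\<^sup>2" using assms by (intro power_mono) auto
  moreover have "0 \<le> x powr p * w powr (2 - p)" by simp
  ultimately show ?thesis by linarith
next
  case False
  then have "0 < x" using assms by linarith
  then have "x\<^sup>2 = x powr p * x powr (2 - p)"
    by (simp add: powr_add[symmetric])
  also have "\<dots> \<le> x powr p * w powr (2 - p)"
    using False assms by (intro mult_left_mono powr_mono2') auto
  finally show ?thesis by (simp add: add.commute add_increasing)
qed

lemma square_powr: "(x\<^sup>2) powr a = \<bar>x\<bar> powr (2 * a)" for x a :: real
proof (cases "x = 0")
  case False
  then have "x\<^sup>2 = \<bar>x\<bar> powr 2" by simp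
  then show ?thesis by (metis powr_powr)
qed simp

text \<open>A minimum is at most any weighted geometric mean, here with weight \<open>p / 2\<close>
  on the square and \<open>1 - p / 2\<close> on \<open>a\<close>.\<close>

lemma min_square_le_powr:
  fixes x a p :: real
  assumes p: "1 \<le> p" "p \<le> 2" and "0 < a"
  shows "min (x\<^sup>2) a \<le> \<bar>x\<bar> powr p * a powr (1 - p / 2)"
proof (cases "x = 0")
  case False
  show ?thesis
  proof (cases "x\<^sup>2 \<le> a")
    case True
    have "x\<^sup>2 = \<bar>x\<bar> powr p * \<bar>x\<bar> powr (2 - p)"
      using False by (simp add: powr_add[symmetric])
    also have "\<bar>x\<bar> powr (2 - p) = (x\<^sup>2) powr (1 - p / 2)"
      by (subst square_powr) (simp add: right_diff_distrib)
    also have "\<bar>x\<bar> powr p * (x\<^sup>2) powr (1 - p / 2) \<le> \<bar>x\<bar> powr p * a powr (1 - p / 2)"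
      using True p by (intro mult_left_mono powr_mono2) auto
    finally show ?thesis by (rule min.coboundedI1)
  next
    case F: False
    have "a = a powr (p / 2) * a powr (1 - p / 2)"
      using \<open>0 < a\<close> by (simp add: powr_add[symmetric])
    also have "\<dots> \<le> (x\<^sup>2) powr (p / 2) * a powr (1 - p / 2)"
      using F \<open>0 < a\<close> p by (intro mult_right_mono powr_mono2) auto
    also have "(x\<^sup>2) powr (p / 2) = \<bar>x\<bar> powr p"
      by (subst square_powr) simp
    finally show ?thesis by (rule min.coboundedI2)
  qed
qed (use assms in auto)

text \<open>This is the embedding of the p-norm into the 2-norm for \<open>p \<le> 2\<close>: each
  \<open>\<bar>x k\<bar> powr p\<close> is at most the whole sum \<open>S\<close>, so the remaining
  factor \<open>\<bar>x k\<bar> powr (2 - p)\<close> of the square is at most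
  \<open>S powr (2 / p - 1)\<close>.\<close>

lemma sum_squares_le_powr:
  fixes x :: "'i \<Rightarrow> real" and p :: real
  assumes p: "1 \<le> p" "p \<le> 2" and "finite K"
  shows "(\<Sum>k\<in>K. (x k)\<^sup>2) \<le> (\<Sum>k\<in>K. \<bar>x k\<bar> powr p) powr (2 / p)"
proof -
  define S where "S = (\<Sum>k\<in>K. \<bar>x k\<bar> powr p)"
  have "0 \<le> S" by (auto simp: S_def intro: sum_nonneg)
  have "(x k)\<^sup>2 \<le> \<bar>x k\<bar> powr p * S powr (2 / p - 1)" if "k \<in> K" for k
  proof (cases "x k = 0")
    case False
    have "\<bar>x k\<bar> powr p \<le> S"
      unfolding S_def using that assms by (intro member_le_sum) auto
    then have "(\<bar>x k\<bar> powr p) powr (2 / p - 1) \<le> S powr (2 / p - 1)"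
      using p by (intro powr_mono2) auto
    moreover have "(\<bar>x k\<bar> powr p) powr (2 / p - 1) = \<bar>x k\<bar> powr (2 - p)"
      using p by (simp add: powr_powr algebra_simps)
    moreover have "(x k)\<^sup>2 = \<bar>x k\<bar> powr p * \<bar>x k\<bar> powr (2 - p)"
      using False by (simp add: powr_add[symmetric])
    ultimately show ?thesis by (simp add: mult_left_mono)
  qed (use p in auto)
  then have "(\<Sum>k\<in>K. (x k)\<^sup>2) \<le> (\<Sum>k\<in>K. \<bar>x k\<bar> powr p * S powr (2 / p - 1))"
    by (intro sum_mono)
  also have "\<dots> = S * S powr (2 / p - 1)"
    by (simp add: S_def sum_distrib_right)
  also have "\<dots> = S powr (2 / p)"
    using \<open>0 \<le> S\<close> powr_add[of S 1 "2 / p - 1"] by (cases "S = 0") auto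
  finally show ?thesis by (simp add: S_def)
qed

text \<open>For \<open>p \<ge> 2\<close>, truncating the coefficients of level \<open>j\<close> at \<open>2 powr (- j (s + 1/2))\<close>
  replaces Hoelder's inequality.\<close>

lemma besov_ball_reduce:
  assumes h: "h \<in> besov_ball \<psi>w \<tau> s p q Ms" and "1 \<le> q" "0 < Ms"
    and ps: "(p \<ge> 2 \<and> 0 < s) \<or> (1 \<le> p \<and> p < 2 \<and> 1 / p < s)"
  obtains p' B where "1 \<le> p'" "p' \<le> 2" "0 < B" "(p' = 2 \<and> 0 < s) \<or> (p' < 2 \<and> 1 / p' < s)"
    "\<And>j. \<tau> \<le> j \<Longrightarrow> (\<Sum>k<2 ^ j. \<bar>wavelet_coeff \<psi>w h j k\<bar> powr p') \<le> B * 2 powr (- ((p' * (s + 1 / 2) - 1) * real j))"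
proof (cases "p < 2")
  case True
  then show ?thesis
    using that[of p "Ms powr p"] besov_ball_level_bound[OF h _ \<open>1 \<le> q\<close> _ \<open>0 < Ms\<close>] ps \<open>0 < Ms\<close>
    by (auto simp: mult.commute)
next
  case False
  then have p: "2 \<le> p" "0 < s" using ps by auto
  show ?thesis
  proof (rule that[of 2 "Ms powr p + 1"])
    fix j assume j: "\<tau> \<le> j"
    let ?\<beta> = "wavelet_coeff \<psi>w h j"
    \<comment> \<open>With this truncation \<open>2 ^ j * w^2\<close> equals
      \<open>2 powr (- 2 * s * j)\<close>, the decay wanted for exponent 2, and the other part
      inherits the same decay from the level bound. The two parts account for the two summands of
      \<open>Ms powr p + 1\<close>.\<close>
    define w where "w = 2 powr (- (real j * (s + 1 / 2)))"
    have "(\<Sum>k<2 ^ j. \<bar>?\<beta> k\<bar> powr 2) \<le> (\<Sum>k<2 ^ j. \<bar>?\<beta> k\<bar> powr p * w powr (2 - p) + w\<^sup>2)"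
      using square_le_powr_add[OF p(1), of w "\<bar>?\<beta> k\<bar>" for k] by (intro sum_mono) (simp add: w_def)
    also have "\<dots> = (\<Sum>k<2 ^ j. \<bar>?\<beta> k\<bar> powr p) * w powr (2 - p) + 2 ^ j * w\<^sup>2"
      by (simp add: sum.distrib sum_distrib_right)
    also have "\<dots> \<le> (Ms powr p * 2 powr (- (real j * (p * (s + 1 / 2) - 1)))) * w powr (2 - p) + 2 ^ j * w\<^sup>2"
      using p by (intro add_right_mono mult_right_mono besov_ball_level_bound[OF h _ \<open>1 \<le> q\<close> j \<open>0 < Ms\<close>]) auto
    also have "\<dots> = Ms powr p * (2 powr (- (real j * (p * (s + 1 / 2) - 1))) * w powr (2 - p)) + 2 powr real j * w powr 2"
      by (simp add: w_def powr_realpow)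
    also have "2 powr (- (real j * (p * (s + 1 / 2) - 1))) * w powr (2 - p) = 2 powr (- ((2 * (s + 1 / 2) - 1) * real j))"
    proof -
      have "- (real j * (p * (s + 1 / 2) - 1)) + - (real j * (s + 1 / 2)) * (2 - p) = - ((2 * (s + 1 / 2) - 1) * real j)"
        by algebra
      then show ?thesis by (simp only: w_def powr_powr flip: powr_add)
    qed
    also have "2 powr real j * w powr 2 = 2 powr (- ((2 * (s + 1 / 2) - 1) * real j))"
      unfolding w_def powr_powr powr_add[symmetric] by (simp add: algebra_simps)
    finally show "(\<Sum>k<2 ^ j. \<bar>?\<beta> k\<bar> powr 2) \<le> (Ms powr p + 1) * 2 powr (- ((2 * (s + 1 / 2) - 1) * real j))"
      by (simp add: algebra_simps)
  qed (use p in \<open>auto simp: add_nonneg_pos\<close>)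
qed

text \<open>\<open>oracle_rate\<close> is the cost of ideal thresholding at squared noise level
  \<delta>, later \<open>ln n / n\<close>; \<open>tail_rate\<close> is the truncation error. The
  rate exponent contains \<open>s\<close> only, because \<open>p\<close> cancels at the balance
  point.\<close>

lemma sparse_coefficient_rates:
  fixes \<beta> :: "nat \<Rightarrow> nat \<Rightarrow> real" and p s B A :: real
  assumes p: "1 \<le> p" "p \<le> 2" and ps: "(p = 2 \<and> 0 < s) \<or> (p < 2 \<and> 1 / p < s)" and "0 < B" "0 < A"
    and \<beta>: "\<And>j. \<tau> \<le> j \<Longrightarrow> (\<Sum>k<2 ^ j. \<bar>\<beta> j k\<bar> powr p) \<le> B * 2 powr (- ((p * (s + 1 / 2) - 1) * real j))"
  shows oracle_rate: "\<exists>C>0. \<forall>\<delta>>0. \<forall>J. finite J \<longrightarrow> J \<subseteq> {\<tau>..} \<longrightarrow>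
      (\<Sum>j\<in>J. \<Sum>k<2 ^ j. min ((\<beta> j k)\<^sup>2) (A * \<delta>)) \<le> C * \<delta> powr (2 * s / (2 * s + 1))"
    and tail_rate: "\<exists>C>0. \<forall>n\<ge>2. \<forall>J. finite J \<longrightarrow> J \<subseteq> {j. \<tau> \<le> j \<and> real n / ln (real n) ^ 3 < 2 ^ j} \<longrightarrow>
      (\<Sum>j\<in>J. \<Sum>k<2 ^ j. (\<beta> j k)\<^sup>2) \<le> C * (ln (real n) / real n) powr (2 * s / (2 * s + 1))"
proof -
  define r where "r = p * (s + 1 / 2) - 1"
  define \<theta> where "\<theta> = 2 * s / (2 * s + 1)"
  have "0 < s"
    using ps p by (auto intro: less_trans[of 0 "1 / p" s])
  then have \<theta>: "0 < \<theta>" "\<theta> < 1" by (auto simp: \<theta>_def)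
  have ps': "p < 2 \<Longrightarrow> 1 < p * s"
    using ps p by (auto simp: field_simps)
  have "0 < r"
    using ps ps' p \<open>0 < s\<close> by (auto simp: r_def algebra_simps)
  \<comment> \<open>The sum of the squares at level \<open>j\<close> decays like
    \<open>2 powr (- t * j)\<close>. Here \<open>t = 2 * s + 1 - 2 / p\<close>, which is
    \<open>2 * s > \<theta>\<close> for \<open>p = 2\<close>, while \<open>1 / p < s\<close> makes
    it larger than 1 for \<open>p < 2\<close>.\<close>
  define t where "t = 2 * r / p"
  have "\<theta> < t"
  proof (cases "p = 2")
    case True
    have "\<theta> * 1 < \<theta> * (2 * s + 1)" using \<theta> \<open>0 < s\<close> by (intro mult_strict_left_mono) auto
    also have "\<dots> = 2 * s" using \<open>0 < s\<close> by (simp add: \<theta>_def)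
    finally show ?thesis using True by (simp add: t_def r_def algebra_simps)
  next
    case False
    then have "p < 2 * r" using ps' p by (auto simp: r_def algebra_simps)
    then have "1 < t" using p by (simp add: t_def field_simps)
    then show ?thesis using \<theta> by simp
  qed
  then have "0 < t" using \<theta> by linarith
  have g: "0 < 1 - 2 powr - r" "0 < 1 - 2 powr - t"
    using \<open>0 < r\<close> \<open>0 < t\<close> by (auto simp: powr_less_one)
  show "\<exists>C>0. \<forall>\<delta>>0. \<forall>J. finite J \<longrightarrow> J \<subseteq> {\<tau>..} \<longrightarrow>
      (\<Sum>j\<in>J. \<Sum>k<2 ^ j. min ((\<beta> j k)\<^sup>2) (A * \<delta>)) \<le> C * \<delta> powr (2 * s / (2 * s + 1))"
  proof (intro exI conjI allI impI)
    show "0 < 2 * A + A powr (1 - p / 2) * B / (1 - 2 powr - r)"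
      using g \<open>0 < A\<close> \<open>0 < B\<close> by (intro add_pos_nonneg) auto
    fix \<delta> :: real and J assume \<delta>: "0 < \<delta>" and J: "finite J" "J \<subseteq> {\<tau>..}"
    \<comment> \<open>Up to constants, the bounds \<open>\<delta> * 2 ^ j\<close> and
      \<open>\<delta> powr (1 - p / 2) * 2 powr (- r * j)\<close> agree where the power
      \<open>r + 1 = p * (s + 1 / 2)\<close> of \<open>2 ^ j\<close> equals
      \<open>\<delta> powr (- p / 2)\<close>. Solving for \<open>2 ^ j\<close> gives this
      \<open>x\<close>, whatever \<open>p\<close> is.\<close>
    define x where "x = \<delta> powr (- 1 / (2 * s + 1))"
    have "(\<Sum>j\<in>J. \<Sum>k<2 ^ j. min ((\<beta> j k)\<^sup>2) (A * \<delta>))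
      \<le> 2 * ((A * \<delta>) * x) + (B * (A * \<delta>) powr (1 - p / 2)) * x powr - r / (1 - 2 powr - r)"
    proof (rule sum_min_geometric_le[OF J(1)])
      fix j assume "j \<in> J"
      then have j: "\<tau> \<le> j" using J by auto
      have "(\<Sum>k<2 ^ j. min ((\<beta> j k)\<^sup>2) (A * \<delta>)) \<le> (\<Sum>k<2 ^ j::nat. A * \<delta>)"
        by (intro sum_mono) auto
      then show "(\<Sum>k<2 ^ j. min ((\<beta> j k)\<^sup>2) (A * \<delta>)) \<le> A * \<delta> * 2 ^ j"
        by (simp add: mult.commute)
      have "(\<Sum>k<2 ^ j. min ((\<beta> j k)\<^sup>2) (A * \<delta>)) \<le> (\<Sum>k<2 ^ j. \<bar>\<beta> j k\<bar> powr p * (A * \<delta>) powr (1 - p / 2))"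
        using p \<delta> \<open>0 < A\<close> by (intro sum_mono min_square_le_powr) auto
      also have "\<dots> = (A * \<delta>) powr (1 - p / 2) * (\<Sum>k<2 ^ j. \<bar>\<beta> j k\<bar> powr p)"
        by (simp add: sum_distrib_left mult.commute)
      also have "\<dots> \<le> (A * \<delta>) powr (1 - p / 2) * (B * 2 powr (- (r * real j)))"
        using \<beta>[OF j] by (intro mult_left_mono) (auto simp: r_def)
      finally show "(\<Sum>k<2 ^ j. min ((\<beta> j k)\<^sup>2) (A * \<delta>)) \<le> B * (A * \<delta>) powr (1 - p / 2) * 2 powr (- (r * real j))"
        by (simp add: mult_ac)
    qed (use \<delta> \<open>0 < r\<close> \<open>0 < A\<close> \<open>0 < B\<close> in \<open>auto simp: x_def\<close>)
    also have "(A * \<delta>) * x = A * \<delta> powr \<theta>"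
    proof -
      have "\<delta> * x = \<delta> powr (1 + - 1 / (2 * s + 1))"
        unfolding x_def powr_add using \<delta> by simp
      also have "1 + - 1 / (2 * s + 1) = \<theta>"
        using \<open>0 < s\<close> by (simp add: \<theta>_def field_simps)
      finally show ?thesis by simp
    qed
    also have "(B * (A * \<delta>) powr (1 - p / 2)) * x powr - r = A powr (1 - p / 2) * B * \<delta> powr \<theta>"
    proof -
      have "\<delta> powr (1 - p / 2) * x powr - r = \<delta> powr ((1 - p / 2) + r / (2 * s + 1))"
        unfolding x_def powr_add powr_powr using \<delta> by simp
      also have "(1 - p / 2) + r / (2 * s + 1) = \<theta>"
        using \<open>0 < s\<close> by (simp add: \<theta>_def r_def field_simps)
      finally show ?thesis using \<delta> \<open>0 < A\<close> by (simp add: powr_mult mult_ac)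
    qed
    finally show "(\<Sum>j\<in>J. \<Sum>k<2 ^ j. min ((\<beta> j k)\<^sup>2) (A * \<delta>))
      \<le> (2 * A + A powr (1 - p / 2) * B / (1 - 2 powr - r)) * \<delta> powr (2 * s / (2 * s + 1))"
      by (simp add: \<theta>_def algebra_simps)
  qed
  obtain C where C: "0 < C" "\<And>n. n \<ge> 2 \<Longrightarrow> (real n / ln (real n) ^ 3) powr - t \<le> C * (ln (real n) / real n) powr \<theta>"
    using log_power_rate_bound[OF \<theta>(1) \<open>\<theta> < t\<close>] by blast
  show "\<exists>C>0. \<forall>n\<ge>2. \<forall>J. finite J \<longrightarrow> J \<subseteq> {j. \<tau> \<le> j \<and> real n / ln (real n) ^ 3 < 2 ^ j} \<longrightarrow>
      (\<Sum>j\<in>J. \<Sum>k<2 ^ j. (\<beta> j k)\<^sup>2) \<le> C * (ln (real n) / real n) powr (2 * s / (2 * s + 1))"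
  proof (intro exI conjI allI impI)
    show "0 < B powr (2 / p) * (C / (1 - 2 powr - t))"
      using C g \<open>0 < B\<close> by simp
    fix n :: nat and J assume n: "2 \<le> n" and J: "finite J" "J \<subseteq> {j. \<tau> \<le> j \<and> real n / ln (real n) ^ 3 < 2 ^ j}"
    have "(\<Sum>k<2 ^ j. (\<beta> j k)\<^sup>2) \<le> B powr (2 / p) * 2 powr (- (t * real j))" if "j \<in> J" for j
    proof -
      have j: "\<tau> \<le> j" using J that by auto
      have "(\<Sum>k<2 ^ j. (\<beta> j k)\<^sup>2) \<le> (\<Sum>k<2 ^ j. \<bar>\<beta> j k\<bar> powr p) powr (2 / p)"
        using p by (intro sum_squares_le_powr) auto
      also have "\<dots> \<le> (B * 2 powr (- (r * real j))) powr (2 / p)"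
        using \<beta>[OF j] p by (intro powr_mono2) (auto simp: r_def intro: sum_nonneg)
      also have "\<dots> = B powr (2 / p) * 2 powr (- (t * real j))"
        using \<open>0 < B\<close> by (simp add: powr_mult powr_powr t_def mult_ac)
      finally show ?thesis .
    qed
    then have "(\<Sum>j\<in>J. \<Sum>k<2 ^ j. (\<beta> j k)\<^sup>2) \<le> B powr (2 / p) * (\<Sum>j\<in>J. 2 powr (- (t * real j)))"
      unfolding sum_distrib_left by (intro sum_mono)
    also have "\<dots> \<le> B powr (2 / p) * ((real n / ln (real n) ^ 3) powr - t / (1 - 2 powr - t))"
      using J n \<open>0 < t\<close> by (intro mult_left_mono sum_powr_minus_le) (auto intro: less_imp_le)
    also have "\<dots> \<le> B powr (2 / p) * ((C * (ln (real n) / real n) powr \<theta>) / (1 - 2 powr - t))"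
      using C(2)[OF n] g by (intro mult_left_mono divide_right_mono) auto
    finally show "(\<Sum>j\<in>J. \<Sum>k<2 ^ j. (\<beta> j k)\<^sup>2)
      \<le> B powr (2 / p) * (C / (1 - 2 powr - t)) * (ln (real n) / real n) powr (2 * s / (2 * s + 1))"
      by (simp add: \<theta>_def)
  qed
qed

section \<open>Hard thresholding of one coefficient\<close>

text \<open>The hypothesis forces \<open>L > 0\<close>. A kept coefficient has
  \<open>\<bar>\<beta>\<bar> > L / 2\<close>, so its error is below both
  \<open>\<bar>\<beta>\<bar>\<close> and \<open>L / 2\<close>; a discarded one has error
  \<open>\<bar>\<beta>\<bar> < 3 / 2 * L\<close>. Hence the constant \<open>9 / 4\<close>.\<close>

lemma hard_threshold_error:
  fixes bh \<beta> L :: real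
  assumes "\<bar>bh - \<beta>\<bar> < L / 2"
  shows "(bh * (if \<bar>bh\<bar> \<ge> L then 1 else 0) - \<beta>)\<^sup>2 \<le> min (\<beta>\<^sup>2) (9 / 4 * L\<^sup>2)"
proof (cases "\<bar>bh\<bar> \<ge> L")
  case True
  then have "\<bar>bh - \<beta>\<bar> \<le> \<bar>\<beta>\<bar>" "\<bar>bh - \<beta>\<bar> \<le> \<bar>3 / 2 * L\<bar>"
    using assms by linarith+
  then have "(bh - \<beta>)\<^sup>2 \<le> \<beta>\<^sup>2" "(bh - \<beta>)\<^sup>2 \<le> (3 / 2 * L)\<^sup>2"
    by (simp_all only: abs_le_square_iff)
  then show ?thesis using True by (simp add: power_mult_distrib power_divide)
next
  case False
  then have "\<bar>\<beta>\<bar> \<le> \<bar>3 / 2 * L\<bar>"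
    using assms by linarith
  then have "\<beta>\<^sup>2 \<le> (3 / 2 * L)\<^sup>2"
    by (simp only: abs_le_square_iff)
  then show ?thesis using False by (simp add: power_mult_distrib power_divide)
qed

text \<open>On the exceptional event the error is only known to be at most \<open>(2 * D)^2\<close>,
  which is weighted by the probability bound \<eta>; elsewhere \<open>hard_threshold_error\<close>
  applies pointwise.\<close>

lemma (in prob_space) hard_threshold_risk:
  fixes bh :: "'a \<Rightarrow> real" and \<beta> L D \<eta> :: real
  assumes [measurable]: "random_variable borel bh"
    and bnd: "\<And>\<omega>. \<omega> \<in> space M \<Longrightarrow> \<bar>bh \<omega>\<bar> \<le> D" "\<bar>\<beta>\<bar> \<le> D"
    and \<eta>: "prob {\<omega> \<in> space M. \<bar>bh \<omega> - \<beta>\<bar> \<ge> L / 2} \<le> \<eta>"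
  defines "err \<equiv> \<lambda>\<omega>. (bh \<omega> * (if \<bar>bh \<omega>\<bar> \<ge> L then 1 else 0) - \<beta>)\<^sup>2"
  shows "integrable M err" "expectation err \<le> min (\<beta>\<^sup>2) (9 / 4 * L\<^sup>2) + 4 * D\<^sup>2 * \<eta>"
proof -
  define A where "A = {\<omega> \<in> space M. \<bar>bh \<omega> - \<beta>\<bar> \<ge> L / 2}"
  have A[measurable]: "A \<in> events" unfolding A_def by measurable
  have le: "err \<omega> \<le> 4 * D\<^sup>2" if "\<omega> \<in> space M" for \<omega>
  proof -
    have "\<bar>bh \<omega> * (if \<bar>bh \<omega>\<bar> \<ge> L then 1 else 0) - \<beta>\<bar> \<le> \<bar>2 * D\<bar>"
      using bnd(1)[OF that] bnd(2) by (auto simp: abs_if split: if_splits)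
    then have "err \<omega> \<le> (2 * D)\<^sup>2"
      unfolding err_def by (simp only: abs_le_square_iff)
    then show ?thesis by (simp add: power_mult_distrib)
  qed
  have [measurable]: "err \<in> borel_measurable M"
    unfolding err_def by measurable
  show int: "integrable M err"
    using le by (intro integrable_const_bound[of _ "4 * D\<^sup>2"]) (auto simp: err_def)
  have "err \<omega> \<le> min (\<beta>\<^sup>2) (9 / 4 * L\<^sup>2) + 4 * D\<^sup>2 * indicator A \<omega>" if "\<omega> \<in> space M" for \<omega>
  proof (cases "\<omega> \<in> A")
    case True
    have "0 \<le> min (\<beta>\<^sup>2) (9 / 4 * L\<^sup>2)" by simp
    then show ?thesis using True le[OF that] by (auto simp: min_def)
  next
    case False
    then show ?thesis
      using that hard_threshold_error[of "bh \<omega>" \<beta> L] by (simp add: A_def err_def)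
  qed
  then have "expectation err \<le> expectation (\<lambda>\<omega>. min (\<beta>\<^sup>2) (9 / 4 * L\<^sup>2) + 4 * D\<^sup>2 * indicator A \<omega>)"
    by (intro integral_mono int) (auto intro!: integrable_real_mult_indicator finite_measure_mono)
  also have "\<dots> = min (\<beta>\<^sup>2) (9 / 4 * L\<^sup>2) + 4 * D\<^sup>2 * prob A"
    using A by (subst Bochner_Integration.integral_add)
      (auto simp: prob_space emeasure_eq_measure intro!: integrable_mult_right integrable_real_indicator)
  also have "\<dots> \<le> min (\<beta>\<^sup>2) (9 / 4 * L\<^sup>2) + 4 * D\<^sup>2 * \<eta>"
    using \<eta> by (intro add_left_mono mult_left_mono) (auto simp: A_def)
  finally show "expectation err \<le> min (\<beta>\<^sup>2) (9 / 4 * L\<^sup>2) + 4 * D\<^sup>2 * \<eta>" .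
qed

section \<open>Expansions in orthonormal bases\<close>

lemma L2_01_mult_integrable:
  assumes "h \<in> L2_01" "k \<in> L2_01"
  shows "set_integrable lborel {0..1} (\<lambda>x. h x * k x)"
proof -
  let ?I = "\<lambda>x::real. indicator {0..1} x :: real"
  have [measurable]: "(\<lambda>x. ?I x * h x) \<in> borel_measurable borel" "(\<lambda>x. ?I x * k x) \<in> borel_measurable borel"
    using assms by (auto simp: L2_01_def set_borel_measurable_def)
  have int: "integrable lborel (\<lambda>x. ?I x * (h x)\<^sup>2 + ?I x * (k x)\<^sup>2)"
    using assms by (intro Bochner_Integration.integrable_add) (auto simp: L2_01_def set_integrable_def)
  have "(\<lambda>x. ?I x * (h x * k x)) = (\<lambda>x. (?I x * h x) * (?I x * k x))"
    by (auto simp: indicator_def)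
  then have meas: "(\<lambda>x. ?I x * (h x * k x)) \<in> borel_measurable lborel"
    by simp
  have "\<bar>a * b\<bar> \<le> a\<^sup>2 + b\<^sup>2" for a b :: real
  proof -
    have "2 * (\<bar>a\<bar> * \<bar>b\<bar>) \<le> a\<^sup>2 + b\<^sup>2"
      using sum_squares_bound[of "\<bar>a\<bar>" "\<bar>b\<bar>"] by simp
    then show ?thesis by (simp add: abs_mult) (smt (verit) mult_nonneg_nonneg abs_ge_zero)
  qed
  then have "integrable lborel (\<lambda>x. ?I x * (h x * k x))"
    using meas by (intro Bochner_Integration.integrable_bound[OF int]) (auto simp: indicator_def)
  then show ?thesis by (simp add: set_integrable_def)
qed

lemma L2_01_cmult: "h \<in> L2_01 \<Longrightarrow> (\<lambda>x. c * h x) \<in> L2_01"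
proof -
  assume h: "h \<in> L2_01"
  have eq: "(\<lambda>x. indicator {0..1} x * (c * h x)) = (\<lambda>x. c * (indicator {0..1::real} x * h x))"
    by auto
  show ?thesis
    using h unfolding L2_01_def
    by (auto simp: set_borel_measurable_def eq power_mult_distrib)
qed

lemma L2_01_add:
  assumes "h \<in> L2_01" "k \<in> L2_01"
  shows "(\<lambda>x. h x + k x) \<in> L2_01"
proof -
  have "set_borel_measurable lborel {0..1} (\<lambda>x. h x + k x)"
    using assms by (auto simp: L2_01_def set_borel_measurable_def distrib_left)
  moreover have "set_integrable lborel {0..1} (\<lambda>x. (h x)\<^sup>2 + (k x)\<^sup>2 + 2 * (h x * k x))"
    using assms L2_01_mult_integrable[OF assms]
    by (intro set_integral_add set_integrable_mult_right) (auto simp: L2_01_def)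
  ultimately show ?thesis
    by (simp add: L2_01_def power2_sum mult.assoc)
qed

lemma L2_01_const: "(\<lambda>x. c) \<in> L2_01"
  by (auto simp: L2_01_def set_borel_measurable_def set_integrable_def)

lemma L2_01_sum:
  assumes "\<And>a. a \<in> F \<Longrightarrow> e a \<in> L2_01"
  shows "(\<lambda>x. \<Sum>a\<in>F. c a * e a x) \<in> L2_01"
  using assms
  by (induction F rule: infinite_finite_induct) (auto intro!: L2_01_add L2_01_cmult L2_01_const[of 0])

lemma set_lebesgue_integral_sum:
  fixes f :: "'i \<Rightarrow> 'a \<Rightarrow> real"
  assumes "\<And>i. i \<in> I \<Longrightarrow> set_integrable N A (f i)"
  shows "set_integrable N A (\<lambda>x. \<Sum>i\<in>I. f i x)"
    and "(LINT x:A|N. (\<Sum>i\<in>I. f i x)) = (\<Sum>i\<in>I. LINT x:A|N. f i x)"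
  using assms by (auto simp: set_integrable_def set_lebesgue_integral_def sum_distrib_left
      intro!: Bochner_Integration.integrable_sum Bochner_Integration.integral_sum)

text \<open>Orthonormality collapses the double sum, and completing the square separates the
  coefficients. The numbers \<open>c a\<close> are arbitrary because estimated coefficients will be
  inserted.\<close>

lemma orthonormal_error_expansion:
  assumes e: "orthonormal_basis_01 I e" and F: "finite F" "F \<subseteq> I" and h: "h \<in> L2_01"
  shows "(LBINT x:{0..1}. (h x - (\<Sum>a\<in>F. c a * e a x))\<^sup>2)
    = (LBINT x:{0..1}. (h x)\<^sup>2) - (\<Sum>a\<in>F. (LBINT x:{0..1}. h x * e a x)\<^sup>2)
      + (\<Sum>a\<in>F. (c a - (LBINT x:{0..1}. h x * e a x))\<^sup>2)"
proof -
  have eL: "e a \<in> L2_01" if "a \<in> F" for a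
    using e F that by (auto simp: orthonormal_basis_01_def)
  have ortho: "(LBINT x:{0..1}. e a x * e b x) = (if a = b then 1 else 0)" if "a \<in> F" "b \<in> F" for a b
    using e F that unfolding orthonormal_basis_01_def by blast
  let ?u = "\<lambda>a. LBINT x:{0..1}. h x * e a x"
  have i1: "set_integrable lborel {0..1} (\<lambda>x. (h x)\<^sup>2)"
    using h by (simp add: L2_01_def)
  have i2: "set_integrable lborel {0..1} (\<lambda>x. 2 * c a * (h x * e a x))" if "a \<in> F" for a
    using L2_01_mult_integrable[OF h eL[OF that]] by simp
  have i3: "set_integrable lborel {0..1} (\<lambda>x. c a * c b * (e a x * e b x))" if "a \<in> F" "b \<in> F" for a b
    using L2_01_mult_integrable[OF eL eL, OF that] by simp
  have s2: "set_integrable lborel {0..1} (\<lambda>x. \<Sum>a\<in>F. 2 * c a * (h x * e a x))"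
    by (intro set_lebesgue_integral_sum i2)
  have s3: "set_integrable lborel {0..1} (\<lambda>x. \<Sum>a\<in>F. \<Sum>b\<in>F. c a * c b * (e a x * e b x))"
    by (intro set_lebesgue_integral_sum i3)
  have "(h x - (\<Sum>a\<in>F. c a * e a x))\<^sup>2 = (h x)\<^sup>2 - (\<Sum>a\<in>F. 2 * c a * (h x * e a x))
      + (\<Sum>a\<in>F. \<Sum>b\<in>F. c a * c b * (e a x * e b x))" for x
    by (simp add: power2_diff power2_eq_square sum_product sum_distrib_left algebra_simps)
  then have "(LBINT x:{0..1}. (h x - (\<Sum>a\<in>F. c a * e a x))\<^sup>2)
     = (LBINT x:{0..1}. (h x)\<^sup>2) - (\<Sum>a\<in>F. 2 * c a * ?u a)
      + (\<Sum>a\<in>F. \<Sum>b\<in>F. c a * c b * (LBINT x:{0..1}. e a x * e b x))"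
    using i1 i2 i3 s2 s3
    by (simp add: set_integral_add set_integral_diff set_lebesgue_integral_sum)
  also have "(\<Sum>a\<in>F. \<Sum>b\<in>F. c a * c b * (LBINT x:{0..1}. e a x * e b x)) = (\<Sum>a\<in>F. (c a)\<^sup>2)"
    using F(1) by (intro sum.cong refl) (simp add: ortho if_distrib power2_eq_square cong: if_cong)
  also have "(LBINT x:{0..1}. (h x)\<^sup>2) - (\<Sum>a\<in>F. 2 * c a * ?u a) + (\<Sum>a\<in>F. (c a)\<^sup>2)
      = (LBINT x:{0..1}. (h x)\<^sup>2) - (\<Sum>a\<in>F. (?u a)\<^sup>2) + (\<Sum>a\<in>F. (c a - ?u a)\<^sup>2)"
    by (simp add: power2_diff sum.distrib sum_subtractf algebra_simps)
  finally show ?thesis .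
qed

text \<open>Bessel's inequality for one function: with the exact coefficient the expanded error is
  nonnegative and its last term vanishes.\<close>

lemma orthonormal_coeff_le:
  assumes e: "orthonormal_basis_01 I e" and "a \<in> I" and h: "h \<in> L2_01"
  shows "(LBINT x:{0..1}. h x * e a x)\<^sup>2 \<le> (LBINT x:{0..1}. (h x)\<^sup>2)"
proof -
  have "0 \<le> (LBINT x:{0..1}. (h x - (\<Sum>a\<in>{a}. (LBINT x:{0..1}. h x * e a x) * e a x))\<^sup>2)"
    by (simp add: set_lebesgue_integral_def)
  then show ?thesis
    using orthonormal_error_expansion[OF e, of "{a}" h "\<lambda>a. LBINT x:{0..1}. h x * e a x"] assms by simp
qed

text \<open>The basis is given by density of finite combinations, so the tail is controlled through
  finite sets \<open>G\<close> instead of an infinite Parseval sum. An \<epsilon>-approximation over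
  \<open>F'\<close> can only improve when its coefficients become the exact ones; splitting
  \<open>F'\<close> into a part inside \<open>F\<close> and a part outside it bounds the norm of
  \<open>h\<close>.\<close>

lemma orthonormal_error_le:
  assumes e: "orthonormal_basis_01 I e" and F: "finite F" "F \<subseteq> I" and h: "h \<in> L2_01"
    and T: "\<And>G. finite G \<Longrightarrow> G \<subseteq> I - F \<Longrightarrow> (\<Sum>a\<in>G. (LBINT x:{0..1}. h x * e a x)\<^sup>2) \<le> T"
  shows "(LBINT x:{0..1}. (h x - (\<Sum>a\<in>F. c a * e a x))\<^sup>2)
    \<le> T + (\<Sum>a\<in>F. (c a - (LBINT x:{0..1}. h x * e a x))\<^sup>2)"
proof -
  let ?u = "\<lambda>a. LBINT x:{0..1}. h x * e a x"
  let ?N = "LBINT x:{0..1}. (h x)\<^sup>2"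
  have "?N \<le> T + (\<Sum>a\<in>F. (?u a)\<^sup>2)"
  proof (rule field_le_epsilon)
    fix \<epsilon> :: real assume "0 < \<epsilon>"
    then obtain F' u where F': "finite F'" "F' \<subseteq> I"
      and lt: "(LBINT x:{0..1}. (h x - (\<Sum>a\<in>F'. u a * e a x))\<^sup>2) < \<epsilon>"
      using e h unfolding orthonormal_basis_01_def by meson
    have "?N - (\<Sum>a\<in>F'. (?u a)\<^sup>2) \<le> (LBINT x:{0..1}. (h x - (\<Sum>a\<in>F'. u a * e a x))\<^sup>2)"
      unfolding orthonormal_error_expansion[OF e F' h] by (simp add: sum_nonneg)
    moreover have "(\<Sum>a\<in>F'. (?u a)\<^sup>2) \<le> (\<Sum>a\<in>F \<union> (F' - F). (?u a)\<^sup>2)"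
      using F F' by (intro sum_mono2) auto
    moreover have "\<dots> = (\<Sum>a\<in>F. (?u a)\<^sup>2) + (\<Sum>a\<in>F' - F. (?u a)\<^sup>2)"
      using F F' by (intro sum.union_disjoint) auto
    moreover have "(\<Sum>a\<in>F' - F. (?u a)\<^sup>2) \<le> T"
      using F' by (intro T) auto
    ultimately show "?N \<le> T + (\<Sum>a\<in>F. (?u a)\<^sup>2) + \<epsilon>"
      using lt by simp
  qed
  then show ?thesis
    unfolding orthonormal_error_expansion[OF e F h] by simp
qed

section \<open>Integration over the unit cube\<close>

text \<open>Fubini for products of one-variable functions. Lebesgue measure on vectors is the image
  of a product measure indexed by \<open>Basis\<close>; \<open>T\<close> rebuilds the vector from
  its coordinates, and \<open>i\<close> inverts the identification of an index \<open>v\<close> with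
  \<open>axis v 1\<close>.\<close>

lemma lborel_vec_prod:
  fixes h :: "'d::finite \<Rightarrow> real \<Rightarrow> real"
  assumes int: "\<And>v. integrable lborel (h v)"
  shows "integrable lborel (\<lambda>x::real ^ 'd. \<Prod>v\<in>UNIV. h v (x $ v))"
    and "(LINT x|lborel. (\<Prod>v\<in>UNIV. h v ((x::real ^ 'd) $ v))) = (\<Prod>v\<in>UNIV. LBINT y. h v y)"
proof -
  let ?B = "Basis :: (real ^ 'd) set"
  define i where "i = (\<lambda>b::real ^ 'd. SOME v. b = axis v 1)"
  have i: "i (axis v 1) = v" for v
    unfolding i_def by (rule some_equality) (auto simp: axis_eq_axis)
  have B: "?B = (\<lambda>v. axis v 1) ` UNIV"
    by (auto simp: Basis_vec_def)
  have inj: "inj (\<lambda>v::'d. axis v (1::real))"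
    by (auto simp: inj_def axis_eq_axis)
  interpret product_sigma_finite "\<lambda>_::real ^ 'd. lborel :: real measure"
    by standard
  have [measurable]: "h v \<in> borel_measurable borel" for v
    using int[of v] by auto
  define T where "T = (\<lambda>f. \<Sum>b\<in>?B. f b *\<^sub>R b)"
  have T[measurable]: "T \<in> measurable (\<Pi>\<^sub>M b\<in>?B. lborel) borel"
    unfolding T_def by measurable
  have lb: "(lborel :: (real ^ 'd) measure) = distr (\<Pi>\<^sub>M b\<in>?B. lborel) borel T"
    unfolding T_def by (rule lborel_eq)
  have "T f $ v = f (axis v 1)" for f v
  proof -
    have "T f $ v = T f \<bullet> axis v 1"
      by (simp add: inner_axis)
    also have "\<dots> = f (axis v 1)"
      unfolding T_def by (rule inner_sum_left_Basis) (simp add: axis_in_Basis_iff)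
    finally show ?thesis .
  qed
  then have eq: "(\<Prod>v\<in>UNIV. h v (T f $ v)) = (\<Prod>b\<in>?B. h (i b) (f b))" for f
    unfolding B using inj by (simp add: prod.reindex i)
  have meas: "(\<lambda>x::real ^ 'd. \<Prod>v\<in>UNIV. h v (x $ v)) \<in> borel_measurable borel"
    by measurable
  show "integrable lborel (\<lambda>x::real ^ 'd. \<Prod>v\<in>UNIV. h v (x $ v))"
    unfolding lb using int by (subst integrable_distr_eq[OF T meas]) (auto simp: eq intro!: product_integrable_prod)
  have "(LINT x|lborel. (\<Prod>v\<in>UNIV. h v ((x::real ^ 'd) $ v))) = (\<Prod>b\<in>?B. LBINT y. h (i b) y)"
    unfolding lb using int by (subst integral_distr[OF T meas]) (auto simp: eq intro!: product_integral_prod)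
  also have "\<dots> = (\<Prod>v\<in>UNIV. LBINT y. h v y)"
    unfolding B using inj by (simp add: prod.reindex i)
  finally show "(LINT x|lborel. (\<Prod>v\<in>UNIV. h v ((x::real ^ 'd) $ v))) = (\<Prod>v\<in>UNIV. LBINT y. h v y)" .
qed

lemma indicator_unit_cube: "indicator unit_cube x = (\<Prod>v\<in>UNIV. indicator {0..1} (x $ v) :: real)"
  for x :: "real ^ 'd::finite"
proof (cases "x \<in> unit_cube")
  case True
  then show ?thesis by (auto simp: unit_cube_def indicator_def intro!: prod.neutral[symmetric])
next
  case False
  then obtain v where "x $ v \<notin> {0..1}" by (auto simp: unit_cube_def)
  then have "(\<Prod>v\<in>UNIV. indicator {0..1} (x $ v) :: real) = 0"
    by (intro prod_zero bexI[of _ v]) auto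
  with False show ?thesis by simp
qed

lemma unit_cube_measurable[measurable]: "unit_cube \<in> sets (borel :: (real ^ 'd::finite) measure)"
proof -
  have "unit_cube = {x::real ^ 'd. \<forall>v\<in>UNIV. 0 \<le> x $ v \<and> x $ v \<le> 1}"
    by (simp add: unit_cube_def)
  also have "\<dots> \<in> sets borel"
    by measurable
  finally show ?thesis .
qed

text \<open>The remaining coordinates contribute the indicator of \<open>{0..1}\<close>, whose
  integral is 1. The factorisation is what later annihilates the other additive components.\<close>

lemma unit_cube_integral_pair:
  fixes a b :: "real \<Rightarrow> real" and u v :: "'d::finite"
  assumes "u \<noteq> v" "set_integrable lborel {0..1} a" "set_integrable lborel {0..1} b"
  shows "set_integrable lborel (unit_cube :: (real ^ 'd) set) (\<lambda>x. a (x $ u) * b (x $ v))"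
    and "(LINT x:(unit_cube :: (real ^ 'd) set)|lborel. a (x $ u) * b (x $ v))
      = (LBINT x:{0..1}. a x) * (LBINT x:{0..1}. b x)"
proof -
  define h where "h = (\<lambda>w x. indicator {0..1} x * (if w = u then a x else if w = v then b x else 1) :: real)"
  have int: "integrable lborel (h w)" for w
    using assms by (cases "w = u"; cases "w = v") (auto simp: h_def set_integrable_def)
  have U: "(UNIV :: 'd set) = insert u (insert v (UNIV - {u, v}))" by auto
  have pick: "(\<Prod>w\<in>UNIV. F w) = F u * (F v * (\<Prod>w\<in>UNIV - {u, v}. F w))" for F :: "'d \<Rightarrow> real"
    by (subst U, use assms(1) in \<open>simp add: prod.insert\<close>)
  have one: "(\<Prod>w\<in>UNIV - {u, v}. if w = u then a (x $ w) else if w = v then b (x $ w) else 1) = 1"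
    for x :: "real ^ 'd"
    by (rule prod.neutral) auto
  have eq: "(\<Prod>w\<in>UNIV. h w (x $ w)) = indicator unit_cube x * (a (x $ u) * b (x $ v))" for x :: "real ^ 'd"
    unfolding h_def prod.distrib indicator_unit_cube pick[of "\<lambda>w. if w = u then a (x $ w) else if w = v then b (x $ w) else 1"] one
    using assms(1) by simp
  have "(\<Prod>w\<in>UNIV. LBINT y. h w y) = (LBINT y. h u y) * ((LBINT y. h v y) * (\<Prod>w\<in>UNIV - {u, v}. LBINT y. h w y))"
    by (rule pick)
  also have "(\<Prod>w\<in>UNIV - {u, v}. LBINT y. h w y) = 1"
    by (intro prod.neutral) (auto simp: h_def)
  finally have p: "(\<Prod>w\<in>UNIV. LBINT y. h w y) = (LBINT x:{0..1}. a x) * (LBINT x:{0..1}. b x)"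
    using assms(1) by (simp add: h_def set_lebesgue_integral_def)
  show "set_integrable lborel (unit_cube :: (real ^ 'd) set) (\<lambda>x. a (x $ u) * b (x $ v))"
    using lborel_vec_prod(1)[of h] int by (simp add: eq set_integrable_def)
  show "(LINT x:(unit_cube :: (real ^ 'd) set)|lborel. a (x $ u) * b (x $ v))
      = (LBINT x:{0..1}. a x) * (LBINT x:{0..1}. b x)"
    using lborel_vec_prod(2)[of h] int by (simp add: eq set_lebesgue_integral_def p)
qed

lemma unit_cube_integral_single:
  fixes a :: "real \<Rightarrow> real" and u :: "'d::finite"
  assumes "set_integrable lborel {0..1} a"
  shows "set_integrable lborel (unit_cube :: (real ^ 'd) set) (\<lambda>x. a (x $ u))"
    and "(LINT x:(unit_cube :: (real ^ 'd) set)|lborel. a (x $ u)) = (LBINT x:{0..1}. a x)"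
proof -
  define h where "h = (\<lambda>w x. indicator {0..1} x * (if w = u then a x else 1) :: real)"
  have int: "integrable lborel (h w)" for w
    using assms by (cases "w = u") (auto simp: h_def set_integrable_def)
  have pick: "(\<Prod>w\<in>UNIV. F w) = F u * (\<Prod>w\<in>UNIV - {u}. F w)" for F :: "'d \<Rightarrow> real"
    by (rule prod.remove) auto
  have eq: "(\<Prod>w\<in>UNIV. h w (x $ w)) = indicator unit_cube x * a (x $ u)" for x :: "real ^ 'd"
    unfolding h_def prod.distrib indicator_unit_cube pick[of "\<lambda>w. if w = u then a (x $ w) else 1"] by simp
  have "(\<Prod>w\<in>UNIV. LBINT y. h w y) = (LBINT y. h u y) * (\<Prod>w\<in>UNIV - {u}. LBINT y. h w y)"
    by (rule pick)
  also have "(\<Prod>w\<in>UNIV - {u}. LBINT y. h w y) = 1"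
    by (intro prod.neutral) (auto simp: h_def)
  finally have p: "(\<Prod>w\<in>UNIV. LBINT y. h w y) = (LBINT x:{0..1}. a x)"
    by (simp add: h_def set_lebesgue_integral_def)
  show "set_integrable lborel (unit_cube :: (real ^ 'd) set) (\<lambda>x. a (x $ u))"
    using lborel_vec_prod(1)[of h] int by (simp add: eq set_integrable_def)
  show "(LINT x:(unit_cube :: (real ^ 'd) set)|lborel. a (x $ u)) = (LBINT x:{0..1}. a x)"
    using lborel_vec_prod(2)[of h] int by (simp add: eq set_lebesgue_integral_def p)
qed

section \<open>Tensor sums over the indices of the other coordinates\<close>

lemma sum_multi_indices_prod:
  fixes F :: "'d::finite \<Rightarrow> nat \<Rightarrow> real"
  assumes "k0 < 2 ^ j"
  shows "(\<Sum>k\<in>multi_indices j l k0. \<Prod>v\<in>UNIV. F v (k v)) = F l k0 * (\<Prod>v\<in>UNIV - {l}. \<Sum>k<2 ^ j. F v k)"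
proof -
  \<comment> \<open>The multi-indices form a box whose l-th side is a singleton, so the distributive
    law over \<open>PiE\<close> applies and the l-th factor is a single term.\<close>
  define B where "B = (\<lambda>v. if v = l then {k0} else {..<(2::nat) ^ j})"
  have "multi_indices j l k0 = PiE UNIV B"
    using assms by (auto simp: multi_indices_def B_def PiE_def Pi_def split: if_splits)
  then have "(\<Sum>k\<in>multi_indices j l k0. \<Prod>v\<in>UNIV. F v (k v)) = (\<Prod>v\<in>UNIV. \<Sum>k\<in>B v. F v k)"
    by (subst prod_sum_PiE) (auto simp: B_def)
  also have "\<dots> = (\<Sum>k\<in>B l. F l k) * (\<Prod>v\<in>UNIV - {l}. \<Sum>k\<in>B v. F v k)"
    by (rule prod.remove) auto
  also have "(\<Prod>v\<in>UNIV - {l}. \<Sum>k\<in>B v. F v k) = (\<Prod>v\<in>UNIV - {l}. \<Sum>k<2 ^ j. F v k)"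
    by (intro prod.cong) (auto simp: B_def)
  finally show ?thesis by (simp add: B_def)
qed

lemma sum_tensor_phi:
  assumes "k0 < 2 ^ j"
  shows "(\<Sum>k\<in>multi_indices j l k0. tensor_phi \<phi>w j k x) = \<phi>w j k0 (x $ l) * (\<Prod>v\<in>UNIV - {l}. \<Sum>k<2 ^ j. \<phi>w j k (x $ v))"
  unfolding tensor_phi_def using sum_multi_indices_prod[OF assms, of "\<lambda>v k. \<phi>w j k (x $ v)"] .

lemma sum_tensor_psi:
  assumes "k0 < 2 ^ j"
  shows "(\<Sum>k\<in>multi_indices j l k0. tensor_psi \<phi>w \<psi>w j k l x) = \<psi>w j k0 (x $ l) * (\<Prod>v\<in>UNIV - {l}. \<Sum>k<2 ^ j. \<phi>w j k (x $ v))"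
proof -
  define F where "F = (\<lambda>v k. if v = l then \<psi>w j k (x $ v) else \<phi>w j k (x $ v))"
  have "tensor_psi \<phi>w \<psi>w j k l x = (\<Prod>v\<in>UNIV. F v (k v))" for k
    unfolding tensor_psi_def by (subst prod.remove[of UNIV l]) (auto simp: F_def intro!: prod.cong)
  then have "(\<Sum>k\<in>multi_indices j l k0. tensor_psi \<phi>w \<psi>w j k l x) = F l k0 * (\<Prod>v\<in>UNIV - {l}. \<Sum>k<2 ^ j. F v k)"
    by (simp add: sum_multi_indices_prod[OF assms])
  also have "(\<Prod>v\<in>UNIV - {l}. \<Sum>k<2 ^ j. F v k) = (\<Prod>v\<in>UNIV - {l}. \<Sum>k<2 ^ j. \<phi>w j k (x $ v))"
    by (intro prod.cong) (auto simp: F_def)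
  finally show ?thesis by (simp add: F_def)
qed

section \<open>Empirical means of mixing processes\<close>

text \<open>By the layer cake formula, the covariance is the integral over \<open>[0,A] \<times> [0,B]\<close> of the
  covariances of the indicators of \<open>s < U\<close> and \<open>t < V\<close>.\<close>

lemma (in prob_space) covariance_le_nonneg:
  fixes U V :: "'a \<Rightarrow> real"
  assumes [measurable]: "random_variable borel U" "random_variable borel V"
    and U: "\<And>\<omega>. \<omega> \<in> space M \<Longrightarrow> 0 \<le> U \<omega> \<and> U \<omega> \<le> A"
    and V: "\<And>\<omega>. \<omega> \<in> space M \<Longrightarrow> 0 \<le> V \<omega> \<and> V \<omega> \<le> B"
    and \<alpha>: "\<And>s t. \<bar>prob {\<omega> \<in> space M. s < U \<omega> \<and> t < V \<omega>}
        - prob {\<omega> \<in> space M. s < U \<omega>} * prob {\<omega> \<in> space M. t < V \<omega>}\<bar> \<le> \<alpha>"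
  shows "\<bar>expectation (\<lambda>\<omega>. U \<omega> * V \<omega>) - expectation U * expectation V\<bar> \<le> A * B * \<alpha>"
proof -
  obtain \<omega>0 where "\<omega>0 \<in> space M" using not_empty by blast
  then have AB: "0 \<le> A" "0 \<le> B"
    using U V by force+
  have "0 \<le> \<alpha>" using \<alpha>[of 0 0] by linarith
  have intU: "integrable M U"
    using U by (intro integrable_const_bound[of _ A]) auto
  have intV: "integrable M V"
    using V by (intro integrable_const_bound[of _ B]) auto
  have intUV: "integrable M (\<lambda>\<omega>. U \<omega> * V \<omega>)"
    using U V AB by (intro integrable_const_bound[of _ "A * B"]) (auto simp: abs_mult intro!: mult_mono)
  define P where "P = (\<lambda>z::real \<times> real. emeasure M {\<omega> \<in> space M. fst z < U \<omega> \<and> snd z < V \<omega>})"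
  define Q where "Q = (\<lambda>z::real \<times> real. emeasure M {\<omega> \<in> space M. fst z < U \<omega>} * emeasure M {\<omega> \<in> space M. snd z < V \<omega>})"
  define b where "b = {0..A} \<times> {0..B}"
  have [measurable]: "b \<in> sets (lborel \<Otimes>\<^sub>M lborel)" by (simp add: b_def)
  interpret UV: pair_sigma_finite M "lborel \<Otimes>\<^sub>M lborel :: (real \<times> real) measure"
    by (intro pair_sigma_finite.intro sigma_finite_measure_axioms)
       (simp add: lborel_prod lborel.sigma_finite_measure_axioms)
  \<comment> \<open>The points of \<open>{0..A}\<close> below \<open>u\<close> form an interval of
    length \<open>u\<close>, so a bounded variable is recovered from the indicators of its level
    sets.\<close>
  have layer: "(\<integral>\<^sup>+s. indicator {0..A} s * indicator {s. s < u} s \<partial>lborel) = ennreal u"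
    if "0 \<le> u" "u \<le> A" for u A :: real
  proof -
    have "(\<lambda>s. indicator {0..A} s * indicator {s. s < u} s :: ennreal) = indicator {0..<u}"
      using that by (auto simp: fun_eq_iff indicator_def)
    then show ?thesis using that by simp
  qed
  have E1: "(\<integral>\<^sup>+\<omega>. ennreal (U \<omega> * V \<omega>) \<partial>M) = (\<integral>\<^sup>+z. indicator b z * P z \<partial>(lborel \<Otimes>\<^sub>M lborel))"
  proof -
    have "(\<integral>\<^sup>+\<omega>. ennreal (U \<omega> * V \<omega>) \<partial>M)
      = (\<integral>\<^sup>+\<omega>. (\<integral>\<^sup>+z. indicator b z * indicator {\<omega> \<in> space M. fst z < U \<omega> \<and> snd z < V \<omega>} \<omega>
            \<partial>(lborel \<Otimes>\<^sub>M lborel)) \<partial>M)"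
    proof (rule nn_integral_cong)
      fix \<omega> assume w: "\<omega> \<in> space M"
      have "(\<integral>\<^sup>+z. indicator b z * indicator {\<omega> \<in> space M. fst z < U \<omega> \<and> snd z < V \<omega>} \<omega>
            \<partial>(lborel \<Otimes>\<^sub>M lborel))
         = (\<integral>\<^sup>+z. (indicator {0..A} (fst z) * indicator {s. s < U \<omega>} (fst z)) *
               (indicator {0..B} (snd z) * indicator {s. s < V \<omega>} (snd z)) \<partial>(lborel \<Otimes>\<^sub>M lborel))"
        using w by (intro nn_integral_cong) (auto simp: b_def indicator_def)
      also have "\<dots> = (\<integral>\<^sup>+s. (\<integral>\<^sup>+t. (indicator {0..A} s * indicator {s. s < U \<omega>} s) *
               (indicator {0..B} t * indicator {s. s < V \<omega>} t) \<partial>lborel) \<partial>lborel)"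
        by (subst lborel.nn_integral_fst[symmetric]) auto
      also have "\<dots> = ennreal (U \<omega>) * ennreal (V \<omega>)"
        using U[OF w] V[OF w] by (simp add: nn_integral_cmult nn_integral_multc layer)
      finally show "ennreal (U \<omega> * V \<omega>) = (\<integral>\<^sup>+z. indicator b z * indicator {\<omega> \<in> space M. fst z < U \<omega> \<and> snd z < V \<omega>} \<omega>
            \<partial>(lborel \<Otimes>\<^sub>M lborel))"
        using U[OF w] V[OF w] by (simp add: ennreal_mult)
    qed
    also have "\<dots> = (\<integral>\<^sup>+z. (\<integral>\<^sup>+\<omega>. indicator b z * indicator {\<omega> \<in> space M. fst z < U \<omega> \<and> snd z < V \<omega>} \<omega> \<partial>M)
            \<partial>(lborel \<Otimes>\<^sub>M lborel))"
      by (intro UV.Fubini'[symmetric]) measurable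
    also have "\<dots> = (\<integral>\<^sup>+z. indicator b z * P z \<partial>(lborel \<Otimes>\<^sub>M lborel))"
      unfolding P_def by (intro nn_integral_cong) (simp add: nn_integral_cmult)
    finally show ?thesis .
  qed
  have one: "(\<integral>\<^sup>+\<omega>. ennreal (W \<omega>) \<partial>M) = (\<integral>\<^sup>+s. indicator {0..D} s * emeasure M {\<omega> \<in> space M. s < W \<omega>} \<partial>lborel)"
    if [measurable]: "random_variable borel W" and W: "\<And>\<omega>. \<omega> \<in> space M \<Longrightarrow> 0 \<le> W \<omega> \<and> W \<omega> \<le> D"
    for W :: "'a \<Rightarrow> real" and D
  proof -
    interpret W: pair_sigma_finite M "lborel :: real measure"
      by (intro pair_sigma_finite.intro sigma_finite_measure_axioms lborel.sigma_finite_measure_axioms)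
    have "(\<integral>\<^sup>+\<omega>. ennreal (W \<omega>) \<partial>M)
      = (\<integral>\<^sup>+\<omega>. (\<integral>\<^sup>+s. indicator {0..D} s * indicator {\<omega> \<in> space M. s < W \<omega>} \<omega> \<partial>lborel) \<partial>M)"
    proof (rule nn_integral_cong)
      fix \<omega> assume w: "\<omega> \<in> space M"
      show "ennreal (W \<omega>) = (\<integral>\<^sup>+s. indicator {0..D} s * indicator {\<omega> \<in> space M. s < W \<omega>} \<omega> \<partial>lborel)"
        using layer[of "W \<omega>" D] W[OF w] w by (simp add: indicator_def)
    qed
    also have "\<dots> = (\<integral>\<^sup>+s. (\<integral>\<^sup>+\<omega>. indicator {0..D} s * indicator {\<omega> \<in> space M. s < W \<omega>} \<omega> \<partial>M) \<partial>lborel)"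
      by (intro W.Fubini'[symmetric]) measurable
    finally show ?thesis
      by (simp add: nn_integral_cmult)
  qed
  have Q[measurable]: "Q \<in> borel_measurable (lborel \<Otimes>\<^sub>M lborel)"
    unfolding Q_def by measurable
  have P[measurable]: "P \<in> borel_measurable (lborel \<Otimes>\<^sub>M lborel)"
    unfolding P_def by measurable
  have E2: "(\<integral>\<^sup>+\<omega>. ennreal (U \<omega>) \<partial>M) * (\<integral>\<^sup>+\<omega>. ennreal (V \<omega>) \<partial>M)
      = (\<integral>\<^sup>+z. indicator b z * Q z \<partial>(lborel \<Otimes>\<^sub>M lborel))"
  proof -
    have "(\<integral>\<^sup>+z. indicator b z * Q z \<partial>(lborel \<Otimes>\<^sub>M lborel))
      = (\<integral>\<^sup>+z. (indicator {0..A} (fst z) * emeasure M {\<omega> \<in> space M. fst z < U \<omega>}) *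
           (indicator {0..B} (snd z) * emeasure M {\<omega> \<in> space M. snd z < V \<omega>}) \<partial>(lborel \<Otimes>\<^sub>M lborel))"
      unfolding Q_def b_def by (intro nn_integral_cong) (auto simp: indicator_def)
    also have "\<dots> = (\<integral>\<^sup>+s. (\<integral>\<^sup>+t. (indicator {0..A} s * emeasure M {\<omega> \<in> space M. s < U \<omega>}) *
           (indicator {0..B} t * emeasure M {\<omega> \<in> space M. t < V \<omega>}) \<partial>lborel) \<partial>lborel)"
      by (subst lborel.nn_integral_fst[symmetric]) auto
    also have "\<dots> = (\<integral>\<^sup>+\<omega>. ennreal (U \<omega>) \<partial>M) * (\<integral>\<^sup>+\<omega>. ennreal (V \<omega>) \<partial>M)"
      by (simp add: nn_integral_cmult nn_integral_multc one[OF assms(1) U] one[OF assms(2) V])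
    finally show ?thesis by simp
  qed
  have box: "(\<integral>\<^sup>+z. indicator b z * ennreal \<alpha> \<partial>(lborel \<Otimes>\<^sub>M lborel)) = ennreal (A * B * \<alpha>)"
    using AB \<open>0 \<le> \<alpha>\<close>
    by (simp add: nn_integral_multc b_def lborel.emeasure_pair_measure_Times ennreal_mult)
  \<comment> \<open>Subtraction of extended nonnegative reals is truncated, so the two-sided bound
    on the covariances of the indicators is kept as a pair of additive inequalities.\<close>
  have PQ: "P z \<le> Q z + ennreal \<alpha>" "Q z \<le> P z + ennreal \<alpha>" for z
    using \<alpha>[of "fst z" "snd z"] \<open>0 \<le> \<alpha>\<close>
    by (auto simp: P_def Q_def emeasure_eq_measure simp flip: ennreal_mult ennreal_plus intro!: ennreal_leI)
  have eUV: "(\<integral>\<^sup>+\<omega>. ennreal (U \<omega> * V \<omega>) \<partial>M) = ennreal (expectation (\<lambda>\<omega>. U \<omega> * V \<omega>))"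
    using U V by (intro nn_integral_eq_integral intUV) auto
  have eU: "(\<integral>\<^sup>+\<omega>. ennreal (U \<omega>) \<partial>M) = ennreal (expectation U)"
    using U by (intro nn_integral_eq_integral intU) auto
  have eV: "(\<integral>\<^sup>+\<omega>. ennreal (V \<omega>) \<partial>M) = ennreal (expectation V)"
    using V by (intro nn_integral_eq_integral intV) auto
  have nn: "0 \<le> expectation U" "0 \<le> expectation V" "0 \<le> expectation (\<lambda>\<omega>. U \<omega> * V \<omega>)"
    using U V by (auto intro!: integral_nonneg_AE)
  have "ennreal (expectation (\<lambda>\<omega>. U \<omega> * V \<omega>)) \<le> (\<integral>\<^sup>+z. indicator b z * Q z + indicator b z * ennreal \<alpha> \<partial>(lborel \<Otimes>\<^sub>M lborel))"
    unfolding eUV[symmetric] E1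
    by (intro nn_integral_mono) (simp add: PQ mult_left_mono flip: distrib_left)
  also have "\<dots> = ennreal (expectation U * expectation V + A * B * \<alpha>)"
    using nn AB \<open>0 \<le> \<alpha>\<close> by (simp add: nn_integral_add box E2[symmetric] eU eV ennreal_mult)
  finally have 1: "expectation (\<lambda>\<omega>. U \<omega> * V \<omega>) \<le> expectation U * expectation V + A * B * \<alpha>"
    using nn AB \<open>0 \<le> \<alpha>\<close> by (subst (asm) ennreal_le_iff) auto
  have "ennreal (expectation U * expectation V) \<le> (\<integral>\<^sup>+z. indicator b z * P z + indicator b z * ennreal \<alpha> \<partial>(lborel \<Otimes>\<^sub>M lborel))"
    using nn by (simp add: ennreal_mult eU[symmetric] eV[symmetric] E2)
      (intro nn_integral_mono, simp add: PQ mult_left_mono flip: distrib_left)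
  also have "\<dots> = ennreal (expectation (\<lambda>\<omega>. U \<omega> * V \<omega>) + A * B * \<alpha>)"
    using nn AB \<open>0 \<le> \<alpha>\<close> by (simp add: nn_integral_add box E1[symmetric] eUV)
  finally have 2: "expectation U * expectation V \<le> expectation (\<lambda>\<omega>. U \<omega> * V \<omega>) + A * B * \<alpha>"
    using nn AB \<open>0 \<le> \<alpha>\<close> by (subst (asm) ennreal_le_iff) auto
  show ?thesis using 1 2 by linarith
qed

text \<open>Adding \<open>A\<close> and \<open>B\<close> makes the variables nonnegative with upper
  bounds \<open>2 * A\<close> and \<open>2 * B\<close>, whence the factor 4. The shift changes
  neither the covariance nor the family of level sets.\<close>

lemma (in prob_space) covariance_le_bounded:
  fixes U V :: "'a \<Rightarrow> real"
  assumes [measurable]: "random_variable borel U" "random_variable borel V"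
    and U: "\<And>\<omega>. \<omega> \<in> space M \<Longrightarrow> \<bar>U \<omega>\<bar> \<le> A"
    and V: "\<And>\<omega>. \<omega> \<in> space M \<Longrightarrow> \<bar>V \<omega>\<bar> \<le> B"
    and \<alpha>: "\<And>s t. \<bar>prob {\<omega> \<in> space M. s < U \<omega> \<and> t < V \<omega>}
        - prob {\<omega> \<in> space M. s < U \<omega>} * prob {\<omega> \<in> space M. t < V \<omega>}\<bar> \<le> \<alpha>"
  shows "\<bar>expectation (\<lambda>\<omega>. U \<omega> * V \<omega>) - expectation U * expectation V\<bar> \<le> 4 * A * B * \<alpha>"
proof -
  have intU: "integrable M U"
    using U by (intro integrable_const_bound[of _ A]) auto
  have intV: "integrable M V"
    using V by (intro integrable_const_bound[of _ B]) auto
  obtain \<omega>0 where "\<omega>0 \<in> space M" using not_empty by blast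
  then have AB: "0 \<le> A" "0 \<le> B"
    using U V by force+
  have intUV: "integrable M (\<lambda>\<omega>. U \<omega> * V \<omega>)"
    using U V AB by (intro integrable_const_bound[of _ "A * B"]) (auto simp: abs_mult intro!: mult_mono)
  have "\<bar>expectation (\<lambda>\<omega>. (U \<omega> + A) * (V \<omega> + B)) - expectation (\<lambda>\<omega>. U \<omega> + A) * expectation (\<lambda>\<omega>. V \<omega> + B)\<bar>
      \<le> (2 * A) * (2 * B) * \<alpha>"
  proof (rule covariance_le_nonneg)
    fix s t :: real
    show "\<bar>prob {\<omega> \<in> space M. s < U \<omega> + A \<and> t < V \<omega> + B}
        - prob {\<omega> \<in> space M. s < U \<omega> + A} * prob {\<omega> \<in> space M. t < V \<omega> + B}\<bar> \<le> \<alpha>"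
      using \<alpha>[of "s - A" "t - B"] by (simp add: diff_less_eq)
  next
    fix \<omega> assume "\<omega> \<in> space M"
    from U[OF this] V[OF this]
    show "0 \<le> U \<omega> + A \<and> U \<omega> + A \<le> 2 * A" "0 \<le> V \<omega> + B \<and> V \<omega> + B \<le> 2 * B" by auto
  qed auto
  also have "expectation (\<lambda>\<omega>. (U \<omega> + A) * (V \<omega> + B))
      = expectation (\<lambda>\<omega>. U \<omega> * V \<omega>) + expectation U * B + A * expectation V + A * B"
    using intU intV intUV by (simp add: algebra_simps prob_space)
  also have "expectation (\<lambda>\<omega>. U \<omega> + A) = expectation U + A"
    using intU by (simp add: prob_space)
  also have "expectation (\<lambda>\<omega>. V \<omega> + B) = expectation V + B"
    using intV by (simp add: prob_space)
  finally show ?thesis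
    by (simp add: algebra_simps)
qed

text \<open>A supremum of reals dominates the members of its set only if the set is bounded above;
  all the differences here are at most 1.\<close>

lemma (in prob_space) alpha_mixing_ge:
  assumes Z: "\<And>i. random_variable borel (Z i)"
    and "A \<in> generated_events M Z {..0}" "B \<in> generated_events M Z {int m..}"
  shows "\<bar>prob (A \<inter> B) - prob A * prob B\<bar> \<le> alpha_mixing M Z m"
  unfolding alpha_mixing_def
proof (rule cSup_upper)
  have le1: "\<bar>prob A - prob B * prob C\<bar> \<le> 1" for A B C
    using prob_le_1[of A] prob_le_1[of "B"] prob_le_1[of C] mult_le_one[of "prob B" "prob C"]
      measure_nonneg[of M A] measure_nonneg[of M B] measure_nonneg[of M C]
      mult_nonneg_nonneg[of "prob B" "prob C"] by linarith
  then show "bdd_above {\<bar>prob (A \<inter> B) - prob A * prob B\<bar> |A B.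
      A \<in> generated_events M Z {..0} \<and> B \<in> generated_events M Z {int m..}}"
    by (intro bdd_aboveI[of _ 1]) auto
qed (use assms in auto)

text \<open>On each side of \<open>i\<close> every distance occurs at most once, so each side is
  part of a geometric series.\<close>

lemma sum_exp_abs_le:
  fixes c :: real and i :: int
  assumes "0 < c" "finite J"
  shows "(\<Sum>j\<in>J. exp (- c * \<bar>real_of_int (j - i)\<bar>)) \<le> 2 / (1 - exp (- c))"
proof -
  define q where "q = exp (- c)"
  have q: "0 < q" "q < 1" using assms by (auto simp: q_def)
  have eq: "exp (- c * \<bar>real_of_int (j - i)\<bar>) = q ^ nat \<bar>j - i\<bar>" for j
    by (simp add: q_def mult.commute flip: exp_of_nat_mult)
  have half: "(\<Sum>j\<in>L. q ^ nat \<bar>j - i\<bar>) \<le> 1 / (1 - q)" if "finite L" "inj_on (\<lambda>j. nat \<bar>j - i\<bar>) L" for L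
  proof -
    have "(\<Sum>j\<in>L. q ^ nat \<bar>j - i\<bar>) = (\<Sum>m\<in>(\<lambda>j. nat \<bar>j - i\<bar>) ` L. q ^ m)"
      using that(2) by (simp add: sum.reindex)
    also have "\<dots> \<le> (\<Sum>m. q ^ m)"
      using q that(1) by (intro sum_le_suminf) auto
    finally show ?thesis using q by (simp add: suminf_geometric)
  qed
  have "(\<Sum>j\<in>J. q ^ nat \<bar>j - i\<bar>) = (\<Sum>j\<in>{j\<in>J. j \<le> i} \<union> {j\<in>J. i < j}. q ^ nat \<bar>j - i\<bar>)"
    by (intro sum.cong) auto
  also have "\<dots> = (\<Sum>j\<in>{j\<in>J. j \<le> i}. q ^ nat \<bar>j - i\<bar>) + (\<Sum>j\<in>{j\<in>J. i < j}. q ^ nat \<bar>j - i\<bar>)"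
    using assms by (intro sum.union_disjoint) auto
  also have "\<dots> \<le> 1 / (1 - q) + 1 / (1 - q)"
    using assms by (intro add_mono half) (auto simp: inj_on_def)
  finally show ?thesis unfolding eq by (simp add: q_def)
qed

text \<open>The integrand is a function of the whole path, whose law is invariant under shifts.
  Taking \<open>G\<close> constant covers expectations at a single time.\<close>

lemma stationary_pair_expectation:
  fixes Z :: "int \<Rightarrow> 'a \<Rightarrow> 'b::topological_space" and H G :: "'b \<Rightarrow> real"
  assumes st: "stationary_process M Z" and [measurable]: "H \<in> borel_measurable borel" "G \<in> borel_measurable borel"
  shows "(LINT \<omega>|M. H (Z (i + h) \<omega>) * G (Z (j + h) \<omega>)) = (LINT \<omega>|M. H (Z i \<omega>) * G (Z j \<omega>))"
proof -
  have Z[measurable]: "Z i \<in> borel_measurable M" for i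
    using st by (simp add: stationary_process_def)
  have shift[measurable]: "(\<lambda>\<omega> i. Z (i + h) \<omega>) \<in> measurable M (\<Pi>\<^sub>M i\<in>UNIV. borel)" for h
    by (rule measurable_PiM_single') (auto simp: space_PiM)
  have F: "(\<lambda>x. H (x i) * G (x j)) \<in> borel_measurable (\<Pi>\<^sub>M i\<in>UNIV. borel)"
    by measurable
  have "(LINT \<omega>|M. H (Z (i + h) \<omega>) * G (Z (j + h) \<omega>)) = (LINT x|distr M (\<Pi>\<^sub>M i\<in>UNIV. borel) (\<lambda>\<omega> i. Z (i + h) \<omega>). H (x i) * G (x j))"
    by (subst integral_distr[OF shift F]) simp
  also have "distr M (\<Pi>\<^sub>M i\<in>UNIV. borel) (\<lambda>\<omega> i. Z (i + h) \<omega>) = distr M (\<Pi>\<^sub>M i\<in>UNIV. borel) (\<lambda>\<omega> i. Z i \<omega>)"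
    using st by (simp add: stationary_process_def)
  also have "(LINT x|distr M (\<Pi>\<^sub>M i\<in>UNIV. borel) (\<lambda>\<omega> i. Z i \<omega>). H (x i) * G (x j)) = (LINT \<omega>|M. H (Z i \<omega>) * G (Z j \<omega>))"
    using integral_distr[OF shift[of 0] F] by simp
  finally show ?thesis .
qed

text \<open>The level sets of \<open>H (Z 0)\<close> belong to the past and those of
  \<open>H (Z m)\<close> to the future, so the mixing coefficient bounds the covariances of their
  indicators.\<close>

lemma (in prob_space) mixing_covariance_le:
  fixes Z :: "int \<Rightarrow> 'a \<Rightarrow> 'b::topological_space" and H :: "'b \<Rightarrow> real"
  assumes st: "stationary_process M Z" and [measurable]: "H \<in> borel_measurable borel"
    and bnd: "\<And>z. \<bar>H z\<bar> \<le> B"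
  shows "\<bar>expectation (\<lambda>\<omega>. H (Z 0 \<omega>) * H (Z (int m) \<omega>)) - expectation (\<lambda>\<omega>. H (Z 0 \<omega>)) * expectation (\<lambda>\<omega>. H (Z (int m) \<omega>))\<bar>
    \<le> 4 * B * B * alpha_mixing M Z m"
proof (rule covariance_le_bounded)
  have Z[measurable]: "Z i \<in> borel_measurable M" for i
    using st by (simp add: stationary_process_def)
  show "random_variable borel (\<lambda>\<omega>. H (Z 0 \<omega>))" "random_variable borel (\<lambda>\<omega>. H (Z (int m) \<omega>))"
    by measurable
  fix s t :: real
  have gen: "{\<omega> \<in> space M. s < H (Z i \<omega>)} \<in> generated_events M Z I" if "i \<in> I" for i s I
  proof -
    have "{\<omega> \<in> space M. s < H (Z i \<omega>)} = Z i -` {z. s < H z} \<inter> space M" by auto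
    moreover have "{z. s < H z} \<in> sets borel"
    proof -
      have "{z \<in> space borel. s < H z} \<in> sets borel" by measurable
      then show ?thesis by simp
    qed
    ultimately show ?thesis
      using that unfolding generated_events_def by (intro sigma_sets.Basic) blast
  qed
  have "{\<omega> \<in> space M. s < H (Z 0 \<omega>) \<and> t < H (Z (int m) \<omega>)}
      = {\<omega> \<in> space M. s < H (Z 0 \<omega>)} \<inter> {\<omega> \<in> space M. t < H (Z (int m) \<omega>)}"
    by auto
  then show "\<bar>prob {\<omega> \<in> space M. s < H (Z 0 \<omega>) \<and> t < H (Z (int m) \<omega>)}
      - prob {\<omega> \<in> space M. s < H (Z 0 \<omega>)} * prob {\<omega> \<in> space M. t < H (Z (int m) \<omega>)}\<bar> \<le> alpha_mixing M Z m"
    using alpha_mixing_ge[of Z, OF Z gen gen, of 0 "int m" m s t] by simp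
qed (use bnd in auto)

text \<open>The mean square is a double sum of covariances divided by \<open>n^2\<close>.
  Exponential mixing bounds every row of it independently of \<open>n\<close>, which leaves order
  \<open>1 / n\<close>.\<close>

lemma (in prob_space) mixing_mean_square_error:
  fixes Z :: "int \<Rightarrow> 'a \<Rightarrow> 'b::topological_space" and H :: "'b \<Rightarrow> real"
  assumes st: "stationary_process M Z" and [measurable]: "H \<in> borel_measurable borel"
    and bnd: "\<And>z. \<bar>H z\<bar> \<le> B"
    and mix: "0 < \<gamma>" "0 < c" "\<And>m. m \<ge> 1 \<Longrightarrow> alpha_mixing M Z m \<le> \<gamma> * exp (- c * real m)"
    and n: "1 \<le> n"
  defines "W \<equiv> \<lambda>\<omega>. ((\<Sum>i=1..int n. H (Z i \<omega>)) / real n - expectation (\<lambda>\<omega>. H (Z 1 \<omega>)))\<^sup>2"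
  shows "integrable M W" "expectation W \<le> 8 * B\<^sup>2 * (\<gamma> + 1) / (1 - exp (- c)) / real n"
proof -
  have Z[measurable]: "Z i \<in> borel_measurable M" for i
    using st by (simp add: stationary_process_def)
  define e where "e = expectation (\<lambda>\<omega>. H (Z 1 \<omega>))"
  have "0 \<le> B" using bnd[of undefined] by linarith
  have mean: "expectation (\<lambda>\<omega>. H (Z i \<omega>)) = e" for i
    using stationary_pair_expectation[OF st, of H "\<lambda>_. 1" 1 "i - 1" 0] by (simp add: e_def)
  have intH: "integrable M (\<lambda>\<omega>. H (Z i \<omega>))" for i
    using bnd by (intro integrable_const_bound[of _ B]) auto
  have intHH: "integrable M (\<lambda>\<omega>. H (Z i \<omega>) * H (Z j \<omega>))" for i j
    using bnd \<open>0 \<le> B\<close> by (intro integrable_const_bound[of _ "B * B"]) (auto simp: abs_mult intro!: mult_mono)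
  \<comment> \<open>The mixing bound starts at lag 1; \<open>\<gamma> + 1\<close> instead of
    \<gamma> lets the same constant dominate the variances on the diagonal.\<close>
  define D where "D = 4 * B\<^sup>2 * (\<gamma> + 1)"
  define cv where "cv = (\<lambda>i j. expectation (\<lambda>\<omega>. H (Z i \<omega>) * H (Z j \<omega>)) - e * e)"
  have cov_int: "integrable M (\<lambda>\<omega>. (H (Z i \<omega>) - e) * (H (Z j \<omega>) - e))" for i j
    using intH intHH by (simp add: algebra_simps)
  have cov_eq: "expectation (\<lambda>\<omega>. (H (Z i \<omega>) - e) * (H (Z j \<omega>) - e)) = cv i j" for i j
    using intH intHH by (simp add: algebra_simps mean cv_def prob_space)
  have cov_sym: "cv i j = cv j i" for i j by (simp add: cv_def mult.commute)
  \<comment> \<open>The mixing coefficient pairs the past with a later future, so the times are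
    ordered first; symmetry of the covariance gives the other order.\<close>
  have cov1: "cv i j \<le> D * exp (- c * \<bar>real_of_int (j - i)\<bar>)" if "i \<le> j" for i j
  proof (cases "i = j")
    case True
    have "expectation (\<lambda>\<omega>. H (Z i \<omega>) * H (Z i \<omega>)) \<le> B\<^sup>2"
    proof (rule integral_le_const[OF intHH])
      have "H z * H z \<le> B\<^sup>2" for z
        using bnd[of z] abs_le_square_iff[of "H z" B] \<open>0 \<le> B\<close> by (simp add: power2_eq_square)
      then show "AE \<omega> in M. H (Z i \<omega>) * H (Z i \<omega>) \<le> B\<^sup>2" by auto
    qed
    then have "cv i j \<le> B\<^sup>2"
      using True zero_le_square[of e] unfolding cv_def by (simp only:)
    also have "\<dots> \<le> D"
    proof -
      have "B\<^sup>2 * 1 \<le> B\<^sup>2 * (4 * (\<gamma> + 1))"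
        using mix(1) by (intro mult_left_mono) auto
      then show ?thesis by (simp add: D_def algebra_simps)
    qed
    finally show ?thesis using True by simp
  next
    case False
    define m where "m = nat (j - i)"
    have m: "1 \<le> m" "int m = j - i" using False that by (auto simp: m_def)
    have "cv i j = expectation (\<lambda>\<omega>. H (Z 0 \<omega>) * H (Z (int m) \<omega>)) - e * e"
      using stationary_pair_expectation[OF st, of H H 0 i "int m"] m by (simp add: cv_def)
    also have "\<dots> \<le> 4 * B * B * alpha_mixing M Z m"
      using mixing_covariance_le[OF st, of H B m] bnd by (simp add: mean)
    also have "\<dots> \<le> 4 * B * B * (\<gamma> * exp (- c * real m))"
      using mix(3)[OF m(1)] \<open>0 \<le> B\<close> by (intro mult_left_mono) auto
    also have "\<dots> = (4 * B\<^sup>2 * \<gamma>) * exp (- c * real m)"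
      by (simp add: power2_eq_square)
    also have "\<dots> \<le> D * exp (- c * real m)"
      unfolding D_def by (intro mult_right_mono mult_left_mono) auto
    also have "real m = \<bar>real_of_int (j - i)\<bar>"
      using m by (metis abs_of_nat of_int_of_nat_eq)
    finally show ?thesis .
  qed
  have cov: "cv i j \<le> D * exp (- c * \<bar>real_of_int (j - i)\<bar>)" for i j
  proof (cases "i \<le> j")
    case False
    then have "cv j i \<le> D * exp (- c * \<bar>real_of_int (i - j)\<bar>)" by (intro cov1) auto
    then show ?thesis by (simp add: cov_sym[of i] abs_minus_commute)
  qed (rule cov1)
  have W_eq: "W \<omega> = (\<Sum>i=1..int n. \<Sum>j=1..int n. (H (Z i \<omega>) - e) * (H (Z j \<omega>) - e)) / (real n)\<^sup>2" for \<omega>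
  proof -
    have "(\<Sum>i=1..int n. H (Z i \<omega>)) / real n - e = (\<Sum>i=1..int n. H (Z i \<omega>) - e) / real n"
      using n by (simp add: sum_subtractf field_simps)
    then show ?thesis
      unfolding W_def e_def[symmetric] by (simp add: power_divide power2_eq_square sum_product)
  qed
  show "integrable M W"
    unfolding W_eq using cov_int by (intro integrable_divide Bochner_Integration.integrable_sum) auto
  have "expectation W = (\<Sum>i=1..int n. \<Sum>j=1..int n. cv i j) / (real n)\<^sup>2"
    unfolding W_eq using cov_int by (simp add: cov_eq)
  also have "\<dots> \<le> (\<Sum>i=1..int n. D * (2 / (1 - exp (- c)))) / (real n)\<^sup>2"
  proof (intro divide_right_mono sum_mono)
    fix i
    have "(\<Sum>j=1..int n. cv i j) \<le> D * (\<Sum>j=1..int n. exp (- c * \<bar>real_of_int (j - i)\<bar>))"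
      unfolding sum_distrib_left by (intro sum_mono cov)
    also have "\<dots> \<le> D * (2 / (1 - exp (- c)))"
      using mix by (intro mult_left_mono sum_exp_abs_le) (auto simp: D_def)
    finally show "(\<Sum>j=1..int n. cv i j) \<le> D * (2 / (1 - exp (- c)))" .
  qed auto
  also have "\<dots> = 8 * B\<^sup>2 * (\<gamma> + 1) / (1 - exp (- c)) / real n"
    using n by (simp add: D_def power2_eq_square)
  finally show "expectation W \<le> 8 * B\<^sup>2 * (\<gamma> + 1) / (1 - exp (- c)) / real n" .
qed

section \<open>Wavelets and the additive regression model\<close>

lemma wavelet_system_onb:
  assumes "wavelet_system_01 R \<tau> K \<phi> \<psi> \<phi>w \<psi>w" "\<tau> \<le> j"
  shows "orthonormal_basis_01 ({..<2 ^ j} <+> (SIGMA j:{j..}. {..<2 ^ j})) (case_sum (\<lambda>k. \<phi>w j k) (\<lambda>(j, k). \<psi>w j k))"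
  using assms by (simp add: wavelet_system_01_def)

lemma wavelet_system_L2:
  assumes "wavelet_system_01 R \<tau> K \<phi> \<psi> \<phi>w \<psi>w" "\<tau> \<le> j" "k < 2 ^ j"
  shows "\<phi>w j k \<in> L2_01" "\<psi>w j k \<in> L2_01"
proof -
  let ?I = "{..<2 ^ j} <+> (SIGMA j:{j..}. {..<2 ^ j})"
  let ?e = "case_sum (\<lambda>k. \<phi>w j k) (\<lambda>(j, k). \<psi>w j k)"
  have L2: "\<And>a. a \<in> ?I \<Longrightarrow> ?e a \<in> L2_01"
    using wavelet_system_onb[OF assms(1,2)] unfolding orthonormal_basis_01_def by blast
  show "\<phi>w j k \<in> L2_01" "\<psi>w j k \<in> L2_01"
    using L2[of "Inl k"] L2[of "Inr (j, k)"] assms(3) by auto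
qed

text \<open>\<open>orthonormal_error_le\<close> is applied to the constant 1 with tail bound 0 and
  exact coefficients, so the projection error vanishes. A zero integral of a square yields equality
  only almost everywhere.\<close>

lemma wavelet_phi_partition_of_unity:
  assumes w: "wavelet_system_01 R \<tau> K \<phi> \<psi> \<phi>w \<psi>w" and j: "\<tau> \<le> j"
  shows "AE x in lborel. x \<in> {0..1} \<longrightarrow> (\<Sum>k<2 ^ j. \<phi>w j k x) = 2 powr (real j / 2)"
proof -
  let ?I = "{..<2 ^ j} <+> (SIGMA j:{j..}. {..<2 ^ j})"
  let ?e = "case_sum (\<lambda>k. \<phi>w j k) (\<lambda>(j, k). \<psi>w j k)"
  let ?F = "Inl ` {..<2 ^ j} :: (nat + nat \<times> nat) set"
  let ?c = "2 powr (- real j / 2)"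
  note onb = wavelet_system_onb[OF w j]
  have int: "(LBINT x:{0..1}. \<phi>w j' k x) = 2 powr (- real j' / 2)" "(LBINT x:{0..1}. \<psi>w j' k x) = 0"
    if "j \<le> j'" "k < 2 ^ j'" for j' k
    using w that j by (simp_all add: wavelet_system_01_def)
  define D where "D = (\<lambda>x. (1 - ?c * (\<Sum>k<2 ^ j. \<phi>w j k x)) :: real)"
  have "(LBINT x:{0..1}. (1 - (\<Sum>a\<in>?F. ?c * ?e a x))\<^sup>2)
      \<le> 0 + (\<Sum>a\<in>?F. (?c - (LBINT x:{0..1}. 1 * ?e a x))\<^sup>2)"
  proof (rule orthonormal_error_le[OF onb])
    fix G assume "finite G" "G \<subseteq> ?I - ?F"
    then show "(\<Sum>a\<in>G. (LBINT x:{0..1}. 1 * ?e a x)\<^sup>2) \<le> 0"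
      by (intro sum_nonpos) (auto simp: int dest!: subsetD)
  qed (auto intro: L2_01_const)
  also have "\<dots> = 0"
    using int(1)[of j] by (simp add: sum.reindex)
  also have "(\<lambda>x. (1 - (\<Sum>a\<in>?F. ?c * ?e a x))) = D"
    by (simp add: D_def sum.reindex sum_distrib_left)
  finally have le: "(LBINT x:{0..1}. (D x)\<^sup>2) \<le> 0" .
  have "D \<in> L2_01"
  proof -
    have "(\<lambda>x. 1 + (\<Sum>k<2 ^ j. (- ?c) * \<phi>w j k x)) \<in> L2_01"
      using wavelet_system_L2(1)[OF w j] by (intro L2_01_add L2_01_const L2_01_sum) auto
    then show ?thesis by (simp add: D_def sum_distrib_left sum_negf)
  qed
  then have "integrable lborel (\<lambda>x. indicator {0..1} x * (D x)\<^sup>2)"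
    by (simp add: L2_01_def set_integrable_def)
  moreover have "(LBINT x. indicator {0..1} x * (D x)\<^sup>2) = 0"
  proof (rule antisym)
    show "(LBINT x. indicator {0..1} x * (D x)\<^sup>2) \<le> 0"
      using le by (simp add: set_lebesgue_integral_def)
  qed (simp add: Bochner_Integration.integral_nonneg)
  ultimately have "AE x in lborel. indicator {0..1} x * (D x)\<^sup>2 = 0"
    by (subst (asm) integral_nonneg_eq_0_iff_AE) auto
  then show ?thesis
  proof (eventually_elim, intro impI)
    fix x :: real assume "indicator {0..1} x * (D x)\<^sup>2 = 0" "x \<in> {0..1}"
    then have "D x = 0" by simp
    then show "(\<Sum>k<2 ^ j. \<phi>w j k x) = 2 powr (real j / 2)"
      by (simp add: D_def powr_minus field_simps)
  qed
qed

text \<open>The cylinder over a null set is null in the cube: its measure there equals the integral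
  over \<open>{0..1}\<close> of the indicator of the null set.\<close>

lemma AE_unit_cube_coordinate:
  fixes v :: "'d::finite"
  assumes "AE y in lborel. y \<in> {0..1} \<longrightarrow> P y"
  shows "AE x in (lborel :: (real ^ 'd) measure). x \<in> unit_cube \<longrightarrow> P (x $ v)"
proof -
  obtain N where N: "{y. \<not> (y \<in> {0..1} \<longrightarrow> P y)} \<subseteq> N" "emeasure lborel N = 0" "N \<in> sets borel"
    using AE_E[OF assms] by auto
  note [measurable] = N(3)
  let ?a = "indicator N :: real \<Rightarrow> real"
  have AEN: "AE y in lborel. y \<notin> N"
    using N by (intro AE_not_in) (auto simp: null_sets_def)
  have int: "set_integrable lborel {0..1} ?a"
    unfolding set_integrable_def using AEN
    by (subst integrable_cong_AE[of _ _ "\<lambda>_. 0"]) auto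
  have "(LBINT x:{0..1}. ?a x) = 0"
    unfolding set_lebesgue_integral_def using AEN by (intro integral_eq_zero_AE) auto
  then have "(LINT x|lborel. indicator unit_cube (x :: real ^ 'd) * ?a (x $ v)) = 0"
    using unit_cube_integral_single(2)[OF int, of v] by (simp add: set_lebesgue_integral_def)
  moreover have "integrable lborel (\<lambda>x :: real ^ 'd. indicator unit_cube x * ?a (x $ v))"
    using unit_cube_integral_single(1)[OF int, of v] by (simp add: set_integrable_def)
  ultimately have "AE x in (lborel :: (real ^ 'd) measure). indicator unit_cube x * ?a (x $ v) = 0"
    by (subst (asm) integral_nonneg_eq_0_iff_AE) auto
  then show ?thesis
  proof (eventually_elim, intro impI)
    fix x :: "real ^ 'd" assume *: "indicator unit_cube x * ?a (x $ v) = 0" "x \<in> unit_cube"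
    then have "x $ v \<notin> N" by (auto simp: indicator_def split: if_splits)
    moreover have "x $ v \<in> {0..1}" using * by (auto simp: unit_cube_def)
    ultimately show "P (x $ v)" using N(1) by blast
  qed
qed

text \<open>The marginal conditions are placed at time 1, the time in the definition of
  \<open>g\<close>; stationarity carries the resulting means to the other times.\<close>

locale additive_regression = prob_space M for M :: "'a measure" +
  fixes Y :: "int \<Rightarrow> 'a \<Rightarrow> real" and X :: "int \<Rightarrow> 'a \<Rightarrow> real ^ 'd::finite"
    and \<rho> :: "real \<Rightarrow> real" and g f :: "real ^ 'd \<Rightarrow> real" and gl :: "'d \<Rightarrow> real \<Rightarrow> real"
    and \<phi> \<psi> :: "real \<Rightarrow> real" and \<phi>w \<psi>w :: "nat \<Rightarrow> nat \<Rightarrow> real \<Rightarrow> real"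
    and \<mu> C2 c0 K :: real and R \<tau> :: nat and l :: 'd
  assumes stationary: "stationary_process M (\<lambda>i \<omega>. (Y i \<omega>, X i \<omega>))"
    and X_cube: "\<And>i \<omega>. \<omega> \<in> space M \<Longrightarrow> X i \<omega> \<in> unit_cube"
    and rho_meas[measurable]: "\<rho> \<in> borel_measurable borel"
    and regression: "regression_function M (\<lambda>\<omega>. \<rho> (Y 1 \<omega>)) (X 1) unit_cube g"
    and gl_meas: "\<And>v. gl v \<in> borel_measurable (restrict_space borel {0..1})"
    and additive: "\<And>x. x \<in> unit_cube \<Longrightarrow> g x = \<mu> + (\<Sum>v\<in>UNIV. gl v (x $ v))"
    and uniform: "\<And>v. distr M borel (\<lambda>\<omega>. X 1 \<omega> $ v) = uniform_measure lborel {0..1}"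
    and X_density: "distributed M lborel (X 1) (\<lambda>x. ennreal (f x) * indicator unit_cube x)"
    and centered: "\<And>v. integrable M (\<lambda>\<omega>. gl v (X 1 \<omega> $ v))" "\<And>v. expectation (\<lambda>\<omega>. gl v (X 1 \<omega> $ v)) = 0"
    and rho_bound: "\<And>y. \<bar>\<rho> y\<bar> \<le> C2"
    and c0: "0 < c0" and f_ge: "\<And>x. x \<in> unit_cube \<Longrightarrow> c0 \<le> f x"
    and wavelets: "wavelet_system_01 R \<tau> K \<phi> \<psi> \<phi>w \<psi>w"
    and gl_L2: "gl l \<in> L2_01"
begin

section \<open>Measurability and moments of a single observation\<close>

lemma pair_meas[measurable]: "(\<lambda>\<omega>. (Y i \<omega>, X i \<omega>)) \<in> borel_measurable M"
  using stationary by (simp add: stationary_process_def)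

lemma Y_meas[measurable]: "Y i \<in> borel_measurable M"
  and X_meas[measurable]: "X i \<in> borel_measurable M"
  using measurable_compose[OF pair_meas[of i] borel_measurable_continuous_onI[of fst]]
    measurable_compose[OF pair_meas[of i] borel_measurable_continuous_onI[of snd]]
  by (simp_all add: continuous_on_fst continuous_on_snd)

lemma C2_nonneg: "0 \<le> C2"
  using rho_bound[of 0] by linarith

lemma f_pos: "x \<in> unit_cube \<Longrightarrow> 0 < f x"
  using f_ge[of x] c0 by linarith

text \<open>The values of \<open>f\<close> are constrained on the cube alone, hence the indicator.
  Positivity of \<open>f\<close> there makes \<open>enn2real\<close> undo the embedding of the
  density into the extended reals.\<close>

lemma f_meas[measurable]: "(\<lambda>x. indicator unit_cube x * f x) \<in> borel_measurable borel"
proof -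
  have "(\<lambda>x. enn2real (ennreal (f x) * indicator unit_cube x)) \<in> borel_measurable borel"
    using distributed_borel_measurable[OF X_density] by measurable
  also have "(\<lambda>x. enn2real (ennreal (f x) * indicator unit_cube x)) = (\<lambda>x. indicator unit_cube x * f x)"
    using f_pos by (auto simp: indicator_def less_imp_le)
  finally show ?thesis .
qed

lemma g_meas[measurable]: "(\<lambda>x. indicator unit_cube x * g x) \<in> borel_measurable borel"
  using regression borel_measurable_restrict_space_iff[of unit_cube borel g]
  by (simp add: regression_function_def mult.commute)

lemma cond_exp_subalgebra: "finite_measure_subalgebra M (vimage_algebra (space M) (X 1) borel)"
proof
  show "subalgebra M (vimage_algebra (space M) (X 1) borel)"
    unfolding subalgebra_def sets_vimage_algebra
    using measurable_sets[OF X_meas[of 1]] by (auto intro!: sets.sigma_sets_subset)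
qed

text \<open>Importance weighting: conditioning on \<open>X 1\<close> replaces
  \<open>\<rho> (Y 1)\<close> by \<open>g (X 1)\<close>, and the division by \<open>f\<close>
  cancels the density, so that Lebesgue measure on the cube remains.\<close>

lemma expectation_weighted:
  fixes W :: "real ^ 'd \<Rightarrow> real"
  assumes [measurable]: "(\<lambda>x. indicator unit_cube x * W x) \<in> borel_measurable borel"
    and W: "\<And>x. x \<in> unit_cube \<Longrightarrow> \<bar>W x\<bar> \<le> D"
  shows "expectation (\<lambda>\<omega>. \<rho> (Y 1 \<omega>) * (W (X 1 \<omega>) / f (X 1 \<omega>))) = (LINT x:unit_cube|lborel. g x * W x)"
proof -
  let ?F = "vimage_algebra (space M) (X 1) borel"
  interpret finite_measure_subalgebra M ?F by (rule cond_exp_subalgebra)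
  \<comment> \<open>Total division gives \<open>0 / 0 = 0\<close> off the cube, which makes
    \<open>q\<close> Borel on the whole space and bounded everywhere by
    \<open>D / c0\<close>.\<close>
  define q where "q = (\<lambda>x. (indicator unit_cube x * W x) / (indicator unit_cube x * f x))"
  define gc where "gc = (\<lambda>x. indicator unit_cube x * g x)"
  have [measurable]: "q \<in> borel_measurable borel" "gc \<in> borel_measurable borel"
    unfolding q_def gc_def by measurable
  have q: "q x = W x / f x" "gc x = g x" if "x \<in> unit_cube" for x
    using that by (simp_all add: q_def gc_def)
  have "0 \<le> D" using W[of 0] by (auto simp: unit_cube_def)
  have qb: "\<bar>q x\<bar> \<le> D / c0" for x
  proof (cases "x \<in> unit_cube")
    case True
    then show ?thesis
      using W[OF True] f_ge[OF True] f_pos[OF True] c0 \<open>0 \<le> D\<close> by (auto simp: q abs_divide intro!: frac_le)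
  qed (use \<open>0 \<le> D\<close> c0 in \<open>auto simp: q_def\<close>)
  have qF: "(\<lambda>\<omega>. q (X 1 \<omega>)) \<in> borel_measurable ?F"
    by (rule measurable_compose[OF measurable_vimage_algebra1]) auto
  have int: "integrable M (\<lambda>\<omega>. q (X 1 \<omega>) * \<rho> (Y 1 \<omega>))"
  proof (rule integrable_const_bound)
    show "AE \<omega> in M. norm (q (X 1 \<omega>) * \<rho> (Y 1 \<omega>)) \<le> D / c0 * C2"
      unfolding real_norm_def abs_mult
      using qb rho_bound \<open>0 \<le> D\<close> c0 by (intro AE_I2 mult_mono) auto
  qed measurable
  have "expectation (\<lambda>\<omega>. \<rho> (Y 1 \<omega>) * (W (X 1 \<omega>) / f (X 1 \<omega>))) = expectation (\<lambda>\<omega>. q (X 1 \<omega>) * \<rho> (Y 1 \<omega>))"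
    using X_cube by (intro Bochner_Integration.integral_cong) (auto simp: q)
  also have "\<dots> = expectation (\<lambda>\<omega>. q (X 1 \<omega>) * real_cond_exp M ?F (\<lambda>\<omega>. \<rho> (Y 1 \<omega>)) \<omega>)"
    using real_cond_exp_intg(2)[OF int qF] by simp
  also have "\<dots> = expectation (\<lambda>\<omega>. q (X 1 \<omega>) * gc (X 1 \<omega>))"
  proof (rule integral_cong_AE)
    have "AE \<omega> in M. real_cond_exp M ?F (\<lambda>\<omega>. \<rho> (Y 1 \<omega>)) \<omega> = g (X 1 \<omega>)"
      using regression by (simp add: regression_function_def)
    then show "AE \<omega> in M. q (X 1 \<omega>) * real_cond_exp M ?F (\<lambda>\<omega>. \<rho> (Y 1 \<omega>)) \<omega> = q (X 1 \<omega>) * gc (X 1 \<omega>)"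
      using AE_space by eventually_elim (simp add: q X_cube)
  qed auto
  also have "\<dots> = (LINT x|lborel. (indicator unit_cube x * f x) * (q x * gc x))"
  proof (rule distributed_integral[symmetric])
    have "(\<lambda>x. ennreal (f x) * indicator unit_cube x) = (\<lambda>x. ennreal (indicator unit_cube x * f x))"
      by (auto simp: indicator_def)
    then show "distributed M lborel (X 1) (\<lambda>x. ennreal (indicator unit_cube x * f x))"
      using X_density by simp
    show "0 \<le> indicator unit_cube x * f x" for x
      using f_pos[of x] by (auto simp: indicator_def less_imp_le)
  qed auto
  also have "\<dots> = (LINT x:unit_cube|lborel. g x * W x)"
    unfolding set_lebesgue_integral_def
  proof (intro Bochner_Integration.integral_cong refl)
    fix x :: "real ^ 'd"
    show "(indicator unit_cube x * f x) * (q x * gc x) = indicator unit_cube x *\<^sub>R (g x * W x)"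
      using f_pos[of x] by (auto simp: indicator_def q)
  qed
  finally show ?thesis .
qed

text \<open>Each coordinate of \<open>X 1\<close> is uniform, so its moments are Lebesgue integrals
  over \<open>{0..1}\<close> and the centring assumption becomes a vanishing integral.\<close>

lemma gl_integral: "set_integrable lborel {0..1} (gl v)" "(LBINT x:{0..1}. gl v x) = 0"
proof -
  define h where "h = (\<lambda>y. indicator {0..1} y * gl v y)"
  have hm[measurable]: "h \<in> borel_measurable borel"
    unfolding h_def using gl_meas[of v] borel_measurable_restrict_space_iff[of "{0..1}" borel "gl v"]
    by (simp add: mult.commute)
  have Xv[measurable]: "(\<lambda>\<omega>. X 1 \<omega> $ v) \<in> borel_measurable M"
    by (rule measurable_compose[OF X_meas]) measurable
  have eq: "h (X 1 \<omega> $ v) = gl v (X 1 \<omega> $ v)" if "\<omega> \<in> space M" for \<omega>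
    using X_cube[OF that, of 1] by (simp add: h_def unit_cube_def)
  have u: "uniform_measure lborel {0..1} = density lborel (\<lambda>y::real. ennreal (indicator {0..1} y))"
    unfolding uniform_measure_def by (auto simp: divide_ennreal_def indicator_def intro!: arg_cong[where f = "density lborel"])
  have hh: "indicator {0..1} y * h y = h y" for y
    by (auto simp: h_def indicator_def)
  have "integrable M (\<lambda>\<omega>. h (X 1 \<omega> $ v))"
    using centered(1)[of v] eq by (subst Bochner_Integration.integrable_cong[OF refl eq]) auto
  then have "integrable (distr M borel (\<lambda>\<omega>. X 1 \<omega> $ v)) h"
    by (subst integrable_distr_eq[OF Xv hm])
  then show "set_integrable lborel {0..1} (gl v)"
    unfolding uniform u by (subst (asm) integrable_real_density) (auto simp: hh, auto simp: h_def set_integrable_def)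
  have "(LBINT x:{0..1}. gl v x) = (LBINT y. indicator {0..1} y * h y)"
    by (simp add: hh, simp add: h_def set_lebesgue_integral_def)
  also have "\<dots> = integral\<^sup>L (distr M borel (\<lambda>\<omega>. X 1 \<omega> $ v)) h"
    unfolding uniform u by (subst integral_real_density) auto
  also have "\<dots> = expectation (\<lambda>\<omega>. h (X 1 \<omega> $ v))"
    by (rule integral_distr[OF Xv hm])
  also have "\<dots> = expectation (\<lambda>\<omega>. gl v (X 1 \<omega> $ v))"
    by (intro Bochner_Integration.integral_cong refl eq)
  finally show "(LBINT x:{0..1}. gl v x) = 0"
    by (simp add: centered)
qed

lemma rho_mean: "expectation (\<lambda>\<omega>. \<rho> (Y 1 \<omega>)) = \<mu>"
proof -
  let ?F = "vimage_algebra (space M) (X 1) borel"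
  interpret finite_measure_subalgebra M ?F by (rule cond_exp_subalgebra)
  have "integrable M (\<lambda>\<omega>. \<rho> (Y 1 \<omega>))"
    using rho_bound by (intro integrable_const_bound[of _ C2]) auto
  then have "expectation (\<lambda>\<omega>. \<rho> (Y 1 \<omega>)) = expectation (real_cond_exp M ?F (\<lambda>\<omega>. \<rho> (Y 1 \<omega>)))"
    by (rule real_cond_exp_int(2)[symmetric])
  also have "\<dots> = expectation (\<lambda>\<omega>. \<mu> + (\<Sum>v\<in>UNIV. gl v (X 1 \<omega> $ v)))"
  proof (rule integral_cong_AE)
    have "AE \<omega> in M. real_cond_exp M ?F (\<lambda>\<omega>. \<rho> (Y 1 \<omega>)) \<omega> = g (X 1 \<omega>)"
      using regression by (simp add: regression_function_def)
    then show "AE \<omega> in M. real_cond_exp M ?F (\<lambda>\<omega>. \<rho> (Y 1 \<omega>)) \<omega> = \<mu> + (\<Sum>v\<in>UNIV. gl v (X 1 \<omega> $ v))"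
      using AE_space by eventually_elim (simp add: additive X_cube)
    show "(\<lambda>\<omega>. \<mu> + (\<Sum>v\<in>UNIV. gl v (X 1 \<omega> $ v))) \<in> borel_measurable M"
      using centered(1) by (intro borel_measurable_add borel_measurable_sum) auto
  qed auto
  also have "\<dots> = \<mu>"
    using centered by (simp add: prob_space)
  finally show ?thesis .
qed

text \<open>Every component with \<open>v \<noteq> l\<close> factors off from \<open>w\<close> and
  integrates to 0. The constant \<mu> stays, since \<open>w\<close> may have a nonzero
  integral.\<close>

lemma unit_cube_integral_g:
  assumes w: "w \<in> L2_01"
  shows "(LINT x:unit_cube|lborel. g x * w (x $ l)) = (LBINT x:{0..1}. (\<mu> + gl l x) * w x)"
proof -
  have wi: "set_integrable lborel {0..1} w"
    using L2_01_mult_integrable[OF w L2_01_const[of 1]] by simp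
  have main: "set_integrable lborel {0..1} (\<lambda>x. (\<mu> + gl l x) * w x)"
    by (intro L2_01_mult_integrable w L2_01_add gl_L2 L2_01_const)
  have cube[measurable]: "unit_cube \<in> sets (lborel :: (real ^ 'd) measure)" by simp
  have "(LINT x:unit_cube|lborel. g x * w (x $ l))
    = (LINT x:unit_cube|lborel. (\<mu> + gl l (x $ l)) * w (x $ l) + (\<Sum>v\<in>UNIV - {l}. gl v (x $ v) * w (x $ l)))"
  proof (rule set_lebesgue_integral_cong[OF cube], intro allI impI)
    fix x :: "real ^ 'd" assume "x \<in> unit_cube"
    then have "g x = \<mu> + (gl l (x $ l) + (\<Sum>v\<in>UNIV - {l}. gl v (x $ v)))"
      by (subst additive) (auto simp: sum.remove[of UNIV l])
    then show "g x * w (x $ l) = (\<mu> + gl l (x $ l)) * w (x $ l) + (\<Sum>v\<in>UNIV - {l}. gl v (x $ v) * w (x $ l))"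
      by (simp add: sum_distrib_left algebra_simps)
  qed
  also have "\<dots> = (LINT x:unit_cube|lborel. (\<mu> + gl l (x $ l)) * w (x $ l))
      + (LINT x:unit_cube|lborel. (\<Sum>v\<in>UNIV - {l}. gl v (x $ v) * w (x $ l)))"
    using unit_cube_integral_pair(1)[OF _ gl_integral(1) wi]
    by (intro set_integral_add(2) unit_cube_integral_single(1)[OF main] set_lebesgue_integral_sum(1)) auto
  also have "(LINT x:unit_cube|lborel. (\<Sum>v\<in>UNIV - {l}. gl v (x $ v) * w (x $ l)))
      = (\<Sum>v\<in>UNIV - {l}. LINT x:unit_cube|lborel. gl v (x $ v) * w (x $ l))"
    using unit_cube_integral_pair(1)[OF _ gl_integral(1) wi] by (intro set_lebesgue_integral_sum(2)) auto
  also have "\<dots> = 0"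
    by (intro sum.neutral ballI) (simp add: unit_cube_integral_pair(2)[OF _ gl_integral(1) wi] gl_integral(2))
  also have "(LINT x:unit_cube|lborel. (\<mu> + gl l (x $ l)) * w (x $ l)) = (LBINT x:{0..1}. (\<mu> + gl l x) * w x)"
    by (rule unit_cube_integral_single(2)[OF main])
  finally show ?thesis by simp
qed

text \<open>The product is what \<open>sum_tensor_phi\<close> and \<open>sum_tensor_psi\<close>
  leave of the other coordinates. The scale factor, taken from the estimators, normalises it to 1
  almost everywhere on the cube.\<close>

definition weight :: "(real \<Rightarrow> real) \<Rightarrow> nat \<Rightarrow> real ^ 'd \<Rightarrow> real" where
  "weight w j x = 2 powr (- (real j * (real CARD('d) - 1)) / 2) *
     (w (x $ l) * (\<Prod>v\<in>UNIV - {l}. \<Sum>k<2 ^ j. \<phi>w j k (x $ v)))"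

lemma phi_bounds:
  assumes "\<tau> \<le> j" "y \<in> {0..1}"
  shows "(\<Sum>k<2 ^ j. \<bar>\<phi>w j k y\<bar>) \<le> K * 2 powr (real j / 2)"
    and "k < 2 ^ j \<Longrightarrow> \<bar>\<phi>w j k y\<bar> \<le> K * 2 powr (real j / 2)"
    and "k < 2 ^ j \<Longrightarrow> \<bar>\<psi>w j k y\<bar> \<le> K * 2 powr (real j / 2)"
  using wavelets assms by (auto simp: wavelet_system_01_def)

lemma K_nonneg: "0 \<le> K"
proof -
  have "0 \<le> (\<Sum>k<2 ^ \<tau>. \<bar>\<phi>w \<tau> k 0\<bar>)" by (intro sum_nonneg) auto
  also have "\<dots> \<le> K * 2 powr (real \<tau> / 2)" by (intro phi_bounds) auto
  finally show ?thesis by (simp add: zero_le_mult_iff)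
qed

lemma card_minus: "card (UNIV - {l}) = CARD('d) - 1"
  by (simp add: card_Diff_singleton)

lemma scale_cancel: "2 powr (- (real j * (real CARD('d) - 1)) / 2) * (2 powr (real j / 2)) ^ card (UNIV - {l}) = 1"
proof -
  have "(2 powr (real j / 2)) ^ card (UNIV - {l}) = 2 powr (real j * (real CARD('d) - 1) / 2)"
    by (simp add: card_minus powr_powr of_nat_diff flip: powr_realpow)
  then show ?thesis by (simp add: powr_minus)
qed

text \<open>The mean square estimate asks for a bound at every point, where the almost-everywhere
  identity is of no help. The supremum bound on the sums costs \<open>K\<close> for each of the
  other coordinates, and the powers of 2 cancel by \<open>scale_cancel\<close>.\<close>

lemma weight_bound:
  assumes "\<tau> \<le> j" and w: "\<And>y. y \<in> {0..1} \<Longrightarrow> \<bar>w y\<bar> \<le> B" and x: "x \<in> unit_cube"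
  shows "\<bar>weight w j x\<bar> \<le> B * K ^ card (UNIV - {l})"
proof -
  have xv: "x $ v \<in> {0..1}" for v using x by (auto simp: unit_cube_def)
  let ?s = "2 powr (- (real j * (real CARD('d) - 1)) / 2)"
  have p: "(\<Prod>v\<in>UNIV - {l}. \<bar>\<Sum>k<2 ^ j. \<phi>w j k (x $ v)\<bar>) \<le> (\<Prod>v\<in>UNIV - {l}. K * 2 powr (real j / 2))"
    using order_trans[OF sum_abs phi_bounds(1)[OF assms(1) xv]] by (intro prod_mono) auto
  have "\<bar>weight w j x\<bar> = ?s * (\<bar>w (x $ l)\<bar> * (\<Prod>v\<in>UNIV - {l}. \<bar>\<Sum>k<2 ^ j. \<phi>w j k (x $ v)\<bar>))"
    by (simp add: weight_def abs_mult abs_prod)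
  also have "\<dots> \<le> ?s * (B * (\<Prod>v\<in>UNIV - {l}. K * 2 powr (real j / 2)))"
    using w[OF xv] p order_trans[OF abs_ge_zero w[OF xv]] by (intro mult_left_mono mult_mono) (auto intro: prod_nonneg)
  also have "\<dots> = B * K ^ card (UNIV - {l}) * (?s * (2 powr (real j / 2)) ^ card (UNIV - {l}))"
    by (simp add: power_mult_distrib)
  finally show ?thesis by (simp only: scale_cancel mult_1_right)
qed

text \<open>Membership in \<open>L2_01\<close> gives measurability only after multiplication by the
  indicator of \<open>{0..1}\<close>; inserting these indicators coordinatewise changes nothing on
  the cube.\<close>

lemma weight_meas:
  assumes j: "\<tau> \<le> j" and w: "w \<in> L2_01"
  shows "(\<lambda>x. indicator unit_cube x * weight w j x) \<in> borel_measurable borel"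
proof -
  let ?I = "\<lambda>y::real. indicator {0..1} y :: real"
  have L2m: "(\<lambda>y. ?I y * h y) \<in> borel_measurable borel" if "h \<in> L2_01" for h
    using that by (simp add: L2_01_def set_borel_measurable_def)
  have [measurable]: "(\<lambda>y. ?I y * w y) \<in> borel_measurable borel"
    by (rule L2m[OF w])
  define \<Phi> where "\<Phi> = (\<lambda>y. \<Sum>k<2 ^ j. \<phi>w j k y)"
  have "\<Phi> \<in> L2_01"
    unfolding \<Phi>_def using L2_01_sum[of "{..<2 ^ j}" "\<phi>w j" "\<lambda>_. 1"] wavelet_system_L2(1)[OF wavelets j] by simp
  then have [measurable]: "(\<lambda>y. ?I y * \<Phi> y) \<in> borel_measurable borel" by (rule L2m)
  have "(\<lambda>x. indicator unit_cube x * (2 powr (- (real j * (real CARD('d) - 1)) / 2) *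
     ((?I (x $ l) * w (x $ l)) * (\<Prod>v\<in>UNIV - {l}. ?I (x $ v) * \<Phi> (x $ v))))) \<in> borel_measurable borel"
    by measurable
  also have "(\<lambda>x. indicator unit_cube x * (2 powr (- (real j * (real CARD('d) - 1)) / 2) *
     ((?I (x $ l) * w (x $ l)) * (\<Prod>v\<in>UNIV - {l}. ?I (x $ v) * \<Phi> (x $ v))))) = (\<lambda>x. indicator unit_cube x * weight w j x)"
  proof (rule ext)
    fix x :: "real ^ 'd"
    show "indicator unit_cube x * (2 powr (- (real j * (real CARD('d) - 1)) / 2) *
     ((?I (x $ l) * w (x $ l)) * (\<Prod>v\<in>UNIV - {l}. ?I (x $ v) * \<Phi> (x $ v)))) = indicator unit_cube x * weight w j x"
    proof (cases "x \<in> unit_cube")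
      case True
      then have "?I (x $ v) = 1" for v by (simp add: unit_cube_def)
      then show ?thesis by (simp add: weight_def \<Phi>_def)
    qed simp
  qed
  finally show ?thesis .
qed

lemma weight_integral:
  assumes j: "\<tau> \<le> j" and w: "w \<in> L2_01"
  shows "(LINT x:unit_cube|lborel. g x * weight w j x) = (LBINT x:{0..1}. (\<mu> + gl l x) * w x)"
proof -
  \<comment> \<open>There are finitely many coordinates, hence one common null set outside which the
    weight at a point of the cube is \<open>w (x $ l)\<close>.\<close>
  have "AE x in (lborel :: (real ^ 'd) measure). \<forall>v\<in>UNIV. x \<in> unit_cube \<longrightarrow> (\<Sum>k<2 ^ j. \<phi>w j k (x $ v)) = 2 powr (real j / 2)"
    by (intro AE_finite_allI AE_unit_cube_coordinate wavelet_phi_partition_of_unity[OF wavelets j]) auto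
  then have ae: "AE x in (lborel :: (real ^ 'd) measure). indicator unit_cube x * (g x * weight w j x)
      = indicator unit_cube x * (g x * w (x $ l))"
  proof eventually_elim
    case (elim x)
    show ?case
    proof (cases "x \<in> unit_cube")
      case True
      then have "weight w j x = w (x $ l) * (2 powr (- (real j * (real CARD('d) - 1)) / 2) * (2 powr (real j / 2)) ^ card (UNIV - {l}))"
        using elim by (simp add: weight_def)
      then show ?thesis by (simp only: scale_cancel mult_1_right)
    qed simp
  qed
  have m1: "(\<lambda>x. indicator unit_cube x * (g x * weight w j x)) \<in> borel_measurable borel"
  proof -
    have "(\<lambda>x. (indicator unit_cube x * g x) * (indicator unit_cube x * weight w j x)) \<in> borel_measurable borel"
      by (intro borel_measurable_times g_meas weight_meas j w)
    also have "(\<lambda>x. (indicator unit_cube x * g x) * (indicator unit_cube x * weight w j x)) = (\<lambda>x. indicator unit_cube x * (g x * weight w j x))"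
      by (auto simp: indicator_def)
    finally show ?thesis .
  qed
  have m2: "(\<lambda>x. indicator unit_cube x * (g x * w (x $ l))) \<in> borel_measurable borel"
  proof -
    have wm: "(\<lambda>y. indicator {0..1} y * w y) \<in> borel_measurable borel"
      using w by (simp add: L2_01_def set_borel_measurable_def)
    have "(\<lambda>x. (indicator unit_cube x * g x) * (indicator {0..1} (x $ l) * w (x $ l))) \<in> borel_measurable borel"
      by (intro borel_measurable_times g_meas measurable_compose[OF _ wm]) measurable
    also have "(\<lambda>x. (indicator unit_cube x * g x) * (indicator {0..1} (x $ l) * w (x $ l))) = (\<lambda>x. indicator unit_cube x * (g x * w (x $ l)))"
      by (rule ext) (auto simp: indicator_def unit_cube_def)
    finally show ?thesis .
  qed
  have "(LINT x:unit_cube|lborel. g x * weight w j x) = (LINT x:unit_cube|lborel. g x * w (x $ l))"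
    unfolding set_lebesgue_integral_def using m1 m2 ae by (intro integral_cong_AE) auto
  then show ?thesis by (simp add: unit_cube_integral_g[OF w])
qed

text \<open>\<open>a_hat\<close> and \<open>b_hat\<close> are the empirical means of \<open>score\<close> for \<open>w = \<phi>w j k\<close> and \<open>w = \<psi>w j k\<close>.
  The indicators make it measurable on the whole space; off the cube it is \<open>0 / 0 = 0\<close>.\<close>

definition score :: "(real \<Rightarrow> real) \<Rightarrow> nat \<Rightarrow> real \<times> (real ^ 'd) \<Rightarrow> real" where
  "score w j z = \<rho> (fst z) * ((indicator unit_cube (snd z) * weight w j (snd z)) / (indicator unit_cube (snd z) * f (snd z)))"

lemma score_meas:
  assumes j: "\<tau> \<le> j" and w: "w \<in> L2_01"
  shows "score w j \<in> borel_measurable borel"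
proof -
  note [measurable] = weight_meas[OF j w]
  have "score w j \<in> borel_measurable (borel \<Otimes>\<^sub>M borel)"
    unfolding score_def by measurable
  then show ?thesis by (simp add: borel_prod)
qed

lemma score_bound:
  assumes j: "\<tau> \<le> j" and w: "\<And>y. y \<in> {0..1} \<Longrightarrow> \<bar>w y\<bar> \<le> B"
  shows "\<bar>score w j z\<bar> \<le> C2 * (B * K ^ card (UNIV - {l}) / c0)"
proof -
  have "0 \<le> B" using w[of 0] by auto
  have "\<bar>(indicator unit_cube x * weight w j x) / (indicator unit_cube x * f x)\<bar> \<le> B * K ^ card (UNIV - {l}) / c0" for x
  proof (cases "x \<in> unit_cube")
    case True
    then show ?thesis
      using weight_bound[OF j w True] f_ge[OF True] f_pos[OF True] c0 \<open>0 \<le> B\<close> K_nonneg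
      by (auto simp: abs_divide intro!: frac_le)
  qed (use \<open>0 \<le> B\<close> K_nonneg c0 in auto)
  then show ?thesis
    unfolding score_def abs_mult using rho_bound C2_nonneg by (intro mult_mono) auto
qed

lemma score_mean:
  assumes j: "\<tau> \<le> j" and w: "w \<in> L2_01" "\<And>y. y \<in> {0..1} \<Longrightarrow> \<bar>w y\<bar> \<le> B"
  shows "expectation (\<lambda>\<omega>. score w j (Y 1 \<omega>, X 1 \<omega>)) = (LBINT x:{0..1}. (\<mu> + gl l x) * w x)"
proof -
  have "expectation (\<lambda>\<omega>. score w j (Y 1 \<omega>, X 1 \<omega>))
      = expectation (\<lambda>\<omega>. \<rho> (Y 1 \<omega>) * (weight w j (X 1 \<omega>) / f (X 1 \<omega>)))"
    using X_cube by (intro Bochner_Integration.integral_cong) (auto simp: score_def)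
  also have "\<dots> = (LINT x:unit_cube|lborel. g x * weight w j x)"
    by (rule expectation_weighted[OF weight_meas[OF j w(1)] weight_bound[OF j w(2)]])
  finally show ?thesis by (simp add: weight_integral[OF j w(1)])
qed

lemma a_hat_eq:
  assumes "k < 2 ^ j" "\<omega> \<in> space M"
  shows "a_hat \<phi>w \<rho> f Y X n j k l \<omega> = (\<Sum>i=1..int n. score (\<phi>w j k) j (Y i \<omega>, X i \<omega>)) / real n"
  using X_cube[OF assms(2)]
  by (simp add: a_hat_def sum_tensor_phi[OF assms(1)] score_def weight_def sum_distrib_left sum_divide_distrib mult_ac)

lemma b_hat_eq:
  assumes "k < 2 ^ j" "\<omega> \<in> space M"
  shows "b_hat \<phi>w \<psi>w \<rho> f Y X n j k l \<omega> = (\<Sum>i=1..int n. score (\<psi>w j k) j (Y i \<omega>, X i \<omega>)) / real n"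
  using X_cube[OF assms(2)]
  by (simp add: b_hat_def sum_tensor_psi[OF assms(1)] score_def weight_def sum_distrib_left sum_divide_distrib mult_ac)

text \<open>Wavelets integrate to 0, so the function \<open>\<mu> + gl l\<close>, at which
  \<open>a_hat\<close> aims, has the wavelet coefficients of \<open>gl l\<close>.\<close>

lemma psi_coeff_eq:
  assumes j: "\<tau> \<le> j" and k: "k < 2 ^ j"
  shows "(LBINT x:{0..1}. (\<mu> + gl l x) * \<psi>w j k x) = wavelet_coeff \<psi>w (gl l) j k"
proof -
  note w = wavelet_system_L2(2)[OF wavelets j k]
  have wi: "set_integrable lborel {0..1} (\<psi>w j k)"
    using L2_01_mult_integrable[OF w L2_01_const[of 1]] by simp
  have "(LBINT x:{0..1}. (\<mu> + gl l x) * \<psi>w j k x)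
      = (LBINT x:{0..1}. \<mu> * \<psi>w j k x) + (LBINT x:{0..1}. gl l x * \<psi>w j k x)"
    unfolding distrib_right using wi L2_01_mult_integrable[OF gl_L2 w] by (intro set_integral_add) auto
  also have "(LBINT x:{0..1}. \<mu> * \<psi>w j k x) = 0"
    using wavelets j k by (simp add: wavelet_system_01_def)
  finally show ?thesis by (simp add: wavelet_coeff_def)
qed

text \<open>The deviation bound for \<kappa> is stated with \<open>b_true\<close>, the smoothness
  with \<open>wavelet_coeff\<close>; this identity joins them.\<close>

lemma b_true_eq:
  assumes j: "\<tau> \<le> j" and k: "k < 2 ^ j"
  shows "b_true \<phi>w \<psi>w g j k l = wavelet_coeff \<psi>w (gl l) j k"
proof -
  have "b_true \<phi>w \<psi>w g j k l = (LINT x:unit_cube|lborel. g x * weight (\<psi>w j k) j x)"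
    unfolding b_true_def sum_tensor_psi[OF k] weight_def set_integral_mult_right[symmetric]
    by (simp add: mult_ac)
  also have "\<dots> = (LBINT x:{0..1}. (\<mu> + gl l x) * \<psi>w j k x)"
    by (rule weight_integral[OF j wavelet_system_L2(2)[OF wavelets j k]])
  finally show ?thesis by (simp add: psi_coeff_eq[OF j k])
qed

lemma wavelet_coeff_bounded:
  "\<exists>B\<ge>0. \<forall>j\<ge>\<tau>. \<forall>k<2 ^ j. \<bar>wavelet_coeff \<psi>w (gl l) j k\<bar> \<le> B"
proof (intro exI[of _ "sqrt (LBINT x:{0..1}. (gl l x)\<^sup>2)"] conjI allI impI)
  show "0 \<le> sqrt (LBINT x:{0..1}. (gl l x)\<^sup>2)"
    by (simp add: set_lebesgue_integral_def Bochner_Integration.integral_nonneg)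
  fix j k :: nat assume j: "\<tau> \<le> j" and k: "k < 2 ^ j"
  have "Inr (j, k) \<in> {..<2 ^ j} <+> (SIGMA j:{j..}. {..<2 ^ j})"
    using k by auto
  then have "(wavelet_coeff \<psi>w (gl l) j k)\<^sup>2 \<le> (LBINT x:{0..1}. (gl l x)\<^sup>2)"
    using orthonormal_coeff_le[OF wavelet_system_onb[OF wavelets j], of "Inr (j, k)" "gl l"] k gl_L2
    by (simp add: wavelet_coeff_def)
  then show "\<bar>wavelet_coeff \<psi>w (gl l) j k\<bar> \<le> sqrt (LBINT x:{0..1}. (gl l x)\<^sup>2)"
    by (rule real_le_rsqrt[of "\<bar>wavelet_coeff \<psi>w (gl l) j k\<bar>", simplified])
qed

section \<open>Bounds and risks of the empirical coefficients\<close>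

lemma b_hat_meas:
  assumes j: "\<tau> \<le> j" and k: "k < 2 ^ j"
  shows "b_hat \<phi>w \<psi>w \<rho> f Y X n j k l \<in> borel_measurable M"
proof -
  note m = measurable_compose[OF pair_meas score_meas[OF j wavelet_system_L2(2)[OF wavelets j k]]]
  have "(\<lambda>\<omega>. (\<Sum>i=1..int n. score (\<psi>w j k) j (Y i \<omega>, X i \<omega>)) / real n) \<in> borel_measurable M"
    using m by (intro borel_measurable_divide borel_measurable_sum borel_measurable_const) auto
  then show ?thesis
    by (subst measurable_cong[OF b_hat_eq[OF k]])
qed

text \<open>The crude growth \<open>2 powr (j / 2)\<close> is affordable: its square will be
  multiplied by the probability of the exceptional event, which is of order
  \<open>1 / n ^ 4\<close>.\<close>

lemma b_hat_bound:
  assumes j: "\<tau> \<le> j" and k: "k < 2 ^ j" and \<omega>: "\<omega> \<in> space M" and n: "1 \<le> n"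
  shows "\<bar>b_hat \<phi>w \<psi>w \<rho> f Y X n j k l \<omega>\<bar> \<le> C2 * (K * K ^ card (UNIV - {l}) / c0) * 2 powr (real j / 2)"
proof -
  let ?b = "C2 * (K * K ^ card (UNIV - {l}) / c0) * 2 powr (real j / 2)"
  have "\<bar>\<Sum>i=1..int n. score (\<psi>w j k) j (Y i \<omega>, X i \<omega>)\<bar> \<le> (\<Sum>i=1..int n. ?b)"
    using score_bound[OF j phi_bounds(3)[OF j _ k]]
    by (intro order_trans[OF sum_abs] sum_mono) (simp add: mult_ac)
  then show ?thesis
    unfolding b_hat_eq[OF k \<omega>] using n by (simp add: abs_divide divide_le_eq mult.commute)
qed

text \<open>The level \<tau> is fixed, so the score is bounded independently of \<open>n\<close> and
  \<open>k\<close>, and \<open>mixing_mean_square_error\<close> gives order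
  \<open>1 / n\<close>.\<close>

lemma a_hat_risk:
  assumes mix: "0 < \<gamma>" "0 < c" "\<And>m. m \<ge> 1 \<Longrightarrow> alpha_mixing M (\<lambda>i \<omega>. (Y i \<omega>, X i \<omega>)) m \<le> \<gamma> * exp (- c * real m)"
  shows "\<exists>C\<ge>0. \<forall>n\<ge>1. \<forall>k<2 ^ \<tau>.
      integrable M (\<lambda>\<omega>. (a_hat \<phi>w \<rho> f Y X n \<tau> k l \<omega> - (LBINT x:{0..1}. (\<mu> + gl l x) * \<phi>w \<tau> k x))\<^sup>2) \<and>
      expectation (\<lambda>\<omega>. (a_hat \<phi>w \<rho> f Y X n \<tau> k l \<omega> - (LBINT x:{0..1}. (\<mu> + gl l x) * \<phi>w \<tau> k x))\<^sup>2) \<le> C / real n"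
proof -
  let ?B = "C2 * (K * 2 powr (real \<tau> / 2) * K ^ card (UNIV - {l}) / c0)"
  let ?C = "8 * ?B\<^sup>2 * (\<gamma> + 1) / (1 - exp (- c))"
  show ?thesis
  proof (intro exI[of _ ?C] conjI allI impI)
    show "0 \<le> ?C" using mix by auto
    fix n k :: nat assume n: "1 \<le> n" and k: "k < 2 ^ \<tau>"
    note L2 = wavelet_system_L2(1)[OF wavelets order_refl k]
    note bd = phi_bounds(2)[OF order_refl _ k]
    let ?W = "\<lambda>\<omega>. ((\<Sum>i=1..int n. score (\<phi>w \<tau> k) \<tau> (Y i \<omega>, X i \<omega>)) / real n - expectation (\<lambda>\<omega>. score (\<phi>w \<tau> k) \<tau> (Y 1 \<omega>, X 1 \<omega>)))\<^sup>2"
    have sm: "expectation (\<lambda>\<omega>. score (\<phi>w \<tau> k) \<tau> (Y 1 \<omega>, X 1 \<omega>)) = (LBINT x:{0..1}. (\<mu> + gl l x) * \<phi>w \<tau> k x)"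
      by (rule score_mean[OF order_refl L2 bd])
    have eq: "(a_hat \<phi>w \<rho> f Y X n \<tau> k l \<omega> - (LBINT x:{0..1}. (\<mu> + gl l x) * \<phi>w \<tau> k x))\<^sup>2 = ?W \<omega>" if "\<omega> \<in> space M" for \<omega>
      by (simp add: a_hat_eq[OF k that] sm)
    note mse = mixing_mean_square_error[OF stationary score_meas[OF order_refl L2] score_bound[OF order_refl bd] mix n]
    show "integrable M (\<lambda>\<omega>. (a_hat \<phi>w \<rho> f Y X n \<tau> k l \<omega> - (LBINT x:{0..1}. (\<mu> + gl l x) * \<phi>w \<tau> k x))\<^sup>2)"
      using mse(1) by (subst Bochner_Integration.integrable_cong[OF refl eq]) auto
    show "expectation (\<lambda>\<omega>. (a_hat \<phi>w \<rho> f Y X n \<tau> k l \<omega> - (LBINT x:{0..1}. (\<mu> + gl l x) * \<phi>w \<tau> k x))\<^sup>2) \<le> ?C / real n"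
      using mse(2) by (subst Bochner_Integration.integral_cong[OF refl eq]) auto
  qed
qed

lemma mu_hat_risk:
  assumes mix: "0 < \<gamma>" "0 < c" "\<And>m. m \<ge> 1 \<Longrightarrow> alpha_mixing M (\<lambda>i \<omega>. (Y i \<omega>, X i \<omega>)) m \<le> \<gamma> * exp (- c * real m)"
  shows "\<exists>C\<ge>0. \<forall>n\<ge>1. integrable M (\<lambda>\<omega>. (mu_hat \<rho> Y n \<omega> - \<mu>)\<^sup>2) \<and>
      expectation (\<lambda>\<omega>. (mu_hat \<rho> Y n \<omega> - \<mu>)\<^sup>2) \<le> C / real n"
proof -
  let ?C = "8 * C2\<^sup>2 * (\<gamma> + 1) / (1 - exp (- c))"
  show ?thesis
  proof (intro exI[of _ ?C] conjI allI impI)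
    show "0 \<le> ?C" using mix by auto
    fix n :: nat assume n: "1 \<le> n"
    have m: "(\<lambda>z::real \<times> (real ^ 'd). \<rho> (fst z)) \<in> borel_measurable borel"
      by (rule measurable_compose[OF borel_measurable_continuous_onI rho_meas]) (simp add: continuous_on_fst)
    note mse = mixing_mean_square_error[OF stationary m rho_bound mix n]
    show "integrable M (\<lambda>\<omega>. (mu_hat \<rho> Y n \<omega> - \<mu>)\<^sup>2)"
      using mse(1) by (simp add: mu_hat_def rho_mean)
    show "expectation (\<lambda>\<omega>. (mu_hat \<rho> Y n \<omega> - \<mu>)\<^sup>2) \<le> ?C / real n"
      using mse(2) by (simp add: mu_hat_def rho_mean)
  qed
qed

text \<open>The expansion is applied to \<open>\<mu> + gl l\<close>, the function at which
  \<open>a_hat\<close> aims. Subtracting \<open>mu_hat\<close> in place of \<mu> adds a constant on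
  an interval of length 1, and \<open>(a + b)^2 \<le> 2 * a^2 + 2 * b^2\<close> separates the two
  errors.\<close>

lemma integrated_squared_error_le:
  fixes \<kappa> T :: real
  assumes n: "2 \<le> n"
    and T: "\<And>J. finite J \<Longrightarrow> J \<subseteq> {j. \<tau> \<le> j \<and> real n / ln (real n) ^ 3 < 2 ^ j} \<Longrightarrow>
      (\<Sum>j\<in>J. \<Sum>k<2 ^ j. (wavelet_coeff \<psi>w (gl l) j k)\<^sup>2) \<le> T"
  defines "bt \<equiv> \<lambda>j k \<omega>. b_hat \<phi>w \<psi>w \<rho> f Y X n j k l \<omega> *
        (if \<bar>b_hat \<phi>w \<psi>w \<rho> f Y X n j k l \<omega>\<bar> \<ge> \<kappa> * noise_level n then 1 else 0)"
  shows "(\<integral>\<^sup>+ x\<in>{0..1}. ennreal ((g_hat \<tau> \<phi>w \<psi>w \<rho> f Y X \<kappa> n l \<omega> x - gl l x)\<^sup>2) \<partial>lborel)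
    \<le> ennreal (2 * (T + ((\<Sum>k<2 ^ \<tau>. (a_hat \<phi>w \<rho> f Y X n \<tau> k l \<omega> - (LBINT x:{0..1}. (\<mu> + gl l x) * \<phi>w \<tau> k x))\<^sup>2)
        + (\<Sum>j | \<tau> \<le> j \<and> 2 ^ j \<le> real n / ln (real n) ^ 3. \<Sum>k<2 ^ j. (bt j k \<omega> - wavelet_coeff \<psi>w (gl l) j k)\<^sup>2)))
        + 2 * (mu_hat \<rho> Y n \<omega> - \<mu>)\<^sup>2)"
proof -
  let ?y = "real n / ln (real n) ^ 3"
  let ?I = "{..<2 ^ \<tau>} <+> (SIGMA j:{\<tau>..}. {..<2 ^ j}) :: (nat + nat \<times> nat) set"
  let ?e = "case_sum (\<lambda>k. \<phi>w \<tau> k) (\<lambda>(j, k). \<psi>w j k)"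
  define J where "J = {j. \<tau> \<le> j \<and> 2 ^ j \<le> ?y}"
  have J: "finite J" unfolding J_def by (rule finite_levels)
  \<comment> \<open>All indices up to the maximal level, including those discarded by the threshold:
    their coefficient in \<open>c\<close> is then 0.\<close>
  define F :: "(nat + nat \<times> nat) set" where "F = {..<2 ^ \<tau>} <+> (SIGMA j:J. {..<2 ^ j})"
  define h where "h = (\<lambda>x. \<mu> + gl l x)"
  define a where "a = (\<lambda>k. a_hat \<phi>w \<rho> f Y X n \<tau> k l \<omega>)"
  define c where "c = case_sum a (\<lambda>(j, k). bt j k \<omega>)"
  define m where "m = mu_hat \<rho> Y n \<omega> - \<mu>"
  note onb = wavelet_system_onb[OF wavelets order_refl]
  have hL2: "h \<in> L2_01"
    unfolding h_def by (intro L2_01_add L2_01_const gl_L2)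
  have finS: "finite (SIGMA j:J. {..<(2::nat) ^ j})"
    using J by auto
  have F: "finite F" "F \<subseteq> ?I"
    using finS by (auto simp: F_def J_def)
  have sumF: "(\<Sum>x\<in>F. q x) = (\<Sum>k<2 ^ \<tau>. q (Inl k)) + (\<Sum>j\<in>J. \<Sum>k<2 ^ j. q (Inr (j, k)))"
    for q :: "nat + nat \<times> nat \<Rightarrow> real"
    using finS J by (simp add: F_def sum.Plus sum.Sigma split_def)
  have coef: "(LBINT x:{0..1}. h x * \<psi>w j k x) = wavelet_coeff \<psi>w (gl l) j k" if "\<tau> \<le> j" "k < 2 ^ j" for j k
    using psi_coeff_eq[OF that] by (simp add: h_def)
  define S where "S = (\<lambda>x. \<Sum>b\<in>F. c b * ?e b x)"
  have "(LBINT x:{0..1}. (h x - S x)\<^sup>2) \<le> T + (\<Sum>b\<in>F. (c b - (LBINT x:{0..1}. h x * ?e b x))\<^sup>2)"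
    unfolding S_def
  proof (rule orthonormal_error_le[OF onb F hL2])
    fix G assume G: "finite G" "G \<subseteq> ?I - F"
    \<comment> \<open>Every scaling index lies in \<open>F\<close>, so \<open>G\<close> contains
      wavelet indices only, of levels above the maximal one; it is enlarged to full levels.\<close>
    define J' where "J' = {j. \<exists>k. Inr (j, k) \<in> G}"
    have sub: "G \<subseteq> Inr ` (SIGMA j:J'. {..<2 ^ j})"
      using G(2) by (auto simp: F_def J'_def)
    have "J' \<subseteq> (\<lambda>z. case z of Inl _ \<Rightarrow> 0 | Inr (j, k) \<Rightarrow> j) ` G"
      unfolding J'_def by force
    then have J': "finite J'" using G(1) finite_subset by blast
    have J'_sub: "J' \<subseteq> {j. \<tau> \<le> j \<and> ?y < 2 ^ j}"
      using G(2) by (force simp: J'_def F_def J_def)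
    have finS': "finite (SIGMA j:J'. {..<(2::nat) ^ j})"
      using J' by auto
    have "(\<Sum>b\<in>G. (LBINT x:{0..1}. h x * ?e b x)\<^sup>2)
        \<le> (\<Sum>b\<in>Inr ` (SIGMA j:J'. {..<2 ^ j}). (LBINT x:{0..1}. h x * ?e b x)\<^sup>2)"
      using sub finS' by (intro sum_mono2) auto
    also have "\<dots> = (\<Sum>j\<in>J'. \<Sum>k<2 ^ j. (LBINT x:{0..1}. h x * \<psi>w j k x)\<^sup>2)"
      using J' by (simp add: sum.reindex sum.Sigma split_def)
    also have "\<dots> = (\<Sum>j\<in>J'. \<Sum>k<2 ^ j. (wavelet_coeff \<psi>w (gl l) j k)\<^sup>2)"
      using J'_sub by (intro sum.cong refl) (auto simp: coef)
    also have "\<dots> \<le> T" by (rule T[OF J' J'_sub])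
    finally show "(\<Sum>b\<in>G. (LBINT x:{0..1}. h x * ?e b x)\<^sup>2) \<le> T" .
  qed
  also have "(\<Sum>b\<in>F. (c b - (LBINT x:{0..1}. h x * ?e b x))\<^sup>2)
      = (\<Sum>k<2 ^ \<tau>. (a k - (LBINT x:{0..1}. h x * \<phi>w \<tau> k x))\<^sup>2)
        + (\<Sum>j\<in>J. \<Sum>k<2 ^ j. (bt j k \<omega> - wavelet_coeff \<psi>w (gl l) j k)\<^sup>2)"
    unfolding sumF by (intro arg_cong2[where f = "(+)"] sum.cong refl) (auto simp: c_def coef J_def)
  finally have L: "(LBINT x:{0..1}. (h x - S x)\<^sup>2) \<le> T + ((\<Sum>k<2 ^ \<tau>. (a k - (LBINT x:{0..1}. h x * \<phi>w \<tau> k x))\<^sup>2)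
        + (\<Sum>j\<in>J. \<Sum>k<2 ^ j. (bt j k \<omega> - wavelet_coeff \<psi>w (gl l) j k)\<^sup>2))" .
  have "S \<in> L2_01"
    unfolding S_def using onb F(2) by (intro L2_01_sum) (auto simp: orthonormal_basis_01_def)
  then have "(\<lambda>x. h x + (-1) * S x) \<in> L2_01"
    by (intro L2_01_add L2_01_cmult hL2)
  then have int: "set_integrable lborel {0..1} (\<lambda>x. (h x - S x)\<^sup>2)"
    by (simp add: L2_01_def)
  have int2: "set_integrable lborel {0..1} (\<lambda>x. 2 * (h x - S x)\<^sup>2 + 2 * m\<^sup>2)"
    using int by (intro set_integral_add set_integrable_mult_right) (auto simp: set_integrable_def)
  have gh: "g_hat \<tau> \<phi>w \<psi>w \<rho> f Y X \<kappa> n l \<omega> x = S x - mu_hat \<rho> Y n \<omega>" for x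
    unfolding g_hat_def S_def sumF le_max_level_iff[OF n] J_def[symmetric]
    by (simp add: c_def a_def bt_def)
  have pt: "(g_hat \<tau> \<phi>w \<psi>w \<rho> f Y X \<kappa> n l \<omega> x - gl l x)\<^sup>2 \<le> 2 * (h x - S x)\<^sup>2 + 2 * m\<^sup>2" for x
  proof -
    have "g_hat \<tau> \<phi>w \<psi>w \<rho> f Y X \<kappa> n l \<omega> x - gl l x = - ((h x - S x) + m)"
      by (simp add: gh h_def m_def)
    then have "(g_hat \<tau> \<phi>w \<psi>w \<rho> f Y X \<kappa> n l \<omega> x - gl l x)\<^sup>2 = ((h x - S x) + m)\<^sup>2"
      by (simp only: power2_minus)
    also have "\<dots> \<le> 2 * (h x - S x)\<^sup>2 + 2 * m\<^sup>2"
      using sum_squares_bound[of "h x - S x" m] by (simp add: power2_sum)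
    finally show ?thesis .
  qed
  have "(\<integral>\<^sup>+ x\<in>{0..1}. ennreal ((g_hat \<tau> \<phi>w \<psi>w \<rho> f Y X \<kappa> n l \<omega> x - gl l x)\<^sup>2) \<partial>lborel)
      \<le> (\<integral>\<^sup>+ x. ennreal (indicator {0..1} x *\<^sub>R (2 * (h x - S x)\<^sup>2 + 2 * m\<^sup>2)) \<partial>lborel)"
    using pt by (intro nn_integral_mono) (auto simp: indicator_def simp del: ennreal_plus intro!: ennreal_leI)
  also have "\<dots> = ennreal (LBINT x:{0..1}. 2 * (h x - S x)\<^sup>2 + 2 * m\<^sup>2)"
    unfolding set_lebesgue_integral_def using int2
    by (intro nn_integral_eq_integral) (auto simp: set_integrable_def)
  also have "(LBINT x:{0..1}. 2 * (h x - S x)\<^sup>2 + 2 * m\<^sup>2) = 2 * (LBINT x:{0..1}. (h x - S x)\<^sup>2) + 2 * m\<^sup>2"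
  proof -
    have "set_integrable lborel {0..1::real} (\<lambda>x. 2 * m\<^sup>2)" "(LBINT x:{0..1::real}. 2 * m\<^sup>2) = 2 * m\<^sup>2"
      by (auto simp: set_integrable_def set_lebesgue_integral_def)
    then show ?thesis
      using int by (subst set_integral_add) auto
  qed
  also have "ennreal \<dots> \<le> ennreal (2 * (T + ((\<Sum>k<2 ^ \<tau>. (a k - (LBINT x:{0..1}. h x * \<phi>w \<tau> k x))\<^sup>2)
        + (\<Sum>j\<in>J. \<Sum>k<2 ^ j. (bt j k \<omega> - wavelet_coeff \<psi>w (gl l) j k)\<^sup>2))) + 2 * m\<^sup>2)"
    using L by (intro ennreal_leI) auto
  finally show ?thesis
    by (simp add: a_def h_def m_def J_def)
qed

end

section \<open>Risk of the estimator\<close>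

theorem theorem5p1:
  fixes M :: "'a measure"
    and Y :: "int \<Rightarrow> 'a \<Rightarrow> real"
    and X :: "int \<Rightarrow> 'a \<Rightarrow> real ^ 'd::finite"
    and \<rho> :: "real \<Rightarrow> real"
    and g f :: "real ^ 'd \<Rightarrow> real"
    and gl :: "'d \<Rightarrow> real \<Rightarrow> real"
    and fYX :: "real \<times> (real ^ 'd) \<Rightarrow> real"
    and fYXYX :: "nat \<Rightarrow> (real \<times> (real ^ 'd)) \<times> (real \<times> (real ^ 'd)) \<Rightarrow> real"
    and \<phi> \<psi> :: "real \<Rightarrow> real"
    and \<phi>w \<psi>w :: "nat \<Rightarrow> nat \<Rightarrow> real \<Rightarrow> real"
    and \<mu> \<gamma> c C1 C2 C3 c0 K \<kappa> C' Mb s p q :: real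
    and Mstar :: "real \<Rightarrow> real"
    and R \<tau> :: nat
    and l :: 'd
  assumes "prob_space M"
    and stationary: "stationary_process M (\<lambda>i \<omega>. (Y i \<omega>, X i \<omega>))"
    and X_cube: "\<And>i \<omega>. \<omega> \<in> space M \<Longrightarrow> X i \<omega> \<in> unit_cube"
    and rho_meas: "\<rho> \<in> borel_measurable borel"
    and regression: "regression_function M (\<lambda>\<omega>. \<rho> (Y 1 \<omega>)) (X 1) unit_cube g"
    and gl_meas: "\<And>v. gl v \<in> borel_measurable (restrict_space borel {0..1})"
    and additive: "\<And>x. x \<in> unit_cube \<Longrightarrow> g x = \<mu> + (\<Sum>v\<in>UNIV. gl v (x $ v))"
    and A1_uniform: "\<And>v i. distr M borel (\<lambda>\<omega>. X i \<omega> $ v) = uniform_measure lborel {0..1}"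
    and A1_density: "\<And>i. distributed M lborel (X i) (\<lambda>x. ennreal (f x) * indicator unit_cube x)"
    and A2: "\<And>v i. integrable M (\<lambda>\<omega>. gl v (X i \<omega> $ v)) \<and>
                     prob_space.expectation M (\<lambda>\<omega>. gl v (X i \<omega> $ v)) = 0"
    and A3: "\<gamma> > 0" "c > 0"
            "\<And>m. m \<ge> 1 \<Longrightarrow>
               alpha_mixing M (\<lambda>i \<omega>. (Y i \<omega>, X i \<omega>)) m \<le> \<gamma> * exp (- c * real m)"
    and A4: "integrable lborel \<rho>" "(LBINT y. \<bar>\<rho> y\<bar>) \<le> C1" "\<And>y. \<bar>\<rho> y\<bar> \<le> C2"
    and A5: "c0 > 0" "\<And>x. x \<in> unit_cube \<Longrightarrow> c0 \<le> f x"
    and A6_nonneg: "\<And>z. 0 \<le> fYX z" "\<And>m z. m \<ge> 1 \<Longrightarrow> 0 \<le> fYXYX m z"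
    and A6_density: "distributed M lborel (\<lambda>\<omega>. (Y 0 \<omega>, X 0 \<omega>)) (\<lambda>z. ennreal (fYX z))"
    and A6_joint: "\<And>m. m \<ge> 1 \<Longrightarrow>
          distributed M lborel (\<lambda>\<omega>. ((Y 0 \<omega>, X 0 \<omega>), (Y (int m) \<omega>, X (int m) \<omega>)))
            (\<lambda>z. ennreal (fYXYX m z))"
    and A6_bound: "\<And>m y x y' x'. m \<ge> 1 \<Longrightarrow> x \<in> unit_cube \<Longrightarrow> x' \<in> unit_cube \<Longrightarrow>
          \<bar>fYXYX m ((y, x), (y', x')) - fYX (y, x) * fYX (y', x')\<bar> \<le> C3"
    and R: "R \<ge> 1"
    and wavelets: "wavelet_system_01 R \<tau> K \<phi> \<psi> \<phi>w \<psi>w"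
    and kappa: "\<kappa> > 0" "C' > 0"
          "\<And>n j k. n \<ge> 2 \<Longrightarrow> \<tau> \<le> j \<Longrightarrow> 2 ^ j \<le> real n / ln (real n) ^ 3 \<Longrightarrow> k < 2 ^ j \<Longrightarrow>
             measure M {\<omega> \<in> space M.
               \<bar>b_hat \<phi>w \<psi>w \<rho> f Y X n j k l \<omega> - b_true \<phi>w \<psi>w g j k l\<bar> \<ge> \<kappa> * noise_level n / 2}
             \<le> C' / real n ^ 4"
    and Mstar: "\<And>r. r > 0 \<Longrightarrow> Mstar r > 0"
    and besov: "Mb > 0" "q \<ge> 1"
          "(p \<ge> 2 \<and> 0 < s \<and> s < real R) \<or> (1 \<le> p \<and> p < 2 \<and> 1 / p < s \<and> s < real R)"
          "gl l \<in> besov_ball \<psi>w \<tau> s p q (Mstar Mb)"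
  shows "\<exists>C>0. \<forall>n\<ge>2.
           (\<integral>\<^sup>+ \<omega>. (\<integral>\<^sup>+ x\<in>{0..1}. ennreal ((g_hat \<tau> \<phi>w \<psi>w \<rho> f Y X \<kappa> n l \<omega> x - gl l x)\<^sup>2) \<partial>lborel) \<partial>M)
             \<le> ennreal (C * (ln (real n) / real n) powr (2 * s / (2 * s + 1)))"
proof -
  let ?\<beta> = "wavelet_coeff \<psi>w (gl l)"
  let ?\<theta> = "2 * s / (2 * s + 1)"
  let ?\<delta> = "\<lambda>n. ln (real n) / real n"
  let ?L = "\<lambda>n. {j. \<tau> \<le> j \<and> 2 ^ j \<le> real n / ln (real n) ^ 3}"
  have gL2: "gl l \<in> L2_01"
    using besov(4) by (simp add: besov_ball_def)
  interpret prob_space M by fact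
  interpret additive_regression M Y X \<rho> g f gl \<phi> \<psi> \<phi>w \<psi>w \<mu> C2 c0 K R \<tau> l
    by (unfold_locales; (fact | (rule assms; assumption) | (simp add: A2)))
  \<comment> \<open>The target exponent contains \<open>s\<close> only, so passing to an exponent
    \<open>p' \<le> 2\<close> affects nothing but the constants.\<close>
  obtain p' B where p': "1 \<le> p'" "p' \<le> 2" "0 < B" "(p' = 2 \<and> 0 < s) \<or> (p' < 2 \<and> 1 / p' < s)"
    and lev: "\<And>j. \<tau> \<le> j \<Longrightarrow> (\<Sum>k<2 ^ j. \<bar>?\<beta> j k\<bar> powr p') \<le> B * 2 powr (- ((p' * (s + 1 / 2) - 1) * real j))"
    using besov_ball_reduce[OF besov(4,2) Mstar[OF besov(1)]] besov(3) by metis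
  have "0 < s" using p' by (auto intro: less_trans[of 0 "1 / p'" s])
  then have \<theta>: "0 < ?\<theta>" "?\<theta> < 1" by auto
  have A: "0 < 9 / 4 * \<kappa>\<^sup>2" using kappa(1) by simp
  have "\<exists>C>0. \<forall>\<delta>>0. \<forall>J. finite J \<longrightarrow> J \<subseteq> {\<tau>..} \<longrightarrow>
      (\<Sum>j\<in>J. \<Sum>k<2 ^ j. min ((?\<beta> j k)\<^sup>2) (9 / 4 * \<kappa>\<^sup>2 * \<delta>)) \<le> C * \<delta> powr ?\<theta>"
    by (rule oracle_rate[OF p'(1,2,4,3) A lev])
  then obtain Co where Co: "0 < Co" "\<forall>\<delta>>0. \<forall>J. finite J \<longrightarrow> J \<subseteq> {\<tau>..} \<longrightarrow>
      (\<Sum>j\<in>J. \<Sum>k<2 ^ j. min ((?\<beta> j k)\<^sup>2) (9 / 4 * \<kappa>\<^sup>2 * \<delta>)) \<le> Co * \<delta> powr ?\<theta>"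
    by (elim exE conjE)
  have "\<exists>C>0. \<forall>n\<ge>2. \<forall>J. finite J \<longrightarrow> J \<subseteq> {j. \<tau> \<le> j \<and> real n / ln (real n) ^ 3 < 2 ^ j} \<longrightarrow>
      (\<Sum>j\<in>J. \<Sum>k<2 ^ j. (?\<beta> j k)\<^sup>2) \<le> C * ?\<delta> n powr ?\<theta>"
    by (rule tail_rate[OF p'(1,2,4,3) A lev])
  then obtain Ct where Ct: "0 < Ct" "\<forall>n\<ge>2. \<forall>J. finite J \<longrightarrow> J \<subseteq> {j. \<tau> \<le> j \<and> real n / ln (real n) ^ 3 < 2 ^ j} \<longrightarrow>
      (\<Sum>j\<in>J. \<Sum>k<2 ^ j. (?\<beta> j k)\<^sup>2) \<le> Ct * ?\<delta> n powr ?\<theta>"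
    by (elim exE conjE)
  have "\<exists>C\<ge>0. \<forall>n\<ge>1. \<forall>k<2 ^ \<tau>.
      integrable M (\<lambda>\<omega>. (a_hat \<phi>w \<rho> f Y X n \<tau> k l \<omega> - (LBINT x:{0..1}. (\<mu> + gl l x) * \<phi>w \<tau> k x))\<^sup>2) \<and>
      expectation (\<lambda>\<omega>. (a_hat \<phi>w \<rho> f Y X n \<tau> k l \<omega> - (LBINT x:{0..1}. (\<mu> + gl l x) * \<phi>w \<tau> k x))\<^sup>2) \<le> C / real n"
    by (rule a_hat_risk[OF A3])
  then obtain Ca where Ca: "0 \<le> Ca" "\<forall>n\<ge>1. \<forall>k<2 ^ \<tau>.
      integrable M (\<lambda>\<omega>. (a_hat \<phi>w \<rho> f Y X n \<tau> k l \<omega> - (LBINT x:{0..1}. (\<mu> + gl l x) * \<phi>w \<tau> k x))\<^sup>2) \<and>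
      expectation (\<lambda>\<omega>. (a_hat \<phi>w \<rho> f Y X n \<tau> k l \<omega> - (LBINT x:{0..1}. (\<mu> + gl l x) * \<phi>w \<tau> k x))\<^sup>2) \<le> Ca / real n"
    by (elim exE conjE)
  have "\<exists>C\<ge>0. \<forall>n\<ge>1. integrable M (\<lambda>\<omega>. (mu_hat \<rho> Y n \<omega> - \<mu>)\<^sup>2) \<and>
      expectation (\<lambda>\<omega>. (mu_hat \<rho> Y n \<omega> - \<mu>)\<^sup>2) \<le> C / real n"
    by (rule mu_hat_risk[OF A3])
  then obtain Cm where Cm: "0 \<le> Cm" "\<forall>n\<ge>1. integrable M (\<lambda>\<omega>. (mu_hat \<rho> Y n \<omega> - \<mu>)\<^sup>2) \<and>
      expectation (\<lambda>\<omega>. (mu_hat \<rho> Y n \<omega> - \<mu>)\<^sup>2) \<le> Cm / real n"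
    by (elim exE conjE)
  obtain Bb where Bb: "0 \<le> Bb" "\<forall>j\<ge>\<tau>. \<forall>k<2 ^ j. \<bar>?\<beta> j k\<bar> \<le> Bb"
    using wavelet_coeff_bounded by (elim exE conjE)
  \<comment> \<open>Up to the factor \<open>2 powr (j / 2)\<close>, a common bound for the estimated
    and the true coefficients, as \<open>hard_threshold_risk\<close> requires.\<close>
  define D where "D = C2 * (K * K ^ card (UNIV - {l}) / c0) + Bb"
  have D0: "0 \<le> C2 * (K * K ^ card (UNIV - {l}) / c0)"
    using C2_nonneg K_nonneg c0 by simp
  define Cb where "Cb = 4 * D\<^sup>2 * C'"
  have "0 \<le> Cb" using kappa(2) by (simp add: Cb_def)
  define bt where "bt = (\<lambda>n j k \<omega>. b_hat \<phi>w \<psi>w \<rho> f Y X n j k l \<omega> *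
        (if \<bar>b_hat \<phi>w \<psi>w \<rho> f Y X n j k l \<omega>\<bar> \<ge> \<kappa> * noise_level n then 1 else 0))"
  have risk_b: "integrable M (\<lambda>\<omega>. (bt n j k \<omega> - ?\<beta> j k)\<^sup>2) \<and>
      expectation (\<lambda>\<omega>. (bt n j k \<omega> - ?\<beta> j k)\<^sup>2) \<le> min ((?\<beta> j k)\<^sup>2) (9 / 4 * \<kappa>\<^sup>2 * ?\<delta> n) + Cb / real n ^ 4 * 2 ^ j"
    if n: "2 \<le> n" and j: "j \<in> ?L n" and k: "k < 2 ^ j" for n j k
  proof -
    have j: "\<tau> \<le> j" "2 ^ j \<le> real n / ln (real n) ^ 3" using j by auto
    let ?D = "D * 2 powr (real j / 2)"
    have ge1: "1 \<le> 2 powr (real j / 2)" by (simp add: ge_one_powr_ge_zero)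
    have b1: "\<bar>b_hat \<phi>w \<psi>w \<rho> f Y X n j k l \<omega>\<bar> \<le> ?D" if "\<omega> \<in> space M" for \<omega>
    proof -
      have "\<bar>b_hat \<phi>w \<psi>w \<rho> f Y X n j k l \<omega>\<bar> \<le> C2 * (K * K ^ card (UNIV - {l}) / c0) * 2 powr (real j / 2)"
        using n by (intro b_hat_bound j k that) auto
      also have "\<dots> \<le> ?D"
        using Bb(1) by (intro mult_right_mono) (auto simp: D_def)
      finally show ?thesis .
    qed
    have b2: "\<bar>?\<beta> j k\<bar> \<le> ?D"
    proof -
      have "\<bar>?\<beta> j k\<bar> \<le> D * 1" using Bb(2)[rule_format, OF j(1) k] D0 by (simp add: D_def)
      also have "\<dots> \<le> ?D" using ge1 D0 Bb(1) by (intro mult_left_mono) (auto simp: D_def)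
      finally show ?thesis .
    qed
    have b3: "prob {\<omega> \<in> space M. \<bar>b_hat \<phi>w \<psi>w \<rho> f Y X n j k l \<omega> - ?\<beta> j k\<bar> \<ge> \<kappa> * noise_level n / 2} \<le> C' / real n ^ 4"
      using kappa(3)[OF n j k] by (simp add: b_true_eq[OF j(1) k])
    have nl: "(\<kappa> * noise_level n)\<^sup>2 = \<kappa>\<^sup>2 * ?\<delta> n"
      using n by (simp add: noise_level_def power_mult_distrib)
    have D2: "?D\<^sup>2 = D\<^sup>2 * 2 ^ j"
    proof -
      have "(2 powr (real j / 2))\<^sup>2 = 2 ^ j"
        by (simp add: powr_powr flip: powr_realpow powr_numeral)
      then show ?thesis by (simp add: power_mult_distrib)
    qed
    show ?thesis
      using hard_threshold_risk[OF b_hat_meas[OF j(1) k] b1 b2 b3]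
      by (simp add: bt_def nl D2 Cb_def mult_ac)
  qed
  \<comment> \<open>The factors 2 after \<open>Ca\<close>, 256 and \<open>Cm\<close> come from
    \<open>inverse_le_rate\<close>, the outer ones from separating the error of
    \<open>mu_hat\<close>; 256 is \<open>16 * 16\<close>, from the bound on the sum of
    \<open>2 ^ j\<close> below.\<close>
  define C where "C = 2 * (Ct + (2 ^ \<tau> * Ca * 2 + (Co + Cb * 256 * 2))) + 2 * (Cm * 2)"
  show ?thesis
  proof (intro exI[of _ C] conjI allI impI)
    show "0 < C"
      using Ct(1) Co(1) Ca(1) Cm(1) \<open>0 \<le> Cb\<close> by (simp add: C_def add_pos_nonneg)
    fix n :: nat assume n: "2 \<le> n"
    then have n1: "1 \<le> n" by simp
    let ?r = "?\<delta> n powr ?\<theta>"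
    have r: "1 / real n \<le> 2 * ?r"
      using inverse_le_rate[OF n \<theta>] .
    have fL: "finite (?L n)" by (rule finite_levels)
    define Ea where "Ea = (\<lambda>\<omega>. \<Sum>k<2 ^ \<tau>. (a_hat \<phi>w \<rho> f Y X n \<tau> k l \<omega> - (LBINT x:{0..1}. (\<mu> + gl l x) * \<phi>w \<tau> k x))\<^sup>2)"
    define Eb where "Eb = (\<lambda>\<omega>. \<Sum>j\<in>?L n. \<Sum>k<2 ^ j. (bt n j k \<omega> - ?\<beta> j k)\<^sup>2)"
    define Em where "Em = (\<lambda>\<omega>. (mu_hat \<rho> Y n \<omega> - \<mu>)\<^sup>2)"
    have ia: "integrable M Ea"
      unfolding Ea_def using Ca(2) n1 by (intro Bochner_Integration.integrable_sum) auto
    have ib: "integrable M Eb"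
      unfolding Eb_def using risk_b[OF n] by (intro Bochner_Integration.integrable_sum) auto
    have im: "integrable M Em"
      unfolding Em_def using Cm(2) n1 by simp
    have ea: "expectation Ea \<le> 2 ^ \<tau> * Ca * 2 * ?r"
    proof -
      have "expectation Ea = (\<Sum>k<2 ^ \<tau>. expectation (\<lambda>\<omega>. (a_hat \<phi>w \<rho> f Y X n \<tau> k l \<omega> - (LBINT x:{0..1}. (\<mu> + gl l x) * \<phi>w \<tau> k x))\<^sup>2))"
        unfolding Ea_def using Ca(2) n1 by (intro Bochner_Integration.integral_sum) auto
      also have "\<dots> \<le> (\<Sum>k<2 ^ \<tau>::nat. Ca / real n)"
        using Ca(2) n1 by (intro sum_mono) auto
      also have "\<dots> = 2 ^ \<tau> * Ca * (1 / real n)" by simp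
      also have "\<dots> \<le> 2 ^ \<tau> * Ca * (2 * ?r)"
        using r Ca(1) by (intro mult_left_mono) auto
      finally show ?thesis by simp
    qed
    have em: "expectation Em \<le> Cm * 2 * ?r"
    proof -
      have "expectation Em \<le> Cm * (1 / real n)"
        unfolding Em_def using Cm(2) n1 by simp
      also have "\<dots> \<le> Cm * (2 * ?r)"
        using r Cm(1) by (intro mult_left_mono) auto
      finally show ?thesis by simp
    qed
    have small: "(\<Sum>j\<in>?L n. \<Sum>k<2 ^ j::nat. Cb / real n ^ 4 * 2 ^ j) \<le> Cb * 256 * (2 * ?r)"
    proof -
      \<comment> \<open>By \<open>1 / 2 \<le> ln n\<close> the sum is at most
        \<open>2 * n / (1 / 2) ^ 3\<close>, which is \<open>16 * n\<close>.\<close>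
      have "(\<Sum>j\<in>?L n. (2::real) ^ j) \<le> 2 * (real n / ln (real n) ^ 3)"
        using n by (intro sum_power2_le fL) auto
      also have "real n / ln (real n) ^ 3 \<le> real n / (1 / 2) ^ 3"
        using half_le_ln[OF n] n by (intro divide_left_mono power_mono mult_pos_pos) auto
      finally have le: "(\<Sum>j\<in>?L n. (2::real) ^ j) \<le> 16 * real n"
        by (simp add: power3_eq_cube)
      \<comment> \<open>Level \<open>j\<close> has \<open>2 ^ j\<close> coefficients, each with a
        residue proportional to \<open>2 ^ j\<close>. The sum of \<open>4 ^ j\<close> is at most
        \<open>(16 * n)^2\<close>, so division by \<open>n ^ 4\<close> leaves order
        \<open>1 / n^2\<close>.\<close>
      have "(\<Sum>j\<in>?L n. \<Sum>k<2 ^ j::nat. Cb / real n ^ 4 * 2 ^ j) = Cb / real n ^ 4 * (\<Sum>j\<in>?L n. 2 ^ j * 2 ^ j)"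
        by (simp add: sum_distrib_left mult_ac)
      also have "\<dots> \<le> Cb / real n ^ 4 * (\<Sum>j\<in>?L n. 2 ^ j * (16 * real n))"
        using \<open>0 \<le> Cb\<close> le fL
        by (intro mult_left_mono sum_mono) (auto intro: order_trans[OF member_le_sum le])
      also have "\<dots> = Cb / real n ^ 4 * (16 * real n) * (\<Sum>j\<in>?L n. 2 ^ j)"
        by (simp add: sum_distrib_left mult_ac)
      also have "\<dots> \<le> Cb / real n ^ 4 * (16 * real n) * (16 * real n)"
        using \<open>0 \<le> Cb\<close> le by (intro mult_left_mono) auto
      also have "\<dots> = Cb * 256 * (1 / real n) * (1 / real n)"
        using n by (simp add: field_simps power_numeral_reduce)
      also have "\<dots> \<le> Cb * 256 * (1 / real n) * 1"
        using \<open>0 \<le> Cb\<close> n by (intro mult_left_mono) auto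
      also have "\<dots> \<le> Cb * 256 * (2 * ?r)"
        unfolding mult_1_right using \<open>0 \<le> Cb\<close> r by (intro mult_left_mono) auto
      finally show ?thesis .
    qed
    have eb: "expectation Eb \<le> (Co + Cb * 256 * 2) * ?r"
    proof -
      have "expectation Eb = (\<Sum>j\<in>?L n. \<Sum>k<2 ^ j. expectation (\<lambda>\<omega>. (bt n j k \<omega> - ?\<beta> j k)\<^sup>2))"
        unfolding Eb_def using risk_b[OF n]
        by (subst Bochner_Integration.integral_sum)
          (auto intro!: Bochner_Integration.integrable_sum sum.cong Bochner_Integration.integral_sum)
      also have "\<dots> \<le> (\<Sum>j\<in>?L n. \<Sum>k<2 ^ j. min ((?\<beta> j k)\<^sup>2) (9 / 4 * \<kappa>\<^sup>2 * ?\<delta> n) + Cb / real n ^ 4 * 2 ^ j)"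
        using risk_b[OF n] by (intro sum_mono) auto
      also have "\<dots> = (\<Sum>j\<in>?L n. \<Sum>k<2 ^ j. min ((?\<beta> j k)\<^sup>2) (9 / 4 * \<kappa>\<^sup>2 * ?\<delta> n))
          + (\<Sum>j\<in>?L n. \<Sum>k<2 ^ j::nat. Cb / real n ^ 4 * 2 ^ j)"
        unfolding sum.distrib ..
      also have "\<dots> \<le> Co * ?r + Cb * 256 * (2 * ?r)"
        using n fL by (intro add_mono small Co(2)[rule_format]) auto
      finally show ?thesis by (simp add: algebra_simps)
    qed
    \<comment> \<open>An integrable majorant for every \<omega>: the risk is a nonnegative integral,
      so monotonicity is enough and finiteness of the risk comes with the bound.\<close>
    define U where "U = (\<lambda>\<omega>. 2 * (Ct * ?r + (Ea \<omega> + Eb \<omega>)) + 2 * Em \<omega>)"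
    have iU: "integrable M U"
      unfolding U_def using ia ib im by auto
    have nnU: "0 \<le> U \<omega>" for \<omega>
      unfolding U_def Ea_def Eb_def Em_def using Ct(1)
      by (intro add_nonneg_nonneg mult_nonneg_nonneg sum_nonneg) auto
    have "(\<integral>\<^sup>+ \<omega>. (\<integral>\<^sup>+ x\<in>{0..1}. ennreal ((g_hat \<tau> \<phi>w \<psi>w \<rho> f Y X \<kappa> n l \<omega> x - gl l x)\<^sup>2) \<partial>lborel) \<partial>M)
        \<le> (\<integral>\<^sup>+ \<omega>. ennreal (U \<omega>) \<partial>M)"
      unfolding U_def Ea_def Eb_def Em_def bt_def
      by (intro nn_integral_mono integrated_squared_error_le[OF n Ct(2)[rule_format, OF n]])
    also have "\<dots> = ennreal (expectation U)"
      using iU nnU by (intro nn_integral_eq_integral) auto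
    also have "expectation U = 2 * (Ct * ?r + (expectation Ea + expectation Eb)) + 2 * expectation Em"
      unfolding U_def using ia ib im by (simp add: prob_space)
    also have "ennreal \<dots> \<le> ennreal (C * ?r)"
    proof (rule ennreal_leI)
      have "2 * (Ct * ?r + (expectation Ea + expectation Eb)) + 2 * expectation Em
          \<le> 2 * (Ct * ?r + (2 ^ \<tau> * Ca * 2 * ?r + (Co + Cb * 256 * 2) * ?r)) + 2 * (Cm * 2 * ?r)"
        by (intro add_mono mult_left_mono order_refl ea eb em) auto
      also have "\<dots> = C * ?r"
        unfolding C_def by (simp only: distrib_right mult.assoc)
      finally show "2 * (Ct * ?r + (expectation Ea + expectation Eb)) + 2 * expectation Em \<le> C * ?r" .
    qed
    finally show "(\<integral>\<^sup>+ \<omega>. (\<integral>\<^sup>+ x\<in>{0..1}. ennreal ((g_hat \<tau> \<phi>w \<psi>w \<rho> f Y X \<kappa> n l \<omega> x - gl l x)\<^sup>2) \<partial>lborel) \<partial>M)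
        \<le> ennreal (C * ?r)" .
  qed
qed

end
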